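(* Let $(Z_1,Z_2)$ be a pair of processes satisfying the functional limit condition with parameters $(\mu,h,\ell,Y_1,Y_2)$, let $0<\nu<\frac1{1-h}$, and suppose that the no-early-stopping condition holds for $Z_2$ with exponent $\nu$ (all defined in the context). For $c>0$ and $\varepsilon>0$ define $$T_c(\varepsilon):=\inf\Big\{n\in\mathbb N:\ n>\varepsilon^{-\nu},\ c\sqrt{Z_2(n)/n^2}<\varepsilon\Big\},\qquad \Phi_c(u):=\inf\Big\{s>0:\ c\,\frac{\sqrt{Y_2(s)}}{s}<u\Big\},\quad u>0,$$ with $\inf\varnothing=+\infty$. Then for every fixed $c>0$: (a) As $\varepsilon\to0^+$, the processes $u\mapsto a_\varepsilon^{-1}T_c(\varepsilon/u)$ converge weakly to $u\mapsto\Phi_c(1/u)$ in the $M_1$ topology locally on $(0,\infty)$. (b) For any $t>0$ and $a>0$, $\Phi_c(at)\overset{d}{=}a^{\frac1{h-1}}\Phi_c(t)$. Moreover, $\Phi_c(t)<\infty$ almost surely. (c) $\varepsilon^{\gamma}T_c(\varepsilon)\to0$ in probability as $\varepsilon\to 0^+$ whenever $\gamma>\frac1{1-h}$. (d) For every $u>0$ at which $\Phi_c(\cdot)$ is almost surely continuous, $\Phi_c(u)$ is an $\mathbb F^Y$-predictable stopping time.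
   Context: Topologies. Write $\mathbb D=D([0,\infty),\mathbb R)$ and $\mathbb D_+=D([0,\infty),\mathbb R_+)$ for càdlàg paths. For a càdlàg $x$ on a compact interval $[a,b]$, its completed graph is $\Gamma_x=\{(t,z): t\in[a,b],\ z$ between $x(t-)$ and $x(t)$ inclusive$\}$, with $x(a-):=x(a)$. The $M_2$ topology on $D([a,b],\mathbb R)$ is induced by the Hausdorff distance between completed graphs. The $M_1$ topology is induced by the metric $\inf\max(\|\lambda_1-\lambda_2\|_\infty,\|\rho_1-\rho_2\|_\infty)$ over parametric representations, a parametric representation of $x$ being a continuous map $(\lambda,\rho)$ of $[0,1]$ onto $\Gamma_x$ that is nondecreasing for the order $(t,z)\le(t',z')$ iff $t<t'$, or $t=t'$ and $|x(t-)-z|\le|x(t-)-z'|$. Convergence on $[0,\infty)$ (resp. locally on $(0,\infty)$) means convergence of the restrictions to $[0,T]$ (resp. $[a,b]\subset(0,\infty)$) whenever the endpoints are continuity points of the limit. $\mathrm{WM}_i$ ($i=1,2$) denotes the product of the univariate $M_i$ topologies over the two coordinates. Functional limit condition with parameters $(\mu,h,\ell,Y_1,Y_2)$. $Z_1,Z_2$ are processes with sample paths in $\mathbb D$ and $\mathbb D_+$, $Z_1(0)=0$ a.s.; $\mu,h\in\mathbb R$; $\ell$ is an eventually positive function slowly varying at infinity; $Y_1\in\mathbb D$, $Y_2\in\mathbb D_+$ are processes such that, as $\varepsilon\to0^+$, $$\Big(\varepsilon^h\ell(\varepsilon^{-1})\big(Z_1(\tfrac{\cdot}{\varepsilon})-\tfrac{\cdot}{\varepsilon}\mu\big),\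 \varepsilon^h\ell(\varepsilon^{-1})\sqrt{Z_2(\tfrac{\cdot}{\varepsilon})}\Big)\Rightarrow\big(Y_1(\cdot),\sqrt{Y_2(\cdot)}\big)\quad\text{weakly in }\mathrm{WM}_2.$$ Let $\mathbb F^Y=(\mathcal F^Y_t)_{t\ge0}$ be the usual augmentation of the natural filtration of $(Y_1,Y_2)$. Moreover: (a) $0<h<1$; (b) as $t\to\infty$, $(Z_1(t)-\mu t)/t\to0$ and $Z_2(t)/t^2\to0$ a.s.; (c) for every $a>0$, $(Y_1(a\,\cdot),Y_2(a\,\cdot))\overset d=(a^hY_1(\cdot),a^{2h}Y_2(\cdot))$; (d) $Y_1$ is quasi-left-continuous with respect to $\mathbb F^Y$: for every finite $\mathbb F^Y$-predictable stopping time $\tau$, $\mathbb P(\Delta Y_1(\tau)=0)=1$; (e) almost surely $Y_2(t)>0$ for every $t>0$, and $Y_2$ has no negative jumps. Time scale. $A(x):=x^{1-h}\ell(x)$ and $a_\varepsilon:=A^{\leftarrow}(\varepsilon^{-1})$, where $A^{\leftarrow}$ is an asymptotic inverse of $A$ (so $A(A^\leftarrow(x))\sim x$ as $x\to\infty$). No-early-stopping condition for $Z_2$ with exponent $\nu$: for every $K>0$, $$\lim_{\eta\downarrow0}\limsup_{\varepsilon\downarrow0}\mathbb P\Big(\inf_{n\in\mathbb N:\ \varepsilon^{-\nu}\le n\le\eta a_\varepsilon}\frac{\sqrt{Z_2(n)}}{n}\le K\varepsilon\Big)=0.$$ *)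

theory Defs
  imports "HOL-Probability.Probability"
begin

section \<open>Cadlag paths and the Skorohod M1 and M2 topologies\<close>

definition cadlag_on :: "real set \<Rightarrow> (real \<Rightarrow> real) \<Rightarrow> bool" where
  "cadlag_on I x \<longleftrightarrow> (\<forall>t\<in>I.
     (x \<longlongrightarrow> x t) (at t within (I \<inter> {t<..})) \<and>
     (\<exists>l. (x \<longlongrightarrow> l) (at t within (I \<inter> {..<t}))))"

text \<open>Elements are functions on \<^term>\<open>I\<close>, made unique as HOL functions by extensionality.\<close>

definition cadlag_space :: "real set \<Rightarrow> (real \<Rightarrow> real) set" where
  "cadlag_space I = {x \<in> extensional I. cadlag_on I x}"

text \<open>The left limit \<open>x(t-)\<close> of a path whose time interval starts at \<open>a\<close>, with \<open>x(a-) = x(a)\<close>.\<close>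

definition left_lim :: "real \<Rightarrow> (real \<Rightarrow> real) \<Rightarrow> real \<Rightarrow> real" where
  "left_lim a x t = (if t \<le> a then x t else Lim (at_left t) x)"

definition completed_graph :: "real \<Rightarrow> real \<Rightarrow> (real \<Rightarrow> real) \<Rightarrow> (real \<times> real) set" where
  "completed_graph a b x = {(t, z). a \<le> t \<and> t \<le> b \<and> z \<in> closed_segment (left_lim a x t) (x t)}"

definition hausdorff_dist :: "'a::metric_space set \<Rightarrow> 'a set \<Rightarrow> real" where
  "hausdorff_dist A B = max (SUP p\<in>A. infdist p B) (SUP q\<in>B. infdist q A)"

text \<open>The two distances below depend on the values of \<open>x\<close> and \<open>y\<close> in \<open>[a, b]\<close> only, so for paths on
  a larger time set they are the distances of the restrictions to \<open>[a, b]\<close>.\<close>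

definition M2_dist :: "real \<Rightarrow> real \<Rightarrow> (real \<Rightarrow> real) \<Rightarrow> (real \<Rightarrow> real) \<Rightarrow> real" where
  "M2_dist a b x y = hausdorff_dist (completed_graph a b x) (completed_graph a b y)"

definition graph_le :: "real \<Rightarrow> (real \<Rightarrow> real) \<Rightarrow> real \<times> real \<Rightarrow> real \<times> real \<Rightarrow> bool" where
  "graph_le a x p q \<longleftrightarrow> fst p < fst q \<or>
     (fst p = fst q \<and> \<bar>left_lim a x (fst p) - snd p\<bar> \<le> \<bar>left_lim a x (fst p) - snd q\<bar>)"

definition parametric_rep :: "real \<Rightarrow> real \<Rightarrow> (real \<Rightarrow> real) \<Rightarrow> (real \<Rightarrow> real \<times> real) \<Rightarrow> bool" where
  "parametric_rep a b x p \<longleftrightarrow> continuous_on {0..1} p \<and> p ` {0..1} = completed_graph a b x \<and>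
     (\<forall>s\<in>{0..1}. \<forall>s'\<in>{0..1}. s \<le> s' \<longrightarrow> graph_le a x (p s) (p s'))"

definition M1_dist :: "real \<Rightarrow> real \<Rightarrow> (real \<Rightarrow> real) \<Rightarrow> (real \<Rightarrow> real) \<Rightarrow> real" where
  "M1_dist a b x y = Inf {max (SUP s\<in>{0..1}. \<bar>fst (p s) - fst (q s)\<bar>)
                              (SUP s\<in>{0..1}. \<bar>snd (p s) - snd (q s)\<bar>) | p q.
                          parametric_rep a b x p \<and> parametric_rep a b y q}"

definition converges_half_line ::
    "(real \<Rightarrow> real \<Rightarrow> (real \<Rightarrow> real) \<Rightarrow> (real \<Rightarrow> real) \<Rightarrow> real) \<Rightarrow>
     (nat \<Rightarrow> real \<Rightarrow> real) \<Rightarrow> (real \<Rightarrow> real) \<Rightarrow> bool" where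
  "converges_half_line d xs x \<longleftrightarrow>
     (\<forall>T>0. isCont x T \<longrightarrow> (\<lambda>n. d 0 T (xs n) x) \<longlonglongrightarrow> 0)"

definition converges_locally ::
    "(real \<Rightarrow> real \<Rightarrow> (real \<Rightarrow> real) \<Rightarrow> (real \<Rightarrow> real) \<Rightarrow> real) \<Rightarrow>
     (nat \<Rightarrow> real \<Rightarrow> real) \<Rightarrow> (real \<Rightarrow> real) \<Rightarrow> bool" where
  "converges_locally d xs x \<longleftrightarrow>
     (\<forall>a b. 0 < a \<and> a < b \<and> isCont x a \<and> isCont x b \<longrightarrow> (\<lambda>n. d a b (xs n) x) \<longlonglongrightarrow> 0)"

text \<open>On unbounded time sets the topologies are specified through their convergent sequences. These
  topologies are metrizable, hence sequential, so the open sets are the sequentially open ones.\<close>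

definition sequential_topology :: "'a set \<Rightarrow> ((nat \<Rightarrow> 'a) \<Rightarrow> 'a \<Rightarrow> bool) \<Rightarrow> 'a topology" where
  "sequential_topology S conv = topology (\<lambda>U. U \<subseteq> S \<and>
     (\<forall>x\<in>U. \<forall>xs. (\<forall>n. xs n \<in> S) \<and> conv xs x \<longrightarrow> (\<forall>\<^sub>F n in sequentially. xs n \<in> U)))"

lemma openin_sequential_topology:
  "openin (sequential_topology S conv) U \<longleftrightarrow> U \<subseteq> S \<and>
     (\<forall>x\<in>U. \<forall>xs. (\<forall>n. xs n \<in> S) \<and> conv xs x \<longrightarrow> (\<forall>\<^sub>F n in sequentially. xs n \<in> U))"
proof -
  have "istopology (\<lambda>U. U \<subseteq> S \<and>
     (\<forall>x\<in>U. \<forall>xs. (\<forall>n. xs n \<in> S) \<and> conv xs x \<longrightarrow> (\<forall>\<^sub>F n in sequentially. xs n \<in> U)))"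
    unfolding istopology_def
  proof (intro conjI allI impI ballI)
    fix K x xs
    assume "\<forall>U\<in>K. U \<subseteq> S \<and>
      (\<forall>x\<in>U. \<forall>xs. (\<forall>n. xs n \<in> S) \<and> conv xs x \<longrightarrow> (\<forall>\<^sub>F n in sequentially. xs n \<in> U))"
      and "x \<in> \<Union>K" "(\<forall>n. xs n \<in> S) \<and> conv xs x"
    then obtain U where "U \<in> K" "\<forall>\<^sub>F n in sequentially. xs n \<in> U" by blast
    then show "\<forall>\<^sub>F n in sequentially. xs n \<in> \<Union>K" by (auto elim: eventually_mono)
  qed (auto simp: eventually_conj_iff)
  then show ?thesis
    unfolding sequential_topology_def by (simp add: topology_inverse')
qed

lemma topspace_sequential_topology [simp]: "topspace (sequential_topology S conv) = S"
proof
  show "topspace (sequential_topology S conv) \<subseteq> S"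
    using openin_topspace openin_sequential_topology by metis
  have "openin (sequential_topology S conv) S"
    by (simp add: openin_sequential_topology)
  then show "S \<subseteq> topspace (sequential_topology S conv)" by (rule openin_subset)
qed

definition M2_topology :: "(real \<Rightarrow> real) topology" where
  "M2_topology = sequential_topology (cadlag_space {0..}) (converges_half_line M2_dist)"

definition WM2_topology :: "((real \<Rightarrow> real) \<times> (real \<Rightarrow> real)) topology" where
  "WM2_topology = prod_topology M2_topology M2_topology"

definition M1_local_topology :: "(real \<Rightarrow> real) topology" where
  "M1_local_topology = sequential_topology (cadlag_space {0<..}) (converges_locally M1_dist)"


section \<open>Weak convergence\<close>

text \<open>A random element is only required to take values in the space almost surely; the completion
  makes its measurability and the expectations below insensitive to the exceptional null set.\<close>

definition random_element :: "'a measure \<Rightarrow> 's topology \<Rightarrow> ('a \<Rightarrow> 's) \<Rightarrow> bool" where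
  "random_element M \<tau> X \<longleftrightarrow> (AE \<omega> in M. X \<omega> \<in> topspace \<tau>) \<and>
     (\<forall>U. openin \<tau> U \<longrightarrow> X -` U \<inter> space M \<in> sets (completion M))"

definition converges_weakly ::
    "'i filter \<Rightarrow> 's topology \<Rightarrow> 'a measure \<Rightarrow> ('i \<Rightarrow> 'a \<Rightarrow> 's) \<Rightarrow> 'b measure \<Rightarrow> ('b \<Rightarrow> 's) \<Rightarrow> bool" where
  "converges_weakly F \<tau> M X N Y \<longleftrightarrow>
     (\<forall>\<^sub>F i in F. random_element M \<tau> (X i)) \<and> random_element N \<tau> Y \<and>
     (\<forall>f :: 's \<Rightarrow> real. continuous_map \<tau> euclideanreal f \<and> bounded (f ` topspace \<tau>) \<longrightarrow>
        ((\<lambda>i. \<integral>\<omega>. f (X i \<omega>) \<partial>completion M) \<longlongrightarrow> (\<integral>\<omega>. f (Y \<omega>) \<partial>completion N)) F)"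


section \<open>Filtrations and predictable times\<close>

text \<open>Time is \<open>[0, \<infinity>]\<close>, so that stopping times may be infinite.\<close>

definition natural_generator ::
    "'a measure \<Rightarrow> (real \<Rightarrow> 'a \<Rightarrow> 's::topological_space) \<Rightarrow> ennreal \<Rightarrow> 'a set set" where
  "natural_generator M X t =
     {X s -` B \<inter> space M | s B. 0 \<le> s \<and> ennreal s \<le> t \<and> B \<in> sets borel}"

text \<open>Complete the natural filtration with all subsets of null sets and make it right-continuous.
  The disjunct \<open>s = \<infinity>\<close> changes nothing for finite \<open>t\<close> and gives the completed terminal
  sigma-algebra at \<open>t = \<infinity>\<close>.\<close>

definition usual_augmentation ::
    "'a measure \<Rightarrow> (real \<Rightarrow> 'a \<Rightarrow> 's::topological_space) \<Rightarrow> ennreal \<Rightarrow> 'a measure" where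
  "usual_augmentation M X t = sigma (space M)
     (\<Inter>s\<in>{s. t < s \<or> s = \<infinity>}.
        sigma_sets (space M) (natural_generator M X s \<union> null_sets (completion M)))"

text \<open>A predictable time is one announced almost surely by a sequence of stopping times.\<close>

definition predictable_time ::
    "'a measure \<Rightarrow> (ennreal \<Rightarrow> 'a measure) \<Rightarrow> ('a \<Rightarrow> ennreal) \<Rightarrow> bool" where
  "predictable_time P F \<tau> \<longleftrightarrow> stopping_time F \<tau> \<and>
     (\<exists>\<sigma> :: nat \<Rightarrow> 'a \<Rightarrow> ennreal. (\<forall>n. stopping_time F (\<sigma> n)) \<and>
        (AE \<omega> in P. incseq (\<lambda>n. \<sigma> n \<omega>) \<and> (\<lambda>n. \<sigma> n \<omega>) \<longlonglongrightarrow> \<tau> \<omega> \<and>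
           (0 < \<tau> \<omega> \<longrightarrow> (\<forall>n. \<sigma> n \<omega> < \<tau> \<omega>))))"

definition quasi_left_continuous ::
    "'a measure \<Rightarrow> (ennreal \<Rightarrow> 'a measure) \<Rightarrow> (real \<Rightarrow> 'a \<Rightarrow> real) \<Rightarrow> bool" where
  "quasi_left_continuous P F X \<longleftrightarrow>
     (\<forall>\<tau>. predictable_time P F \<tau> \<and> (\<forall>\<omega>\<in>space P. \<tau> \<omega> < \<infinity>) \<longrightarrow>
        (AE \<omega> in P. X (enn2real (\<tau> \<omega>)) \<omega> - left_lim 0 (\<lambda>t. X t \<omega>) (enn2real (\<tau> \<omega>)) = 0))"


section \<open>The functional limit condition\<close>

definition slowly_varying :: "(real \<Rightarrow> real) \<Rightarrow> bool" where
  "slowly_varying L \<longleftrightarrow>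
     (\<exists>x0. L \<in> borel_measurable (restrict_space borel {x0..}) \<and> (\<forall>x\<ge>x0. 0 < L x)) \<and>
     (\<forall>r>0. ((\<lambda>x. L (r * x) / L x) \<longlongrightarrow> 1) at_top)"

definition cadlag_process :: "'a measure \<Rightarrow> (real \<Rightarrow> 'a \<Rightarrow> real) \<Rightarrow> bool" where
  "cadlag_process M X \<longleftrightarrow> (\<forall>t\<ge>0. X t \<in> borel_measurable M) \<and>
     (\<forall>\<omega>\<in>space M. cadlag_on {0..} (\<lambda>t. X t \<omega>))"

locale functional_limit =
  M: prob_space M + N: prob_space N
  for M :: "'a measure" and Z1 Z2 :: "real \<Rightarrow> 'a \<Rightarrow> real"
    and \<mu> h :: real and L :: "real \<Rightarrow> real"
    and N :: "'b measure" and Y1 Y2 :: "real \<Rightarrow> 'b \<Rightarrow> real" +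
  assumes Z1_cadlag: "cadlag_process M Z1"
    and Z2_cadlag: "cadlag_process M Z2"
    and Z2_nonneg: "\<And>\<omega> t. \<omega> \<in> space M \<Longrightarrow> 0 \<le> t \<Longrightarrow> 0 \<le> Z2 t \<omega>"
    and Z1_zero: "AE \<omega> in M. Z1 0 \<omega> = 0"
    and L_slowly_varying: "slowly_varying L"
    and Y1_cadlag: "cadlag_process N Y1"
    and Y2_cadlag: "cadlag_process N Y2"
    and Y2_nonneg: "\<And>\<omega> t. \<omega> \<in> space N \<Longrightarrow> 0 \<le> t \<Longrightarrow> 0 \<le> Y2 t \<omega>"
    and weak_limit: "converges_weakly (at_right 0) WM2_topology
       M (\<lambda>\<epsilon> \<omega>. (\<lambda>t\<in>{0..}. \<epsilon> powr h * L (1 / \<epsilon>) * (Z1 (t / \<epsilon>) \<omega> - t / \<epsilon> * \<mu>),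
                 \<lambda>t\<in>{0..}. \<epsilon> powr h * L (1 / \<epsilon>) * sqrt (Z2 (t / \<epsilon>) \<omega>)))
       N (\<lambda>\<omega>. (\<lambda>t\<in>{0..}. Y1 t \<omega>, \<lambda>t\<in>{0..}. sqrt (Y2 t \<omega>)))"
    and h_range: "0 < h" "h < 1"
    and Z1_lln: "AE \<omega> in M. ((\<lambda>t. (Z1 t \<omega> - \<mu> * t) / t) \<longlongrightarrow> 0) at_top"
    and Z2_lln: "AE \<omega> in M. ((\<lambda>t. Z2 t \<omega> / t\<^sup>2) \<longlongrightarrow> 0) at_top"
    and self_similar: "\<And>a. 0 < a \<Longrightarrow>
       distr N (Pi\<^sub>M {0..} (\<lambda>_. borel)) (\<lambda>\<omega>. \<lambda>t\<in>{0..}. (Y1 (a * t) \<omega>, Y2 (a * t) \<omega>)) =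
       distr N (Pi\<^sub>M {0..} (\<lambda>_. borel))
         (\<lambda>\<omega>. \<lambda>t\<in>{0..}. (a powr h * Y1 t \<omega>, a powr (2 * h) * Y2 t \<omega>))"
    and Y1_quasi_left_continuous:
      "quasi_left_continuous N (usual_augmentation N (\<lambda>t \<omega>. (Y1 t \<omega>, Y2 t \<omega>))) Y1"
    and Y2_pos: "AE \<omega> in N. \<forall>t>0. 0 < Y2 t \<omega>"
    and Y2_no_neg_jumps: "AE \<omega> in N. \<forall>t>0. left_lim 0 (\<lambda>t. Y2 t \<omega>) t \<le> Y2 t \<omega>"

definition asymptotic_inverse :: "(real \<Rightarrow> real) \<Rightarrow> (real \<Rightarrow> real) \<Rightarrow> bool" where
  "asymptotic_inverse A B \<longleftrightarrow> filterlim B at_top at_top \<and>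
     (\<lambda>x. A (B x)) \<sim>[at_top] (\<lambda>x. x) \<and> (\<lambda>x. B (A x)) \<sim>[at_top] (\<lambda>x. x)"

text \<open>The infimum is taken in \<^typ>\<open>ereal\<close>, so over an empty range of indices it is \<open>\<infinity>\<close>.\<close>

definition no_early_stopping ::
    "'a measure \<Rightarrow> (real \<Rightarrow> 'a \<Rightarrow> real) \<Rightarrow> (real \<Rightarrow> real) \<Rightarrow> real \<Rightarrow> bool" where
  "no_early_stopping M Z2 a \<nu> \<longleftrightarrow> (\<forall>K>0.
     ((\<lambda>\<eta>. Limsup (at_right 0) (\<lambda>\<epsilon>. emeasure M {\<omega> \<in> space M.
         (INF n\<in>{n::nat. \<epsilon> powr (-\<nu>) \<le> real n \<and> real n \<le> \<eta> * a \<epsilon>}.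
            ereal (sqrt (Z2 (real n) \<omega>) / real n)) \<le> ereal (K * \<epsilon>)}))
      \<longlongrightarrow> 0) (at_right 0))"


section \<open>The stopping rule and its limit\<close>

text \<open>Both times are infinite when no index qualifies. Under the functional limit condition this
  happens, for some argument, only on a null set; where real-valued paths are formed from these times
  by \<^const>\<open>enn2real\<close>, the value \<open>0\<close> replacing \<open>\<infinity>\<close> is therefore immaterial.\<close>

definition stopping_rule ::
    "(real \<Rightarrow> 'a \<Rightarrow> real) \<Rightarrow> real \<Rightarrow> real \<Rightarrow> real \<Rightarrow> 'a \<Rightarrow> ennreal" where
  "stopping_rule Z2 \<nu> c \<epsilon> \<omega> =
     (INF n\<in>{n::nat. real n > \<epsilon> powr (-\<nu>) \<and> c * sqrt (Z2 (real n) \<omega> / (real n)\<^sup>2) < \<epsilon>}. of_nat n)"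

definition limit_passage :: "(real \<Rightarrow> 'b \<Rightarrow> real) \<Rightarrow> real \<Rightarrow> real \<Rightarrow> 'b \<Rightarrow> ennreal" where
  "limit_passage Y2 c u \<omega> = (INF s\<in>{s. 0 < s \<and> c * (sqrt (Y2 s \<omega>) / s) < u}. ennreal s)"

end

theory Submission
  imports Defs
begin

text \<open>The event \<open>T (\<epsilon> / u) > s * a \<epsilon>\<close> says that the rescaled path of \<open>sqrt Z2\<close> stays above the line of slope
  \<open>1 / (c * u)\<close> at the integer times up to \<open>s * a \<epsilon>\<close>. Away from time zero this is squeezed between events
  that the completed graph avoids a given closed set, and the infimum over the completed graph of a
  truncated distance to such a set is M2-continuous; near time zero one uses the no-early-stopping
  condition. Hence finitely many events \<open>T (\<epsilon> / u) > s * a \<epsilon>\<close> converge jointly in probability to the events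
  \<open>\<Phi> (1 / u) > s\<close>, provided \<open>s\<close> avoids countably many atoms; self-similarity excludes fixed jumps of
  \<open>u \<mapsto> \<Phi> (1 / u)\<close>. Both processes are monotone in \<open>u\<close>, and a monotone path is determined, M1-continuously, by
  countably many such comparisons. For predictability, \<open>\<Phi> u\<close> is announced by \<open>\<Phi> (u + 1 / n)\<close>.\<close>

text \<open>All lines in question pass through the origin, so a graph can keep a positive distance
  from such a line only away from time zero; this is why the start needs a separate condition.
  Elsewhere avoidance is stable only with a margin, and the two inequalities use different margins:
  \<open>T_upper\<close> ends at the event that \<open>\<Phi>\<close> is at least s,
  \<open>T_lower\<close> at a perturbed event with a later time and a steeper line. Absence of atoms
  closes the first gap. The second is a left-continuity statement in u: scaling gives the perturbed
  events the same limiting probability as the unperturbed one, and inclusion then forces almost sure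
  equality. Slow variation enters through Potter's bounds, which compare \<open>a \<epsilon>\<close>
  with powers of \<epsilon> and with \<open>a (\<epsilon> / u)\<close>. Weak convergence is obtained
  from finite patterns of comparisons: with high probability under the limit law, finitely many of
  them fix the value of a bounded continuous functional up to a small error.\<close>

section \<open>Slow variation\<close>

text \<open>The uniform convergence theorem for slowly varying functions in additive form, by a
  Steinhaus-type overlap argument. Along a hypothetical sequence of bad pairs, most shifts in
  \<open>{0..2}\<close> are harmless for the base point \<open>x k\<close>, and most are harmless
  for \<open>x k + v k\<close>; a point reached by harmless shifts from both links the two base
  points.\<close>

lemma slowly_varying_additive_bound:
  fixes f :: "real \<Rightarrow> real"
  assumes meas [measurable]: "f \<in> borel_measurable borel"
    and lim: "\<And>v. 0 \<le> v \<Longrightarrow> ((\<lambda>x. f (x + v) - f x) \<longlongrightarrow> 0) at_top"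
    and "0 < \<rho>"
  shows "\<exists>X. \<forall>x\<ge>X. \<forall>v\<in>{0..1}. \<bar>f (x + v) - f x\<bar> \<le> \<rho>"
proof (rule ccontr)
  assume "\<not> ?thesis"
  then have "\<forall>n::nat. \<exists>x v. x \<ge> real n \<and> v \<in> {0..1} \<and> \<rho> < \<bar>f (x + v) - f x\<bar>"
    by (meson linorder_not_le)
  then obtain x v where xv: "\<And>n. x n \<ge> real n" "\<And>n. v n \<in> {0..1}"
      "\<And>n. \<rho> < \<bar>f (x n + v n) - f (x n)\<bar>"
    by metis
  \<comment> \<open>Pointwise convergence makes these increasing sets exhaust \<open>{0..2}\<close>,
    so their measure tends to 2. The threshold 3/2 is half the length of \<open>{0..3}\<close>,
    where the overlap is taken.\<close>
  have meas_large: "\<exists>k0. \<forall>k\<ge>k0. measure lborel {w\<in>{0..2}. \<forall>m\<ge>k. \<bar>f (z m + w) - f (z m)\<bar> \<le> \<rho>/2} > 3/2"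
    if z: "\<And>n. z n \<ge> real n" for z :: "nat \<Rightarrow> real"
  proof -
    define V where "V k = {w\<in>{0..2}. \<forall>m\<ge>k. \<bar>f (z m + w) - f (z m)\<bar> \<le> \<rho>/2}" for k
    have V_sets [measurable]: "V k \<in> sets borel" for k
      unfolding V_def by measurable
    have ztop: "filterlim z at_top sequentially"
      using z filterlim_at_top_mono[OF filterlim_real_sequentially] by auto
    have "(\<Union>k. V k) = {0..2}"
    proof
      show "(\<Union>k. V k) \<subseteq> {0..2}" by (auto simp: V_def)
      show "{0..2} \<subseteq> (\<Union>k. V k)"
      proof
        fix w :: real assume w: "w \<in> {0..2}"
        have "((\<lambda>m. f (z m + w) - f (z m)) \<longlongrightarrow> 0) sequentially"
          using filterlim_compose[OF lim ztop, of w] w by auto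
        then have "\<forall>\<^sub>F m in sequentially. \<bar>f (z m + w) - f (z m)\<bar> < \<rho>/2"
          using \<open>0 < \<rho>\<close> by (auto simp: tendsto_iff dist_real_def dest!: spec[of _ "\<rho>/2"])
        then show "w \<in> (\<Union>k. V k)"
          using w by (auto simp: V_def eventually_sequentially intro!: less_imp_le)
      qed
    qed
    moreover have "(\<lambda>k. measure lborel (V k)) \<longlonglongrightarrow> measure lborel (\<Union>k. V k)"
    proof (rule Lim_measure_incseq)
      show "incseq V" by (auto simp: V_def incseq_def)
      have "emeasure lborel (\<Union>k. V k) \<le> emeasure lborel {0..2::real}"
        by (rule emeasure_mono) (auto simp: V_def)
      also have "\<dots> < \<infinity>" by simp
      finally show "emeasure lborel (\<Union>k. V k) \<noteq> \<infinity>" by simp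
    qed auto
    ultimately have "(\<lambda>k. measure lborel (V k)) \<longlonglongrightarrow> 2" by simp
    then have "\<forall>\<^sub>F k in sequentially. measure lborel (V k) > 3/2"
      by (rule order_tendstoD) simp
    then show ?thesis by (auto simp: eventually_sequentially V_def)
  qed
  define V where "V k = {w\<in>{0..2}. \<forall>m\<ge>k. \<bar>f (x m + w) - f (x m)\<bar> \<le> \<rho>/2}" for k
  define W where "W k = {w\<in>{0..2}. \<forall>m\<ge>k. \<bar>f (x m + v m + w) - f (x m + v m)\<bar> \<le> \<rho>/2}" for k
  have [measurable]: "V k \<in> sets borel" "W k \<in> sets borel" for k
    unfolding V_def W_def by measurable
  have "x n + v n \<ge> real n" for n using xv(1,2)[of n] by auto
  then obtain k where k: "measure lborel (V k) > 3/2" "measure lborel (W k) > 3/2"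
    using meas_large[of x] meas_large[of "\<lambda>m. x m + v m"] xv(1) unfolding V_def W_def
    by (metis (no_types, lifting) nle_le)
  \<comment> \<open>Shifting by \<open>v k\<close> refers both sets of shifts to the base point
    \<open>x k\<close>.\<close>
  define W' where "W' = (+) (v k) ` W k"
  have W'_eq: "W' = (\<lambda>w. w - v k) -` W k" by (auto simp: W'_def image_iff algebra_simps) (metis diff_add_cancel add.commute)
  have [measurable]: "W' \<in> sets borel"
    unfolding W'_eq using measurable_sets[of "\<lambda>w. w - v k" borel borel "W k"] by simp
  have meas_W': "measure lborel W' = measure lborel (W k)"
  proof -
    have "emeasure lborel (W k) = emeasure (distr lborel borel ((+) (- v k))) (W k)"
      by (simp add: lborel_distr_plus)
    also have "\<dots> = emeasure lborel W'"
      by (simp add: emeasure_distr W'_eq) (simp add: uminus_add_conv_diff[abs_def])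
    finally show ?thesis by (simp add: measure_def)
  qed
  have sub: "V k \<subseteq> {0..3}" "W' \<subseteq> {0..3}"
    using xv(2)[of k] by (auto simp: V_def W_def W'_def)
  have fm: "V k \<in> fmeasurable lborel" "W' \<in> fmeasurable lborel"
    using sub fmeasurableI2[OF fmeasurable_cbox[of 0 "3::real"]] by (simp_all add: cbox_interval)
  have "V k \<inter> W' \<noteq> {}"
  proof
    assume "V k \<inter> W' = {}"
    then have "measure lborel (V k \<union> W') = measure lborel (V k) + measure lborel W'"
      using fm by (simp add: measure_Un3)
    moreover have "measure lborel (V k \<union> W') \<le> measure lborel {0..3::real}"
      using sub fm by (intro measure_mono_fmeasurable) (auto simp: fmeasurable_def)
    ultimately show False using k meas_W' by simp
  qed
  then obtain w where w: "v k + w \<in> V k" "w \<in> W k" by (auto simp: W'_def)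
  then have "\<bar>f (x k + (v k + w)) - f (x k)\<bar> \<le> \<rho>/2" "\<bar>f (x k + v k + w) - f (x k + v k)\<bar> \<le> \<rho>/2"
    by (auto simp: V_def W_def)
  then show False using xv(3)[of k] unfolding add.assoc by linarith
qed

text \<open>Potter's bounds. For the logarithm of \<open>L\<close> in exponential coordinates each
  step of length at most one costs at most \<rho>; going from ln x to ln y takes at most ln (y / x)
  + 1 steps, which gives the power of y / x and the constant exp \<rho>.\<close>

lemma slowly_varying_potter:
  assumes L: "slowly_varying L" and "0 < \<rho>"
  shows "\<exists>X>0. \<exists>C>0. (\<forall>x\<ge>X. 0 < L x) \<and>
    (\<forall>x y. X \<le> x \<and> x \<le> y \<longrightarrow> L y \<le> C * (y / x) powr \<rho> * L x \<and> L x \<le> C * (y / x) powr \<rho> * L y)"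
proof -
  obtain x0 where x0: "L \<in> borel_measurable (restrict_space borel {x0..})" "\<And>x. x \<ge> x0 \<Longrightarrow> 0 < L x"
    and lim: "\<And>r. r > 0 \<Longrightarrow> ((\<lambda>x. L (r * x) / L x) \<longlongrightarrow> 1) at_top"
    using L unfolding slowly_varying_def by blast
  \<comment> \<open>Below \<open>x0\<close> neither measurability nor positivity of \<open>L\<close>
    is known; the value 1 there makes \<open>f\<close> a Borel function on the whole line.\<close>
  define l where "l x = (if x \<ge> x0 then L x else 1)" for x
  have [measurable]: "l \<in> borel_measurable borel"
    unfolding l_def using x0(1)
    by (subst measurable_If_restrict_space_iff) (auto simp: atLeast_def[symmetric])
  define f where "f v = ln (l (exp v))" for v
  have "((\<lambda>x. f (x + v) - f x) \<longlongrightarrow> 0) at_top" for v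
  proof -
    have e: "filterlim exp at_top (at_top :: real filter)" by (rule exp_at_top)
    have "((\<lambda>x. ln (L (exp v * exp x) / L (exp x))) \<longlongrightarrow> ln 1) at_top"
      by (intro tendsto_ln filterlim_compose[OF lim e]) auto
    moreover have "\<forall>\<^sub>F x in at_top. ln (L (exp v * exp x) / L (exp x)) = f (x + v) - f x"
    proof -
      have "\<forall>\<^sub>F x in at_top. x0 \<le> exp x" using e by (simp add: filterlim_at_top)
      moreover have "\<forall>\<^sub>F x::real in at_top. x0 / exp v \<le> exp x" using e by (simp add: filterlim_at_top)
      ultimately show ?thesis
      proof eventually_elim
        case (elim x)
        then have "x0 \<le> exp v * exp x" by (simp add: field_simps)
        with elim show ?case
          using x0(2)[of "exp x"] x0(2)[of "exp v * exp x"]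
          by (simp add: f_def l_def exp_add mult.commute ln_div)
      qed
    qed
    ultimately show ?thesis by (simp add: tendsto_cong)
  qed
  moreover have "f \<in> borel_measurable borel" unfolding f_def by measurable
  ultimately obtain X where X: "\<And>x v. x \<ge> X \<Longrightarrow> v \<in> {0..1} \<Longrightarrow> \<bar>f (x + v) - f x\<bar> \<le> \<rho>"
    using slowly_varying_additive_bound[of f \<rho>] \<open>0 < \<rho>\<close> by blast
  have step: "\<bar>f (x + v) - f x\<bar> \<le> \<rho> * real n" if "x \<ge> X" "0 \<le> v" "v \<le> real n" for x v n
    using that
  proof (induction n arbitrary: v)
    case 0
    then show ?case by simp
  next
    case (Suc n)
    show ?case
    proof (cases "v \<le> real n")
      case True
      then have "\<bar>f (x + v) - f x\<bar> \<le> \<rho> * real n" using Suc by auto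
      also have "\<dots> \<le> \<rho> * real (Suc n)" using \<open>0 < \<rho>\<close> by simp
      finally show ?thesis .
    next
      case False
      have "\<bar>f (x + real n + (v - real n)) - f (x + real n)\<bar> \<le> \<rho>"
        using False Suc.prems by (intro X) auto
      moreover have "\<bar>f (x + real n) - f x\<bar> \<le> \<rho> * real n" using Suc by auto
      ultimately show ?thesis by (simp add: algebra_simps)
    qed
  qed
  have pot: "\<bar>f y - f x\<bar> \<le> \<rho> * (y - x) + \<rho>" if "x \<ge> X" "x \<le> y" for x y
  proof -
    have ceil: "real (nat \<lceil>y - x\<rceil>) \<le> y - x + 1" using that by linarith
    have "\<bar>f (x + (y - x)) - f x\<bar> \<le> \<rho> * real (nat \<lceil>y - x\<rceil>)"
      using that by (intro step) (auto simp: real_nat_ceiling_ge)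
    also have "\<dots> \<le> \<rho> * (y - x + 1)"
      using ceil \<open>0 < \<rho>\<close> by (intro mult_left_mono) simp_all
    finally show ?thesis by (simp add: algebra_simps)
  qed
  have main: "L y \<le> exp \<rho> * (y / x) powr \<rho> * L x \<and> L x \<le> exp \<rho> * (y / x) powr \<rho> * L y"
    if "max (exp X) x0 \<le> x" "x \<le> y" for x y
  proof -
    have "0 < x" using that(1) exp_gt_zero[of X] by linarith
    then have pos: "0 < x" "0 < y" "x0 \<le> x" "x0 \<le> y" "X \<le> ln x" "ln x \<le> ln y"
      using that by (auto simp: ln_ge_iff)
    have f: "f (ln x) = ln (L x)" "f (ln y) = ln (L y)"
      using pos by (auto simp: f_def l_def)
    have b: "\<bar>ln (L y) - ln (L x)\<bar> \<le> \<rho> * (ln y - ln x) + \<rho>"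
      using pot[of "ln x" "ln y"] pos f by simp
    have Lp: "0 < L x" "0 < L y" using pos x0 by auto
    have e: "exp (\<rho> * (ln y - ln x) + \<rho> + ln z) = exp \<rho> * (y / x) powr \<rho> * z" if "0 < z" for z
      using that pos by (simp add: exp_add powr_def ln_div)
    have "L y \<le> exp (\<rho> * (ln y - ln x) + \<rho> + ln (L x))"
      using b Lp exp_le_cancel_iff[of "ln (L y)" "\<rho> * (ln y - ln x) + \<rho> + ln (L x)"] by simp
    moreover have "L x \<le> exp (\<rho> * (ln y - ln x) + \<rho> + ln (L y))"
      using b Lp exp_le_cancel_iff[of "ln (L x)" "\<rho> * (ln y - ln x) + \<rho> + ln (L y)"] by simp
    ultimately show ?thesis using e Lp by simp
  qed
  have "0 < max (exp X) x0" by (simp add: less_max_iff_disj)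
  moreover have "\<forall>x\<ge>max (exp X) x0. 0 < L x" using x0 by simp
  ultimately show ?thesis using main exp_gt_zero[of \<rho>] by blast
qed

text \<open>The growth exponent of \<open>B\<close> is 1 / (1 - h) up to an arbitrarily small loss.
  The first limit makes the cut-off of the stopping rule negligible, the second serves the
  convergence in probability in part (c), and the third compares the time scales at \<epsilon> and
  at \<epsilon> / u.\<close>

lemma asymptotic_inverse_bounds:
  assumes L: "slowly_varying L" and inv: "asymptotic_inverse (\<lambda>x. x powr (1 - h) * L x) B"
    and h: "0 < h" "h < 1"
  shows "p < 1 / (1 - h) \<Longrightarrow> ((\<lambda>x. x powr p / B x) \<longlongrightarrow> 0) at_top"
    and "p > 1 / (1 - h) \<Longrightarrow> ((\<lambda>x. B x / x powr p) \<longlongrightarrow> 0) at_top"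
    and "0 < u \<Longrightarrow> \<exists>C>0. \<forall>\<^sub>F x in at_top. B x \<le> C * B (u * x)"
proof -
  have B_top: "filterlim B at_top at_top"
    and AB: "(\<lambda>x. B x powr (1 - h) * L (B x)) \<sim>[at_top] (\<lambda>x. x)"
    using inv by (auto simp: asymptotic_inverse_def)
  have "((\<lambda>x. (B x powr (1 - h) * L (B x)) / x) \<longlongrightarrow> 1) at_top"
    using asymp_equivD_strong[OF AB] by (simp add: eventually_gt_at_top eventually_mono[OF eventually_gt_at_top[of 0]])
  then have "\<forall>\<^sub>F x in at_top. (B x powr (1 - h) * L (B x)) / x > 1/2 \<and> (B x powr (1 - h) * L (B x)) / x < 2"
    by (intro eventually_conj order_tendstoD) auto
  then have AB_ev: "\<forall>\<^sub>F x in at_top. x / 2 \<le> B x powr (1 - h) * L (B x) \<and> B x powr (1 - h) * L (B x) \<le> 2 * x"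
    using eventually_gt_at_top[of 0] by eventually_elim (auto simp: field_simps)
  have B_ge: "\<forall>\<^sub>F x in at_top. X \<le> B x" for X
    using B_top by (simp add: filterlim_at_top)
  \<comment> \<open>Potter's bound with the fixed lower point \<open>X\<close> replaces
    \<open>L (B x)\<close> by a power of \<open>B x\<close>; the asymptotic relation between
    \<open>B x\<close> and x is then solved for \<open>B x\<close> by taking a root.\<close>
  have lower: "\<exists>c>0. \<forall>\<^sub>F x in at_top. c * x powr (1 / (1 - h + \<rho>)) \<le> B x" if \<rho>: "0 < \<rho>" for \<rho>
  proof -
    obtain X C where X: "0 < X" "0 < C" "\<And>x. x \<ge> X \<Longrightarrow> 0 < L x"
        "\<And>x y. X \<le> x \<Longrightarrow> x \<le> y \<Longrightarrow> L y \<le> C * (y / x) powr \<rho> * L x"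
      using slowly_varying_potter[OF L \<rho>] by metis
    define K where "K = 2 * C * L X / X powr \<rho>"
    have "0 < K" using X by (auto simp: K_def)
    have "\<forall>\<^sub>F x in at_top. (1 / K) powr (1 / (1 - h + \<rho>)) * x powr (1 / (1 - h + \<rho>)) \<le> B x"
      using AB_ev B_ge[of X] eventually_gt_at_top[of 0]
    proof eventually_elim
      case (elim x)
      then have Bpos: "0 < B x" using X by linarith
      have "x \<le> 2 * (B x powr (1 - h) * L (B x))" using elim by simp
      also have "\<dots> \<le> 2 * (B x powr (1 - h) * (C * (B x / X) powr \<rho> * L X))"
        using X(4)[of X "B x"] elim by (intro mult_left_mono) auto
      also have "\<dots> = K * B x powr (1 - h + \<rho>)"
        using Bpos X by (simp add: K_def powr_divide powr_add)
      finally have "x / K \<le> B x powr (1 - h + \<rho>)"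
        using \<open>0 < K\<close> by (simp add: field_simps)
      then have "(x / K) powr (1 / (1 - h + \<rho>)) \<le> (B x powr (1 - h + \<rho>)) powr (1 / (1 - h + \<rho>))"
        using h that elim \<open>0 < K\<close> by (intro powr_mono2) auto
      also have "\<dots> = B x" using h that Bpos by (simp add: powr_powr)
      finally show ?case using elim \<open>0 < K\<close> by (simp add: powr_divide)
    qed
    moreover have "(1 / K) powr (1 / (1 - h + \<rho>)) > 0" using \<open>0 < K\<close> by simp
    ultimately show ?thesis by blast
  qed
  have upper: "\<exists>c>0. \<forall>\<^sub>F x in at_top. B x \<le> c * x powr (1 / (1 - h - \<rho>))" if \<rho>: "0 < \<rho>" "\<rho> < 1 - h" for \<rho>
  proof -
    obtain X C where X: "0 < X" "0 < C" "\<And>x. x \<ge> X \<Longrightarrow> 0 < L x"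
        "\<And>x y. X \<le> x \<Longrightarrow> x \<le> y \<Longrightarrow> L x \<le> C * (y / x) powr \<rho> * L y"
      using slowly_varying_potter[OF L \<rho>(1)] by metis
    define K where "K = 2 * C / (L X * X powr \<rho>)"
    have "0 < K" using X by (auto simp: K_def)
    have "\<forall>\<^sub>F x in at_top. B x \<le> K powr (1 / (1 - h - \<rho>)) * x powr (1 / (1 - h - \<rho>))"
      using AB_ev B_ge[of X] eventually_gt_at_top[of 0]
    proof eventually_elim
      case (elim x)
      then have Bpos: "0 < B x" using X by linarith
      have "B x powr (1 - h - \<rho>) * L X \<le> B x powr (1 - h - \<rho>) * (C * (B x / X) powr \<rho> * L (B x))"
        using X(4)[of X "B x"] elim by (intro mult_left_mono) auto
      also have "\<dots> = C / X powr \<rho> * (B x powr (1 - h) * L (B x))"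
        using Bpos X powr_add[of "B x" "1 - h - \<rho>" \<rho>] by (simp add: powr_divide)
      also have "\<dots> \<le> C / X powr \<rho> * (2 * x)"
        using elim X by (intro mult_left_mono) auto
      finally have "B x powr (1 - h - \<rho>) \<le> K * x"
        using X by (simp add: K_def field_simps)
      then have "(B x powr (1 - h - \<rho>)) powr (1 / (1 - h - \<rho>)) \<le> (K * x) powr (1 / (1 - h - \<rho>))"
        using h that elim by (intro powr_mono2) auto
      then have "B x \<le> (K * x) powr (1 / (1 - h - \<rho>))"
        using h that Bpos by (simp add: powr_powr)
      then show ?case using elim \<open>0 < K\<close> by (simp add: powr_mult)
    qed
    moreover have "K powr (1 / (1 - h - \<rho>)) > 0" using \<open>0 < K\<close> by simp
    ultimately show ?thesis by blast
  qed
  have powr_tendsto: "((\<lambda>x. K * x powr q) \<longlongrightarrow> 0) at_top" if "q < 0" for K q :: real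
    using tendsto_mult_right_zero[OF tendsto_neg_powr[OF that filterlim_ident]] by simp
  show "((\<lambda>x. x powr p / B x) \<longlongrightarrow> 0) at_top" if p: "p < 1 / (1 - h)"
  proof -
    obtain \<rho> where \<rho>: "0 < \<rho>" "p < 1 / (1 - h + \<rho>)"
    proof (cases "p \<le> 0")
      case True
      then show ?thesis using that[of 1] h by (smt (verit) divide_pos_pos)
    next
      case False
      then have "1 - h < 1 / p" using p h by (simp add: field_simps)
      obtain q where q: "1 - h < q" "q < 1 / p" using \<open>1 - h < 1 / p\<close> dense by blast
      define \<rho> where "\<rho> = q - (1 - h)"
      have "0 < \<rho>" "1 - h + \<rho> < 1 / p" using q by (simp_all add: \<rho>_def)
      then show ?thesis using that[of \<rho>] False h by (simp add: pos_less_divide_eq mult.commute)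
    qed
    then obtain c where c: "c > 0" "\<forall>\<^sub>F x in at_top. c * x powr (1 / (1 - h + \<rho>)) \<le> B x"
      using lower by blast
    show ?thesis
    proof (rule tendsto_sandwich[OF _ _ tendsto_const powr_tendsto])
      show "\<forall>\<^sub>F x in at_top. 0 \<le> x powr p / B x"
        using B_ge[of 0] by eventually_elim auto
      show "\<forall>\<^sub>F x in at_top. x powr p / B x \<le> 1 / c * x powr (p - 1 / (1 - h + \<rho>))"
        using c(2) eventually_gt_at_top[of 0]
      proof eventually_elim
        case (elim x)
        from elim c have pos: "0 < c * x powr (1 / (1 - h + \<rho>))" by simp
        then have "0 < B x" using elim by linarith
        then have "x powr p / B x \<le> x powr p / (c * x powr (1 / (1 - h + \<rho>)))"
          using elim pos by (intro divide_left_mono mult_pos_pos[of "B x"]) auto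
        then show ?case by (simp add: powr_diff)
      qed
      show "p - 1 / (1 - h + \<rho>) < 0" using \<rho> by simp
    qed
  qed
  show "((\<lambda>x. B x / x powr p) \<longlongrightarrow> 0) at_top" if p: "p > 1 / (1 - h)"
  proof -
    have p0: "p > 0" using p h by (smt (verit) divide_pos_pos)
    then have "1 / p < 1 - h" using p h by (simp add: field_simps)
    obtain q where q: "1 / p < q" "q < 1 - h" using \<open>1 / p < 1 - h\<close> dense by blast
    define \<rho> where "\<rho> = 1 - h - q"
    have "0 < 1 / p" using p0 by simp
    then have \<rho>: "0 < \<rho>" "\<rho> < 1 - h" "1 / p < 1 - h - \<rho>"
      using q unfolding \<rho>_def by linarith+
    then have \<rho>2: "p > 1 / (1 - h - \<rho>)" using p0 by (simp add: field_simps)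
    obtain c where c: "c > 0" "\<forall>\<^sub>F x in at_top. B x \<le> c * x powr (1 / (1 - h - \<rho>))"
      using upper \<rho> by blast
    show ?thesis
    proof (rule tendsto_sandwich[OF _ _ tendsto_const powr_tendsto])
      show "\<forall>\<^sub>F x in at_top. 0 \<le> B x / x powr p"
        using B_ge[of 0] by eventually_elim auto
      show "\<forall>\<^sub>F x in at_top. B x / x powr p \<le> c * x powr (1 / (1 - h - \<rho>) - p)"
        using c(2) eventually_gt_at_top[of 0]
        by eventually_elim (auto simp: powr_diff divide_right_mono)
      show "1 / (1 - h - \<rho>) - p < 0" using \<rho>2 by simp
    qed
  qed
  show "\<exists>C>0. \<forall>\<^sub>F x in at_top. B x \<le> C * B (u * x)" if "0 < u"
  proof -
    \<comment> \<open>With this choice 1 - h = 2 * \<rho>, so Potter's bound consumes one of two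
      equal factors (y / y') powr \<rho> and leaves a bound for the other.\<close>
    define \<rho> where "\<rho> = (1 - h) / 2"
    have \<rho>: "0 < \<rho>" "1 - h - \<rho> = \<rho>" using h by (auto simp: \<rho>_def field_simps)
    obtain X C where X: "0 < X" "0 < C" "\<And>x. x \<ge> X \<Longrightarrow> 0 < L x"
        "\<And>x y. X \<le> x \<Longrightarrow> x \<le> y \<Longrightarrow> L x \<le> C * (y / x) powr \<rho> * L y"
      using slowly_varying_potter[OF L \<rho>(1)] by metis
    \<comment> \<open>The factor 4 / u is the quotient of the upper bound 2 * x available at
      \<open>y\<close> and the lower bound u * x / 2 available at \<open>y'\<close>; the 1 covers
      the case \<open>y \<le> y'\<close>.\<close>
    define K where "K = max 1 ((4 * C / u) powr (1 / \<rho>))"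
    have mult_top: "filterlim (\<lambda>x. u * x) at_top at_top"
      using that by (simp add: filterlim_tendsto_pos_mult_at_top[OF tendsto_const] filterlim_ident)
    have "\<forall>\<^sub>F x in at_top. B x \<le> K * B (u * x)"
      using AB_ev eventually_compose_filterlim[OF AB_ev mult_top] B_ge[of X]
        eventually_compose_filterlim[OF B_ge[of X] mult_top] eventually_gt_at_top[of 0]
    proof eventually_elim
      case (elim x)
      define y y' where "y = B x" and "y' = B (u * x)"
      have y: "X \<le> y" "X \<le> y'" "0 < y" "0 < y'" using elim X(1) by (auto simp: y_def y'_def)
      show ?case
      proof (cases "y \<le> y'")
        case True
        have "1 * y' \<le> K * y'" using y by (intro mult_right_mono) (auto simp: K_def)
        then show ?thesis using True by (simp add: y_def y'_def)
      next
        case False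
        have "u * x * y powr (1 - h) * L y' \<le> u * x * y powr (1 - h) * (C * (y / y') powr \<rho> * L y)"
          using X(4)[of y' y] y False that elim by (intro mult_left_mono) auto
        also have "\<dots> = u * x * (C * (y / y') powr \<rho>) * (y powr (1 - h) * L y)" by simp
        also have "\<dots> \<le> u * x * (C * (y / y') powr \<rho>) * (2 * x)"
          using that elim X by (intro mult_left_mono) (auto simp: y_def)
        finally have 1: "u * x * y powr (1 - h) * L y' \<le> u * x * (C * (y / y') powr \<rho>) * (2 * x)" .
        have "u * x / 2 \<le> y' powr (1 - h) * L y'" using elim by (simp add: y'_def)
        then have "u * x * y powr (1 - h) * (u * x / 2) \<le> u * x * y powr (1 - h) * (y' powr (1 - h) * L y')"
          using that elim by (intro mult_left_mono) auto
        also have "\<dots> = y' powr (1 - h) * (u * x * y powr (1 - h) * L y')" by simp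
        also have "\<dots> \<le> y' powr (1 - h) * (u * x * (C * (y / y') powr \<rho>) * (2 * x))"
          using 1 by (intro mult_left_mono) auto
        finally have "y powr (1 - h) * u \<le> y' powr (1 - h) * (4 * C * (y / y') powr \<rho>)"
          using that elim by (simp add: field_simps)
        then have "(y / y') powr (1 - h) \<le> 4 * C / u * (y / y') powr \<rho>"
          using that y by (simp add: powr_divide field_simps)
        moreover have "(y / y') powr (1 - h) = (y / y') powr \<rho> * (y / y') powr \<rho>"
          using \<rho> by (metis powr_add diff_add_cancel)
        ultimately have "(y / y') powr \<rho> * (y / y') powr \<rho> \<le> 4 * C / u * (y / y') powr \<rho>" by simp
        moreover have "0 < (y / y') powr \<rho>" using y by simp
        ultimately have "(y / y') powr \<rho> \<le> 4 * C / u" by (rule mult_right_le_imp_le)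
        then have "((y / y') powr \<rho>) powr (1 / \<rho>) \<le> (4 * C / u) powr (1 / \<rho>)"
          using \<rho> by (intro powr_mono2) auto
        then have "y / y' \<le> K" using y \<rho> by (simp add: powr_powr K_def)
        then show ?thesis using y by (simp add: y_def y'_def field_simps)
      qed
    qed
    then show ?thesis by (intro exI[of _ K]) (auto simp: K_def)
  qed
qed

section \<open>Monotone paths in the M1 topology\<close>

lemma mono_on_tendsto_left_SUP:
  fixes x :: "real \<Rightarrow> real"
  assumes mono: "mono_on {a..t} x" and "a < t"
  shows "(x \<longlongrightarrow> (SUP r\<in>{a..<t}. x r)) (at_left t)"
proof -
  have bdd: "bdd_above (x ` {a..<t})"
    using \<open>a < t\<close> by (intro bdd_aboveI[of _ "x t"]) (auto intro: mono_onD[OF mono])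
  show ?thesis
  proof (rule order_tendstoI)
    fix y assume "y < (SUP r\<in>{a..<t}. x r)"
    then obtain r where r: "r \<in> {a..<t}" "y < x r"
      using bdd \<open>a < t\<close> by (subst (asm) less_cSUP_iff) auto
    have "\<forall>\<^sub>F s in at_left t. r < s \<and> s < t"
      using r by (auto simp: eventually_at_left)
    then show "\<forall>\<^sub>F s in at_left t. y < x s"
    proof eventually_elim
      case (elim s)
      then have "x r \<le> x s" using r by (intro mono_onD[OF mono]) auto
      then show ?case using r by simp
    qed
  next
    fix y assume y: "(SUP r\<in>{a..<t}. x r) < y"
    have "\<forall>\<^sub>F s in at_left t. a < s \<and> s < t"
      using \<open>a < t\<close> by (auto simp: eventually_at_left)
    then show "\<forall>\<^sub>F s in at_left t. x s < y"
    proof eventually_elim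
      case (elim s)
      then have "x s \<le> (SUP r\<in>{a..<t}. x r)" using bdd by (intro cSUP_upper) auto
      then show ?case using y by simp
    qed
  qed
qed

lemma left_lim_mono:
  assumes mono: "mono_on {a..b} x" and t: "a < t" "t \<le> b"
  shows left_lim_mono_ge: "r \<in> {a..<t} \<Longrightarrow> x r \<le> left_lim a x t"
    and left_lim_mono_le: "(\<And>r. r \<in> {a..<t} \<Longrightarrow> x r \<le> B) \<Longrightarrow> left_lim a x t \<le> B"
proof -
  have mono': "mono_on {a..t} x" using mono t by (auto intro: mono_on_subset)
  have eq: "left_lim a x t = (SUP r\<in>{a..<t}. x r)"
    using t mono_on_tendsto_left_SUP[OF mono' t(1)]
    by (simp add: left_lim_def tendsto_Lim trivial_limit_at_left_real)
  have bdd: "bdd_above (x ` {a..<t})"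
    using t by (intro bdd_aboveI[of _ "x t"]) (auto intro: mono_onD[OF mono'])
  show "r \<in> {a..<t} \<Longrightarrow> x r \<le> left_lim a x t"
    unfolding eq using bdd by (intro cSUP_upper)
  show "(\<And>r. r \<in> {a..<t} \<Longrightarrow> x r \<le> B) \<Longrightarrow> left_lim a x t \<le> B"
    unfolding eq using t by (intro cSUP_least) auto
qed

text \<open>The completed graph of a monotone path meets every line \<open>t + z = \<sigma>\<close> exactly once;
  \<open>graph_time a b x \<sigma>\<close> is the time coordinate of the intersection point.\<close>

definition graph_time :: "real \<Rightarrow> real \<Rightarrow> (real \<Rightarrow> real) \<Rightarrow> real \<Rightarrow> real" where
  "graph_time a b x \<sigma> = Sup (insert a {t\<in>{a..b}. t + x t \<le> \<sigma>})"

context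
  fixes a b :: real and x :: "real \<Rightarrow> real"
  assumes ab: "a < b" and mono: "mono_on {a..b} x"
begin

lemma graph_time_bdd: "bdd_above (insert a {t\<in>{a..b}. t + x t \<le> \<sigma>})"
  by (intro bdd_aboveI[of _ b]) (use ab in auto)

lemma graph_time_ge: "a \<le> graph_time a b x \<sigma>"
  unfolding graph_time_def using graph_time_bdd by (intro cSup_upper) auto

lemma graph_time_le: "graph_time a b x \<sigma> \<le> b"
  unfolding graph_time_def using ab by (intro cSup_least) auto

lemma less_graph_timeD:
  assumes t: "t \<in> {a..b}" and "t < graph_time a b x \<sigma>"
  shows "t + x t \<le> \<sigma>"
proof -
  obtain s where s: "s \<in> insert a {t\<in>{a..b}. t + x t \<le> \<sigma>}" "t < s"
    using assms(2) unfolding graph_time_def by (subst (asm) less_cSup_iff) (use graph_time_bdd in auto)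
  then have "s \<in> {a..b}" "s + x s \<le> \<sigma>" using t by auto
  moreover have "x t \<le> x s" using s t calculation by (intro mono_onD[OF mono]) auto
  ultimately show ?thesis using s by linarith
qed

lemma graph_time_lessD:
  assumes "t \<in> {a..b}" "graph_time a b x \<sigma> < t"
  shows "\<sigma> < t + x t"
proof (rule ccontr)
  assume "\<not> ?thesis"
  then have "t \<le> graph_time a b x \<sigma>"
    unfolding graph_time_def using assms(1) by (intro cSup_upper[OF _ graph_time_bdd]) auto
  then show False using assms(2) by simp
qed

lemma graph_time_eqI:
  assumes t: "t \<in> {a..b}" and lo: "\<And>s. s \<in> {a..<t} \<Longrightarrow> s + x s \<le> \<sigma>"
    and hi: "\<And>s. s \<in> {t<..b} \<Longrightarrow> \<sigma> < s + x s"
  shows "graph_time a b x \<sigma> = t"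
proof (rule ccontr)
  assume "graph_time a b x \<sigma> \<noteq> t"
  then consider "graph_time a b x \<sigma> < t" | "t < graph_time a b x \<sigma>" by linarith
  then show False
  proof cases
    case 1
    then obtain s where "graph_time a b x \<sigma> < s" "s < t" using dense by blast
    then show False using graph_time_lessD[of s \<sigma>] lo[of s] graph_time_ge[of \<sigma>] t by auto
  next
    case 2
    then obtain s where "t < s" "s < graph_time a b x \<sigma>" using dense by blast
    then show False using less_graph_timeD[of s \<sigma>] hi[of s] graph_time_le[of \<sigma>] t by auto
  qed
qed

lemma graph_time_mono:
  assumes "\<sigma> \<le> \<sigma>'" shows "graph_time a b x \<sigma> \<le> graph_time a b x \<sigma>'"
proof (rule ccontr)
  assume "\<not> ?thesis"
  then obtain s where "graph_time a b x \<sigma>' < s" "s < graph_time a b x \<sigma>"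
    using dense[of "graph_time a b x \<sigma>'" "graph_time a b x \<sigma>"] by auto
  then show False
    using less_graph_timeD[of s \<sigma>] graph_time_lessD[of s \<sigma>'] graph_time_ge[of \<sigma>'] graph_time_le[of \<sigma>] assms
    by auto
qed

text \<open>Since \<open>x\<close> is nondecreasing, t + x t grows at least at unit rate in t; hence
  the intersection point of graph and line moves in time at most as fast as \<sigma>. The second
  coordinate \<sigma> - \<open>graph_time a b x \<sigma>\<close> is therefore nondecreasing
  too.\<close>

lemma graph_time_add:
  assumes "\<sigma> \<le> \<sigma>'" shows "graph_time a b x \<sigma>' \<le> graph_time a b x \<sigma> + (\<sigma>' - \<sigma>)"
proof (rule ccontr)
  assume neg: "\<not> ?thesis"
  define e where "e = (graph_time a b x \<sigma>' - graph_time a b x \<sigma> - (\<sigma>' - \<sigma>)) / 2"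
  define r s where "r = graph_time a b x \<sigma> + e / 2" and "s = graph_time a b x \<sigma>' - e / 2"
  have e: "0 < e" using neg by (simp add: e_def)
  have rs: "s - r = e + (\<sigma>' - \<sigma>)" unfolding r_def s_def e_def by (simp add: field_simps)
  have in_ab: "r \<in> {a..b}" "s \<in> {a..b}"
    using rs e assms graph_time_ge[of \<sigma>] graph_time_le[of \<sigma>'] by (auto simp: r_def s_def)
  have "\<sigma> < r + x r" using in_ab e by (intro graph_time_lessD) (auto simp: r_def)
  moreover have "s + x s \<le> \<sigma>'" using in_ab e by (intro less_graph_timeD) (auto simp: s_def)
  moreover have "x r \<le> x s" using in_ab rs e assms by (intro mono_onD[OF mono]) auto
  ultimately show False using rs e by linarith
qed

lemma graph_time_lipschitz: "\<bar>graph_time a b x \<sigma> - graph_time a b x \<sigma>'\<bar> \<le> \<bar>\<sigma> - \<sigma>'\<bar>"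
  using graph_time_mono[of \<sigma> \<sigma>'] graph_time_mono[of \<sigma>' \<sigma>] graph_time_add[of \<sigma> \<sigma>'] graph_time_add[of \<sigma>' \<sigma>]
  by linarith

text \<open>The graph is parametrized by the sum of its two coordinates, rescaled to the unit
  interval. While a jump is traversed, time stands still and only the second coordinate moves, so
  jumps need no separate treatment.\<close>

definition graph_param :: "real \<Rightarrow> real \<times> real" where
  "graph_param s = (let \<sigma> = a + x a + s * (b + x b - (a + x a)) in
     (graph_time a b x \<sigma>, \<sigma> - graph_time a b x \<sigma>))"

lemma parametric_rep_graph_param:
  assumes rc: "\<And>t. t \<in> {a..<b} \<Longrightarrow> (x \<longlongrightarrow> x t) (at_right t)"
  shows "parametric_rep a b x graph_param"
proof -
  define \<sigma> where "\<sigma> s = a + x a + s * (b + x b - (a + x a))" for s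
  have pos: "0 < b + x b - (a + x a)"
    using mono_onD[OF mono, of a b] ab by auto
  have param: "graph_param s = (graph_time a b x (\<sigma> s), \<sigma> s - graph_time a b x (\<sigma> s))" for s
    by (simp add: graph_param_def \<sigma>_def Let_def)
  have \<sigma>_image: "\<sigma> ` {0..1} = {a + x a..b + x b}"
  proof
    show "\<sigma> ` {0..1} \<subseteq> {a + x a..b + x b}"
    proof (clarsimp simp: \<sigma>_def)
      fix s :: real assume s: "0 \<le> s" "s \<le> 1"
      have "s * (b + x b - (a + x a)) \<le> b + x b - (a + x a)"
        using pos s by (intro mult_left_le_one_le) auto
      then show "0 \<le> s * (b + x b - (a + x a)) \<and> a + x a + s * (b + x b - (a + x a)) \<le> b + x b"
        using pos s mult_nonneg_nonneg[of s "b + x b - (a + x a)"] by linarith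
    qed
    show "{a + x a..b + x b} \<subseteq> \<sigma> ` {0..1}"
    proof
      fix v assume v: "v \<in> {a + x a..b + x b}"
      then have "v = \<sigma> ((v - (a + x a)) / (b + x b - (a + x a)))" using pos by (simp add: \<sigma>_def)
      then show "v \<in> \<sigma> ` {0..1}" using v pos by (intro image_eqI) auto
    qed
  qed
  have ll_ge: "x r \<le> left_lim a x t" if "r \<in> {a..<t}" "t \<in> {a..b}" for r t
    using left_lim_mono_ge[OF mono, of t r] that by auto
  have ll_le: "left_lim a x t \<le> B" if "\<And>r. r \<in> {a..<t} \<Longrightarrow> x r \<le> B" "t \<in> {a<..b}" for t B
    using left_lim_mono_le[OF mono, of t B] that by auto
  have ll_le_x: "left_lim a x t \<le> x t" if "t \<in> {a..b}" for t
  proof (cases "t = a")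
    case False
    then show ?thesis using that by (intro ll_le) (auto intro: mono_onD[OF mono])
  qed (simp add: left_lim_def)
  have graph: "completed_graph a b x = {(t, z). t \<in> {a..b} \<and> left_lim a x t \<le> z \<and> z \<le> x t}"
    using ll_le_x unfolding completed_graph_def by (auto simp: closed_segment_eq_real_ivl)
  have in_graph: "(graph_time a b x v, v - graph_time a b x v) \<in> completed_graph a b x"
    if v: "v \<in> {a + x a..b + x b}" for v
  proof -
    define t where "t = graph_time a b x v"
    have t: "t \<in> {a..b}" using graph_time_ge graph_time_le by (simp add: t_def)
    \<comment> \<open>All times just after \<open>t\<close> lie above level \<open>v\<close>, and
      right-continuity carries this to \<open>t\<close>. At \<open>b\<close> there is no later time,
      and the range of \<open>v\<close> is used instead.\<close>
    have "v \<le> t + x t"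
    proof (cases "t = b")
      case True
      then show ?thesis using v by simp
    next
      case False
      then have tb: "t < b" using t by auto
      have "((\<lambda>s. s + x s) \<longlongrightarrow> t + x t) (at_right t)"
        using rc[of t] t tb by (intro tendsto_intros) auto
      moreover have "\<forall>\<^sub>F s in at_right t. v \<le> s + x s"
      proof -
        have "\<forall>\<^sub>F s in at_right t. t < s \<and> s < b" using tb by (auto simp: eventually_at_right)
        then show ?thesis
          by eventually_elim (use t graph_time_lessD[of _ v] in \<open>auto simp: t_def intro: less_imp_le\<close>)
      qed
      ultimately show ?thesis by (rule tendsto_lowerbound) simp
    qed
    moreover have "left_lim a x t \<le> v - t"
    proof (cases "t = a")
      case True
      then show ?thesis using v by (simp add: left_lim_def)
    next
      case False
      show ?thesis
      proof (rule ll_le)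
        fix r assume r: "r \<in> {a..<t}"
        show "x r \<le> v - t"
        proof (rule ccontr)
          assume "\<not> ?thesis"
          \<comment> \<open>A time s between r and t is taken so late that s + x r already exceeds
            \<open>v\<close>.\<close>
          then have "max r (v - x r) < t" using r by auto
          then obtain s where s: "max r (v - x r) < s" "s < t" using dense by blast
          have "s + x s \<le> v" using s r t by (intro less_graph_timeD) (auto simp: t_def)
          moreover have "x r \<le> x s" using s r t by (intro mono_onD[OF mono]) auto
          ultimately show False using s by auto
        qed
      qed (use t False in auto)
    qed
    ultimately show ?thesis using t by (auto simp: graph t_def[symmetric])
  qed
  have surj: "\<exists>v\<in>{a + x a..b + x b}. (t, z) = (graph_time a b x v, v - graph_time a b x v)"
    if tz: "(t, z) \<in> completed_graph a b x" for t z
  proof (intro bexI[of _ "t + z"])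
    have t: "t \<in> {a..b}" "left_lim a x t \<le> z" "z \<le> x t" using tz by (auto simp: graph)
    have "graph_time a b x (t + z) = t"
    proof (rule graph_time_eqI)
      show "s + x s \<le> t + z" if "s \<in> {a..<t}" for s
        using ll_ge[OF that t(1)] t that by auto
      show "t + z < s + x s" if "s \<in> {t<..b}" for s
        using mono_onD[OF mono, of t s] t that by auto
    qed (use t in auto)
    then show "(t, z) = (graph_time a b x (t + z), t + z - graph_time a b x (t + z))" by simp
    have "x a \<le> z"
      using ll_ge[of a t] t by (cases "t = a") (auto simp: left_lim_def)
    moreover have "x t \<le> x b" using mono_onD[OF mono, of t b] t by auto
    ultimately show "t + z \<in> {a + x a..b + x b}" using t by auto
  qed
  show ?thesis
    unfolding parametric_rep_def
  proof (intro conjI ballI impI)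
    have "continuous_on UNIV (graph_time a b x)"
      using graph_time_lipschitz by (intro lipschitz_on_continuous_on[of 1]) (auto simp: lipschitz_on_def dist_real_def)
    then have "continuous_on A (\<lambda>s. graph_time a b x (\<sigma> s))" for A
      by (rule continuous_on_compose2) (auto simp: \<sigma>_def intro!: continuous_intros)
    then show "continuous_on {0..1} graph_param"
      unfolding param[abs_def] by (intro continuous_intros) (auto simp: \<sigma>_def intro!: continuous_intros)
    show "graph_param ` {0..1} = completed_graph a b x"
    proof -
      have "graph_param ` {0..1} = (\<lambda>v. (graph_time a b x v, v - graph_time a b x v)) ` (\<sigma> ` {0..1})"
        by (auto simp: param image_image)
      also have "\<dots> = completed_graph a b x"
        unfolding \<sigma>_image using in_graph surj by (auto simp: image_iff)
      finally show ?thesis .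
    qed
  next
    fix s s' :: real assume s: "s \<in> {0..1}" "s' \<in> {0..1}" "s \<le> s'"
    then have le: "\<sigma> s \<le> \<sigma> s'" using pos by (simp add: \<sigma>_def mult_right_mono)
    have "graph_param s \<in> completed_graph a b x"
      unfolding param using s \<sigma>_image by (intro in_graph) blast
    then have "left_lim a x (graph_time a b x (\<sigma> s)) \<le> \<sigma> s - graph_time a b x (\<sigma> s)"
      by (simp add: param graph)
    then show "graph_le a x (graph_param s) (graph_param s')"
      using le graph_time_mono[OF le] by (auto simp: graph_le_def param)
  qed
qed

end

section \<open>Bounds for the M1 distance of monotone paths\<close>

abbreviation rep_dist :: "(real \<Rightarrow> real \<times> real) \<Rightarrow> (real \<Rightarrow> real \<times> real) \<Rightarrow> real" where
  "rep_dist p q \<equiv> max (SUP s\<in>{0..1}. \<bar>fst (p s) - fst (q s)\<bar>) (SUP s\<in>{0..1}. \<bar>snd (p s) - snd (q s)\<bar>)"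

lemma parametric_rep_SUP_nonneg:
  assumes "parametric_rep a b x p" "parametric_rep a b y q"
  shows "0 \<le> (SUP s\<in>{0..1}. \<bar>fst (p s) - fst (q s)\<bar>)"
proof -
  have "continuous_on {0..1} p" "continuous_on {0..1} q" using assms by (auto simp: parametric_rep_def)
  then have "continuous_on {0..1} (\<lambda>s. \<bar>fst (p s) - fst (q s)\<bar>)" by (intro continuous_intros)
  then have "bdd_above ((\<lambda>s. \<bar>fst (p s) - fst (q s)\<bar>) ` {0..1})"
    by (intro bounded_imp_bdd_above compact_imp_bounded compact_continuous_image) auto
  then have "\<bar>fst (p 0) - fst (q 0)\<bar> \<le> (SUP s\<in>{0..1}. \<bar>fst (p s) - fst (q s)\<bar>)"
    by (intro cSUP_upper) auto
  then show ?thesis by linarith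
qed

text \<open>\<open>M1_dist\<close> is a real infimum, so a bound from below needs a nonempty set;
  the two given representations provide an element.\<close>

lemma M1_dist_nonneg:
  assumes "parametric_rep a b x p" "parametric_rep a b y q"
  shows "0 \<le> M1_dist a b x y"
  unfolding M1_dist_def
proof (rule cInf_greatest)
  fix v assume "v \<in> {rep_dist p q |p q.
      parametric_rep a b x p \<and> parametric_rep a b y q}"
  then show "0 \<le> v" using parametric_rep_SUP_nonneg by (auto simp: le_max_iff_disj)
qed (use assms in blast)

lemma M1_dist_le:
  assumes "parametric_rep a b x p" "parametric_rep a b y q"
    and "\<And>s. s \<in> {0..1} \<Longrightarrow> \<bar>fst (p s) - fst (q s)\<bar> \<le> B"
    and "\<And>s. s \<in> {0..1} \<Longrightarrow> \<bar>snd (p s) - snd (q s)\<bar> \<le> B"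
  shows "M1_dist a b x y \<le> B"
proof -
  have "M1_dist a b x y \<le> rep_dist p q"
    unfolding M1_dist_def using assms(1,2) parametric_rep_SUP_nonneg
    by (intro cInf_lower bdd_belowI[of _ 0]) (auto simp: le_max_iff_disj)
  also have "\<dots> \<le> B" using assms(3,4) by (intro max.boundedI cSUP_least) auto
  finally show ?thesis .
qed

text \<open>The hypothesis \<open>good\<close> asks for closeness only at one time in each window of
  length \<open>d\<close>. One such time just after the intersection point of \<open>x\<close> puts
  \<open>y\<close> above level \<sigma> - d there; waiting for it costs \<open>d\<close>, and the
  change of level costs another \<open>d\<close> by \<open>graph_time_add\<close>.\<close>

lemma graph_time_close:
  assumes ab: "a < b" and x: "mono_on {a..b} x" and y: "mono_on {a..b} y" and "0 < d"
    and good: "\<And>t. a \<le> t \<Longrightarrow> t + d \<le> b \<Longrightarrow> \<exists>r. t < r \<and> r < t + d \<and> \<bar>x r - y r\<bar> \<le> d"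
  shows "graph_time a b y \<sigma> \<le> graph_time a b x \<sigma> + 2 * d"
proof (cases "graph_time a b x \<sigma> + d \<le> b")
  case False
  then show ?thesis using graph_time_le[OF ab y, of \<sigma>] \<open>0 < d\<close> by linarith
next
  case True
  then obtain r where r: "graph_time a b x \<sigma> < r" "r < graph_time a b x \<sigma> + d" "\<bar>x r - y r\<bar> \<le> d"
    using good graph_time_ge[OF ab x] by blast
  then have r_ab: "r \<in> {a..b}" using True graph_time_ge[OF ab x, of \<sigma>] by auto
  then have "\<sigma> < r + x r" using graph_time_lessD[OF ab x] r by blast
  then have "\<sigma> - d < r + y r" using r(3) by linarith
  then have "graph_time a b y (\<sigma> - d) \<le> r"
    using less_graph_timeD[OF ab y r_ab, of "\<sigma> - d"] by linarith
  then show ?thesis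
    using graph_time_add[OF ab y, of "\<sigma> - d" \<sigma>] r \<open>0 < d\<close> by linarith
qed

text \<open>Both canonical parametrizations are compared at the same s. The levels differ by at most
  \<open>d\<close> because they interpolate linearly between the endpoint values; the times then
  differ by at most 2 * d + d, and the second coordinates by at most one more
  \<open>d\<close>.\<close>

lemma M1_dist_mono_le:
  assumes ab: "a < b" and x: "mono_on {a..b} x" and y: "mono_on {a..b} y" and "0 < d"
    and rcx: "\<And>t. t \<in> {a..<b} \<Longrightarrow> (x \<longlongrightarrow> x t) (at_right t)"
    and rcy: "\<And>t. t \<in> {a..<b} \<Longrightarrow> (y \<longlongrightarrow> y t) (at_right t)"
    and good: "\<And>t. a \<le> t \<Longrightarrow> t + d \<le> b \<Longrightarrow> \<exists>r. t < r \<and> r < t + d \<and> \<bar>x r - y r\<bar> \<le> d"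
    and ends: "\<bar>x a - y a\<bar> \<le> d" "\<bar>x b - y b\<bar> \<le> d"
  shows "0 \<le> M1_dist a b x y \<and> M1_dist a b x y \<le> 4 * d"
proof
  note px = parametric_rep_graph_param[OF ab x rcx] and py = parametric_rep_graph_param[OF ab y rcy]
  show "0 \<le> M1_dist a b x y" by (rule M1_dist_nonneg[OF px py])
  define \<sigma> where "\<sigma> s = a + x a + s * (b + x b - (a + x a))" for s
  define \<tau> where "\<tau> s = a + y a + s * (b + y b - (a + y a))" for s
  have \<sigma>\<tau>: "\<bar>\<sigma> s - \<tau> s\<bar> \<le> d" if "s \<in> {0..1}" for s
  proof -
    have "\<sigma> s - \<tau> s = (1 - s) * (x a - y a) + s * (x b - y b)"
      by (simp add: \<sigma>_def \<tau>_def algebra_simps)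
    also have "\<bar>\<dots>\<bar> \<le> (1 - s) * \<bar>x a - y a\<bar> + s * \<bar>x b - y b\<bar>"
      using that by (intro order_trans[OF abs_triangle_ineq]) (simp add: abs_mult)
    also have "\<dots> \<le> (1 - s) * d + s * d"
      using that ends by (intro add_mono mult_left_mono) auto
    finally show ?thesis by (simp add: algebra_simps)
  qed
  have gt: "\<bar>graph_time a b x v - graph_time a b y v\<bar> \<le> 2 * d" for v
  proof -
    have "graph_time a b y v \<le> graph_time a b x v + 2 * d"
      using good by (intro graph_time_close[OF ab x y \<open>0 < d\<close>]) auto
    moreover have "graph_time a b x v \<le> graph_time a b y v + 2 * d"
      using good by (intro graph_time_close[OF ab y x \<open>0 < d\<close>]) (auto simp: abs_minus_commute)
    ultimately show ?thesis by linarith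
  qed
  have close: "\<bar>graph_time a b x (\<sigma> s) - graph_time a b y (\<tau> s)\<bar> \<le> 3 * d" if "s \<in> {0..1}" for s
    using gt[of "\<sigma> s"] graph_time_lipschitz[OF ab y, of "\<sigma> s" "\<tau> s"] \<sigma>\<tau>[OF that] by linarith
  show "M1_dist a b x y \<le> 4 * d"
  proof (rule M1_dist_le[OF px py])
    fix s :: real assume s: "s \<in> {0..1}"
    show "\<bar>fst (graph_param a b x s) - fst (graph_param a b y s)\<bar> \<le> 4 * d"
      using close[OF s] \<open>0 < d\<close> by (simp add: graph_param_def[OF ab x] graph_param_def[OF ab y] Let_def \<sigma>_def \<tau>_def)
    show "\<bar>snd (graph_param a b x s) - snd (graph_param a b y s)\<bar> \<le> 4 * d"
      using close[OF s] \<sigma>\<tau>[OF s]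
      by (simp add: graph_param_def[OF ab x] graph_param_def[OF ab y] Let_def \<sigma>_def[symmetric] \<tau>_def[symmetric])
  qed
qed

definition mono_paths :: "(real \<Rightarrow> real) set" where
  "mono_paths = {x \<in> extensional {0<..}. mono_on {0<..} x \<and> (\<forall>t>0. (x \<longlongrightarrow> x t) (at_right t))}"

lemma mono_paths_subset_cadlag: "mono_paths \<subseteq> cadlag_space {0<..}"
proof
  fix x assume x: "x \<in> mono_paths"
  then have mono: "mono_on {0<..} x" and rc: "\<And>t. t > 0 \<Longrightarrow> (x \<longlongrightarrow> x t) (at_right t)"
    by (auto simp: mono_paths_def)
  have "cadlag_on {0<..} x"
    unfolding cadlag_on_def
  proof (intro ballI conjI)
    fix t :: real assume t: "t \<in> {0<..}"
    then have "{0<..} \<inter> {t<..} = {t<..}" by auto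
    then show "(x \<longlongrightarrow> x t) (at t within {0<..} \<inter> {t<..})" using rc t by auto
    have "(x \<longlongrightarrow> (SUP r\<in>{t/2..<t}. x r)) (at_left t)"
      using t by (intro mono_on_tendsto_left_SUP mono_on_subset[OF mono]) auto
    then show "\<exists>l. (x \<longlongrightarrow> l) (at t within {0<..} \<inter> {..<t})"
      by (meson tendsto_within_subset Int_lower2)
  qed
  then show "x \<in> cadlag_space {0<..}" using x by (auto simp: cadlag_space_def mono_paths_def)
qed

text \<open>For nondecreasing paths pointwise convergence on a dense set suffices: monotonicity
  spreads it to continuity points, in particular to \<open>a\<close> and \<open>b\<close>, and
  finitely many points of \<open>D\<close> meet every window of length \<open>d\<close>.\<close>

lemma mono_paths_converges_locally:
  assumes x: "x \<in> mono_paths" and xs: "\<And>n. xs n \<in> mono_paths"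
    and dense: "\<And>s t. 0 < s \<Longrightarrow> s < t \<Longrightarrow> \<exists>u\<in>D. s < u \<and> u < t"
    and conv: "\<And>u. u \<in> D \<Longrightarrow> (\<lambda>n. xs n u) \<longlonglongrightarrow> x u"
  shows "converges_locally M1_dist xs x"
  unfolding converges_locally_def
proof (intro allI impI)
  fix a b assume ab: "0 < a \<and> a < b \<and> isCont x a \<and> isCont x b"
  have mono: "mono_on {0<..} x" "mono_on {0<..} (xs n)" for n
    using x xs by (auto simp: mono_paths_def)
  have rc: "\<And>t. t > 0 \<Longrightarrow> (x \<longlongrightarrow> x t) (at_right t)" "\<And>n t. t > 0 \<Longrightarrow> (xs n \<longlongrightarrow> xs n t) (at_right t)"
    using x xs by (auto simp: mono_paths_def)
  have cont_conv: "(\<lambda>n. xs n t) \<longlonglongrightarrow> x t" if t: "0 < t" "isCont x t" for t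
  proof (rule LIMSEQ_I)
    fix e :: real assume "0 < e"
    then obtain d where d: "0 < d" "\<And>s. \<bar>s - t\<bar> < d \<Longrightarrow> \<bar>x s - x t\<bar> < e / 2"
      using t(2) unfolding continuous_at_eps_delta dist_real_def by (meson half_gt_zero)
    have "max (t / 2) (t - d) < t" using t d by auto
    then obtain u where u: "u \<in> D" "max (t / 2) (t - d) < u" "u < t"
      using dense[of "max (t / 2) (t - d)" t] t by (auto simp: less_max_iff_disj)
    obtain v where v: "v \<in> D" "t < v" "v < t + d" using dense[of t "t + d"] t d by auto
    have "\<forall>\<^sub>F n in sequentially. \<bar>xs n u - x u\<bar> < e / 2" "\<forall>\<^sub>F n in sequentially. \<bar>xs n v - x v\<bar> < e / 2"
      using tendstoD[OF conv[OF u(1)], of "e / 2"] tendstoD[OF conv[OF v(1)], of "e / 2"] \<open>0 < e\<close>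
      by (simp_all only: dist_real_def half_gt_zero)
    then have "\<forall>\<^sub>F n in sequentially. norm (xs n t - x t) < e"
    proof eventually_elim
      case (elim n)
      have "xs n u \<le> xs n t" "xs n t \<le> xs n v"
        using u v t by (auto intro!: mono_onD[OF mono(2)])
      moreover have "\<bar>x u - x t\<bar> < e / 2" "\<bar>x v - x t\<bar> < e / 2" using u v d(2)[of u] d(2)[of v] by auto
      ultimately show ?case using elim unfolding real_norm_def by linarith
    qed
    then show "\<exists>no. \<forall>n\<ge>no. norm (xs n t - x t) < e" by (simp add: eventually_sequentially)
  qed
  have "\<forall>\<^sub>F n in sequentially. \<bar>M1_dist a b (xs n) x\<bar> \<le> 4 * d" if d: "0 < d" for d
  proof -
    \<comment> \<open>Mesh d / 2: any window of length \<open>d\<close> contains the interior of a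
      full cell of this grid, hence the chosen point of \<open>D\<close> in that cell.\<close>
    define p where "p i = a + real i * d / 2" for i :: nat
    have "\<exists>u\<in>D. p i < u \<and> u < p (Suc i)" for i
      using ab d by (intro dense) (auto simp: p_def algebra_simps intro!: add_pos_nonneg)
    then obtain f where f: "\<And>i. f i \<in> D" "\<And>i. p i < f i" "\<And>i. f i < p (Suc i)" by metis
    define m where "m = nat \<lceil>2 * (b - a) / d\<rceil>"
    have "\<forall>\<^sub>F n in sequentially. \<forall>i\<in>{..m}. \<bar>xs n (f i) - x (f i)\<bar> < d"
      using conv[OF f(1)] d by (intro eventually_ball_finite) (auto simp: tendsto_iff dist_real_def)
    moreover have "\<forall>\<^sub>F n in sequentially. \<bar>xs n a - x a\<bar> < d" "\<forall>\<^sub>F n in sequentially. \<bar>xs n b - x b\<bar> < d"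
      using cont_conv[of a] cont_conv[of b] ab d by (auto simp: tendsto_iff dist_real_def)
    ultimately show ?thesis
    proof eventually_elim
      case (elim n)
      have "0 \<le> M1_dist a b (xs n) x \<and> M1_dist a b (xs n) x \<le> 4 * d"
      proof (rule M1_dist_mono_le)
        fix t assume t: "a \<le> t" "t + d \<le> b"
        define i where "i = nat \<lceil>2 * (t - a) / d\<rceil>"
        have i_eq: "real i = of_int \<lceil>2 * (t - a) / d\<rceil>" using t d by (simp add: i_def)
        have "2 * (t - a) / d \<le> real i" "real i < 2 * (t - a) / d + 1" unfolding i_eq by linarith+
        then have "t \<le> p i" "p (Suc i) < t + d" using d by (auto simp: p_def field_simps)
        moreover have "i \<le> m" unfolding i_def m_def using t d
          by (intro nat_mono ceiling_mono divide_right_mono) auto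
        ultimately show "\<exists>r>t. r < t + d \<and> \<bar>xs n r - x r\<bar> \<le> d"
          using f(2,3)[of i] elim by (intro exI[of _ "f i"]) (auto intro: less_imp_le)
      qed (use ab d elim rc in \<open>auto intro: mono_on_subset[OF mono(1)] mono_on_subset[OF mono(2)]\<close>)
      then show ?case by simp
    qed
  qed
  then show "(\<lambda>n. M1_dist a b (xs n) x) \<longlonglongrightarrow> 0"
  proof (intro tendstoI)
    fix e :: real assume "0 < e"
      and *: "\<And>d. 0 < d \<Longrightarrow> \<forall>\<^sub>F n in sequentially. \<bar>M1_dist a b (xs n) x\<bar> \<le> 4 * d"
    then show "\<forall>\<^sub>F n in sequentially. dist (M1_dist a b (xs n) x) 0 < e"
      using *[of "e / 5"] by (auto elim!: eventually_mono)
  qed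
qed

section \<open>Functionals of the completed graph in the M2 topology\<close>

lemma cadlag_on_at_right:
  assumes "cadlag_on {0..} x" "0 \<le> t"
  shows "(x \<longlongrightarrow> x t) (at_right t)"
proof -
  have "{0..} \<inter> {t<..} = {t<..}" using assms(2) by auto
  then show ?thesis using assms unfolding cadlag_on_def by (metis atLeast_iff)
qed

lemma cadlag_on_left_lim:
  assumes "cadlag_on {0..} x" "0 < t"
  shows "(x \<longlongrightarrow> left_lim 0 x t) (at_left t)"
proof -
  have "at t within ({0..} \<inter> {..<t}) = at_left t"
    using assms(2) by (intro at_within_nhd[of t "{0<..}"]) auto
  moreover have "\<exists>l. (x \<longlongrightarrow> l) (at t within ({0..} \<inter> {..<t}))"
    using assms by (simp add: cadlag_on_def)
  ultimately obtain l where "(x \<longlongrightarrow> l) (at_left t)" by auto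
  then show ?thesis
    using assms(2) by (simp add: left_lim_def tendsto_Lim trivial_limit_at_left_real)
qed

text \<open>One-sided limits bound the path near each point; compactness of the interval makes the
  bound uniform.\<close>

lemma cadlag_on_bounded:
  assumes x: "cadlag_on {0..} x"
  shows "\<exists>B. \<forall>t\<in>{0..T}. \<bar>x t\<bar> \<le> B"
proof -
  have loc: "\<exists>U B. open U \<and> t \<in> U \<and> (\<forall>s\<in>U \<inter> {0..}. \<bar>x s\<bar> \<le> B)" if t: "0 \<le> t" for t
  proof -
    have right: "(x \<longlongrightarrow> x t) (at t within {0..} \<inter> {t<..})"
      using x t by (auto simp: cadlag_on_def)
    obtain l where left: "(x \<longlongrightarrow> l) (at t within {0..} \<inter> {..<t})"
      using x t by (force simp: cadlag_on_def)
    obtain U where U: "open U" "t \<in> U" "\<And>s. s \<in> U \<Longrightarrow> s \<noteq> t \<Longrightarrow> s \<in> {0..} \<inter> {t<..} \<Longrightarrow> dist (x s) (x t) < 1"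
      using tendstoD[OF right, of 1] unfolding eventually_at_topological by auto
    obtain V where V: "open V" "t \<in> V" "\<And>s. s \<in> V \<Longrightarrow> s \<noteq> t \<Longrightarrow> s \<in> {0..} \<inter> {..<t} \<Longrightarrow> dist (x s) l < 1"
      using tendstoD[OF left, of 1] unfolding eventually_at_topological by auto
    have "\<bar>x s\<bar> \<le> \<bar>x t\<bar> + \<bar>l\<bar> + 1" if "s \<in> (U \<inter> V) \<inter> {0..}" for s
      using U(3)[of s] V(3)[of s] that by (cases s t rule: linorder_cases) (auto simp: dist_real_def)
    then show ?thesis using U(1,2) V(1,2) by (intro exI[of _ "U \<inter> V"]) blast
  qed
  then obtain U B where UB: "\<And>t. 0 \<le> t \<Longrightarrow> open (U t)" "\<And>t. 0 \<le> t \<Longrightarrow> t \<in> U t"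
      "\<And>t s. 0 \<le> t \<Longrightarrow> s \<in> U t \<inter> {0..} \<Longrightarrow> \<bar>x s\<bar> \<le> B t"
    by metis
  obtain C where C: "C \<subseteq> {0..T}" "finite C" "{0..T} \<subseteq> (\<Union>t\<in>C. U t)"
  proof (rule compactE_image[OF compact_Icc, of "{0..T}" U 0 T])
    show "open (U t)" if "t \<in> {0..T}" for t using UB(1) that by simp
    show "{0..T} \<subseteq> (\<Union>t\<in>{0..T}. U t)" using UB(2) by (meson UN_iff atLeastAtMost_iff subsetI)
  qed
  show ?thesis
  proof (intro exI ballI)
    fix t assume t: "t \<in> {0..T}"
    then obtain c where c: "c \<in> C" "t \<in> U c" using C by auto
    then have "\<bar>x t\<bar> \<le> B c" using UB(3)[of c t] C t by auto
    also have "\<dots> \<le> \<bar>B c\<bar>" by simp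
    also have "\<dots> \<le> (\<Sum>c\<in>C. \<bar>B c\<bar>)" using C c by (intro member_le_sum) auto
    finally show "\<bar>x t\<bar> \<le> (\<Sum>c\<in>C. \<bar>B c\<bar>)" .
  qed
qed

text \<open>A cadlag path has countably many discontinuities. Each point of \<open>A n\<close>,
  where the oscillation is at least 1 / (n + 1) at every scale, is followed by an interval without
  further points of \<open>A n\<close>, and these intervals are disjoint. Convergence on the
  half-line speaks only of continuity points, so arbitrarily late ones must exist.\<close>

lemma cadlag_on_isCont_unbounded:
  assumes x: "cadlag_on {0..} x" and a: "0 \<le> a"
  shows "\<exists>T>a. isCont x T"
proof -
  define A where "A n = {t\<in>{a<..}. \<forall>d>0. \<exists>r s. \<bar>r - t\<bar> < d \<and> \<bar>s - t\<bar> < d \<and> \<bar>x r - x s\<bar> \<ge> 1 / real (Suc n)}"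
    for n
  have "countable (A n)" for n
  proof -
    have "\<exists>d>0. \<forall>r. t < r \<and> r < t + d \<longrightarrow> \<bar>x r - x t\<bar> < 1 / (2 * real (Suc n))" if "t \<in> A n" for t
    proof -
      have "\<forall>\<^sub>F r in at_right t. dist (x r) (x t) < 1 / (2 * real (Suc n))"
        using that a by (intro tendstoD[OF cadlag_on_at_right[OF x]]) (auto simp: A_def)
      then obtain b where "b > t" "\<forall>r>t. r < b \<longrightarrow> dist (x r) (x t) < 1 / (2 * real (Suc n))"
        unfolding eventually_at_right[OF less_add_one[of t]] by blast
      then show ?thesis by (intro exI[of _ "b - t"]) (auto simp: dist_real_def)
    qed
    then obtain d where d: "\<And>t. t \<in> A n \<Longrightarrow> d t > 0"
        "\<And>t r. t \<in> A n \<Longrightarrow> t < r \<Longrightarrow> r < t + d t \<Longrightarrow> \<bar>x r - x t\<bar> < 1 / (2 * real (Suc n))"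
      by metis
    have sep: "t + d t \<le> t'" if t: "t \<in> A n" "t' \<in> A n" "t < t'" for t t'
    proof (rule ccontr)
      assume "\<not> ?thesis"
      then have "min (t' - t) (t + d t - t') > 0" using t by auto
      then obtain r s where rs: "\<bar>r - t'\<bar> < min (t' - t) (t + d t - t')" "\<bar>s - t'\<bar> < min (t' - t) (t + d t - t')"
          "\<bar>x r - x s\<bar> \<ge> 1 / real (Suc n)"
        using t(2) unfolding A_def by blast
      then have "\<bar>x r - x t\<bar> < 1 / (2 * real (Suc n))" "\<bar>x s - x t\<bar> < 1 / (2 * real (Suc n))"
        by (intro d(2)[OF t(1)]; simp add: abs_less_iff; linarith)+
      then have "\<bar>x r - x s\<bar> < 2 * (1 / (2 * real (Suc n)))" by linarith
      moreover have "2 * (1 / (2 * real (Suc n))) = 1 / real (Suc n)" by (simp add: divide_simps)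
      ultimately have "\<bar>x r - x s\<bar> < 1 / real (Suc n)" by (simp only:)
      then show False using rs(3) by (metis not_le)
    qed
    define I where "I t = {t<..<t + d t}" for t
    have disj: "disjnt (I t) (I t')" if "t \<in> A n" "t' \<in> A n" "t \<noteq> t'" for t t'
      using that sep[of t t'] sep[of t' t] by (cases t t' rule: linorder_cases) (auto simp: I_def disjnt_iff)
    have "inj_on I (A n)"
    proof (rule inj_onI, rule ccontr)
      fix t t' assume "t \<in> A n" "t' \<in> A n" "I t = I t'" "t \<noteq> t'"
      then have "I t = {}" using disj[of t t'] by (auto simp: disjnt_def)
      then show False using d(1)[OF \<open>t \<in> A n\<close>] by (auto simp: I_def)
    qed
    moreover have "countable (I ` A n)"
      using disj by (intro countable_disjoint_open_subsets) (auto simp: I_def pairwise_def)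
    ultimately show ?thesis by (rule countable_image_inj_on[rotated])
  qed
  then have "countable (\<Union>n. A n)" by auto
  moreover have "uncountable {a<..<a + 1}" by (simp add: uncountable_open_interval)
  ultimately have "\<not> {a<..<a + 1} \<subseteq> (\<Union>n. A n)" using countable_subset by blast
  then obtain T where "T \<in> {a<..<a + 1}" "T \<notin> (\<Union>n. A n)" by blast
  then have T: "a < T" "\<And>n. T \<notin> A n" by auto
  have "isCont x T"
    unfolding continuous_at_eps_delta
  proof (intro allI impI)
    fix e :: real assume "e > 0"
    then obtain n where n: "1 / real (Suc n) < e" using nat_approx_posE by (metis)
    then obtain d where d: "d > 0" "\<And>r s. \<bar>r - T\<bar> < d \<Longrightarrow> \<bar>s - T\<bar> < d \<Longrightarrow> \<bar>x r - x s\<bar> < 1 / real (Suc n)"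
      using T(1) T(2)[of n] unfolding A_def by (auto simp: not_le)
    have "dist (x s) (x T) < e" if "dist s T < d" for s
      using d(2)[of s T] d(1) n that by (auto simp: dist_real_def)
    then show "\<exists>d>0. \<forall>x'. dist x' T < d \<longrightarrow> dist (x x') (x T) < e" using d(1) by blast
  qed
  then show ?thesis using T(1) by blast
qed

text \<open>The completed graph without a right end. Functionals of it involve no horizon, while the
  horizons in \<open>converges_half_line\<close> depend on the continuity points of the
  limit.\<close>

definition half_line_graph :: "(real \<Rightarrow> real) \<Rightarrow> (real \<times> real) set" where
  "half_line_graph x = {(t, z). 0 \<le> t \<and> z \<in> closed_segment (left_lim 0 x t) (x t)}"

lemma completed_graph_half_line: "completed_graph 0 T x = {p \<in> half_line_graph x. fst p \<le> T}"
  by (auto simp: completed_graph_def half_line_graph_def)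

lemma half_line_graphI: "0 \<le> t \<Longrightarrow> (t, x t) \<in> half_line_graph x"
  by (simp add: half_line_graph_def)

lemma bounded_completed_graph:
  assumes x: "cadlag_on {0..} x"
  shows "bounded (completed_graph 0 T x)"
proof -
  obtain B where B: "\<And>t. t \<in> {0..T} \<Longrightarrow> \<bar>x t\<bar> \<le> B"
    using cadlag_on_bounded[OF x] by blast
  have ll: "\<bar>left_lim 0 x t\<bar> \<le> B" if t: "t \<in> {0..T}" for t
  proof (cases "t = 0")
    case False
    then have "0 < t" using t by auto
    have "\<forall>\<^sub>F s in at_left t. 0 < s \<and> s < t" using \<open>0 < t\<close> by (auto simp: eventually_at_left)
    then have "\<forall>\<^sub>F s in at_left t. \<bar>x s\<bar> \<le> B"
      by eventually_elim (use B t in auto)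
    with tendsto_rabs[OF cadlag_on_left_lim[OF x \<open>0 < t\<close>]] show ?thesis
      by (rule tendsto_upperbound) (simp add: trivial_limit_at_left_real)
  qed (use B t in \<open>simp add: left_lim_def\<close>)
  have "completed_graph 0 T x \<subseteq> {0..T} \<times> {-B..B}"
  proof
    fix p assume "p \<in> completed_graph 0 T x"
    then obtain t z where p: "p = (t, z)" "t \<in> {0..T}" "z \<in> closed_segment (left_lim 0 x t) (x t)"
      by (auto simp: completed_graph_def)
    moreover have "closed_segment (left_lim 0 x t) (x t) \<subseteq> {-B..B}"
      using ll[OF p(2)] B[OF p(2)] by (intro closed_segment_subset) auto
    ultimately show "p \<in> {0..T} \<times> {-B..B}" by auto
  qed
  then show ?thesis by (rule bounded_subset[rotated]) (intro bounded_Times bounded_closed_interval)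
qed

lemma infdist_less_iff: "A \<noteq> {} \<Longrightarrow> infdist p A < d \<longleftrightarrow> (\<exists>q\<in>A. dist p q < d)"
  by (simp add: infdist_notempty cINF_less_iff bdd_belowI[of _ 0])

text \<open>The two suprema in the Hausdorff distance control individual points only if they are
  taken over bounded sets of reals, which boundedness of \<open>A\<close> and \<open>B\<close>
  ensures.\<close>

lemma hausdorff_dist_lessD:
  assumes "bounded A" "bounded B" "A \<noteq> {}" "B \<noteq> {}" and d: "hausdorff_dist A B < d"
  shows "p \<in> A \<Longrightarrow> \<exists>q\<in>B. dist p q < d" and "q \<in> B \<Longrightarrow> \<exists>p\<in>A. dist p q < d"
proof -
  have bdd: "bdd_above ((\<lambda>p. infdist p B) ` A)" if AB: "bounded A" "B \<noteq> {}" for A B :: "'a set"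
  proof -
    obtain b where b: "b \<in> B" using AB by blast
    obtain K where K: "\<And>p. p \<in> A \<Longrightarrow> dist b p \<le> K" using AB(1) unfolding bounded_any_center[where a=b] by blast
    then show ?thesis
      using order_trans[OF infdist_le[OF b] K[unfolded dist_commute[of b]]]
      by (intro bdd_aboveI[of _ K]) blast
  qed
  show "\<exists>q\<in>B. dist p q < d" if "p \<in> A"
  proof -
    have "infdist p B \<le> (SUP p\<in>A. infdist p B)" using bdd[OF assms(1,4)] that by (rule cSUP_upper[rotated])
    then have "infdist p B < d" using d by (simp add: hausdorff_dist_def)
    then show ?thesis using infdist_less_iff[OF assms(4)] by blast
  qed
  show "\<exists>p\<in>A. dist p q < d" if "q \<in> B"
  proof -
    have "infdist q A \<le> (SUP q\<in>B. infdist q A)" using bdd[OF assms(2,3)] that by (rule cSUP_upper[rotated])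
    then have "infdist q A < d" using d by (simp add: hausdorff_dist_def)
    then show ?thesis using infdist_less_iff[OF assms(3)] by (metis dist_commute)
  qed
qed

lemma continuous_map_sequential_topology:
  fixes f :: "'a \<Rightarrow> 'b::topological_space"
  assumes "\<And>x xs. x \<in> S \<Longrightarrow> (\<And>n. xs n \<in> S) \<Longrightarrow> conv xs x \<Longrightarrow> (\<lambda>n. f (xs n)) \<longlonglongrightarrow> f x"
  shows "continuous_map (sequential_topology S conv) euclidean f"
  unfolding continuous_map_def
proof (intro conjI allI impI)
  fix U :: "'b set" assume "openin euclidean U"
  then have "open U" by simp
  have "\<forall>\<^sub>F n in sequentially. xs n \<in> {x \<in> S. f x \<in> U}"
    if "x \<in> S" "f x \<in> U" "\<forall>n. xs n \<in> S" "conv xs x" for x xs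
    using topological_tendstoD[OF assms[of x xs] \<open>open U\<close>] that by auto
  then show "openin (sequential_topology S conv) {x \<in> topspace (sequential_topology S conv). f x \<in> U}"
    by (auto simp: openin_sequential_topology)
qed auto

text \<open>A Urysohn function for the condition that the graph avoids \<open>B\<close>: it vanishes
  if the graph meets \<open>B\<close> and equals 1 if the graph keeps distance \<open>r\<close>. The
  truncation at 1 also removes the influence of late times.\<close>

definition graph_gap :: "(real \<times> real) set \<Rightarrow> real \<Rightarrow> (real \<Rightarrow> real) \<Rightarrow> real" where
  "graph_gap B r x = (INF p\<in>half_line_graph x. min 1 (infdist p B / r))"

lemma half_line_graph_nonempty: "half_line_graph x \<noteq> {}"
  using half_line_graphI[of 0 x] by blast

context
  fixes B :: "(real \<times> real) set" and r T0 :: real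
  assumes B: "B \<noteq> {}" "B \<subseteq> {..T0} \<times> UNIV" and r: "0 < r"
begin

lemma graph_gap_bdd: "bdd_below ((\<lambda>p. min 1 (infdist p B / r)) ` half_line_graph x)"
  using r by (intro bdd_belowI[of _ 0]) (auto simp: infdist_nonneg)

lemma graph_gap_le: "p \<in> half_line_graph x \<Longrightarrow> graph_gap B r x \<le> min 1 (infdist p B / r)"
  unfolding graph_gap_def by (rule cINF_lower[OF graph_gap_bdd])

lemma graph_gap_nonneg: "0 \<le> graph_gap B r x"
  unfolding graph_gap_def using half_line_graph_nonempty r
  by (intro cINF_greatest) (auto simp: infdist_nonneg)

lemma graph_gap_le_1: "graph_gap B r x \<le> 1"
  using graph_gap_le[OF half_line_graphI[of 0 x]] by simp

lemma graph_gap_pos_disjoint: "0 < graph_gap B r x \<Longrightarrow> half_line_graph x \<inter> B = {}"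
proof (rule ccontr)
  assume "0 < graph_gap B r x" "half_line_graph x \<inter> B \<noteq> {}"
  then obtain p where "p \<in> half_line_graph x" "p \<in> B" by blast
  then show False using graph_gap_le[of p x] \<open>0 < graph_gap B r x\<close> by simp
qed

lemma graph_gap_eq_1: "(\<And>p. p \<in> half_line_graph x \<Longrightarrow> r \<le> infdist p B) \<Longrightarrow> graph_gap B r x = 1"
  using graph_gap_le_1[of x] r half_line_graph_nonempty[of x]
  by (intro antisym) (auto simp: graph_gap_def intro!: cINF_greatest)

text \<open>Points of the graph later than T0 + r are at least \<open>r\<close> away from
  \<open>B\<close> in the time coordinate alone, so the truncated distance is 1 there. Closeness up
  to \<open>T\<close> therefore controls the whole infimum.\<close>

lemma graph_gap_perturb:
  assumes near: "\<And>p. p \<in> half_line_graph x \<Longrightarrow> fst p \<le> T \<Longrightarrow> \<exists>q\<in>half_line_graph y. dist p q < d"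
    and T: "T0 + r \<le> T" and "0 < d"
  shows "graph_gap B r y \<le> graph_gap B r x + d / r"
proof -
  have "graph_gap B r y - d / r \<le> graph_gap B r x"
    unfolding graph_gap_def[of B r x]
  proof (rule cINF_greatest[OF half_line_graph_nonempty])
    fix p assume p: "p \<in> half_line_graph x"
    show "graph_gap B r y - d / r \<le> min 1 (infdist p B / r)"
    proof (cases "fst p \<le> T")
      case True
      then obtain q where q: "q \<in> half_line_graph y" "dist p q < d" using near[OF p] by blast
      have "infdist q B \<le> infdist p B + d"
        using infdist_triangle[of q B p] q by (simp add: dist_commute)
      then have "infdist q B / r \<le> infdist p B / r + d / r"
        using r by (simp add: field_simps)
      then show ?thesis using graph_gap_le[OF q(1)] r \<open>0 < d\<close> divide_pos_pos[of d r] by linarith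
    next
      case False
      have "r \<le> infdist p B"
        unfolding infdist_def using B(1)
      proof (simp, intro cINF_greatest)
        fix b assume "b \<in> B"
        then have "fst b \<le> T0" using B(2) by auto
        then have "r \<le> dist (fst p) (fst b)" using False T by (simp add: dist_real_def)
        also have "\<dots> \<le> dist p b" by (rule dist_fst_le)
        finally show "r \<le> dist p b" .
      qed
      then have "1 \<le> infdist p B / r" using r by simp
      then show ?thesis using graph_gap_le_1[of y] \<open>0 < d\<close> r divide_pos_pos[of d r] by linarith
    qed
  qed
  then show ?thesis by simp
qed

lemma continuous_map_graph_gap: "continuous_map M2_topology euclideanreal (graph_gap B r)"
  unfolding M2_topology_def
proof (rule continuous_map_sequential_topology)
  fix x xs assume x: "x \<in> cadlag_space {0..}" and xs: "\<And>n. xs n \<in> cadlag_space {0..}"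
    and conv: "converges_half_line M2_dist xs x"
  have cx: "cadlag_on {0..} x" "cadlag_on {0..} (xs n)" for n
    using x xs by (auto simp: cadlag_space_def)
  obtain T where T: "max 0 (T0 + r) < T" "isCont x T"
    using cadlag_on_isCont_unbounded[OF cx(1), of "max 0 (T0 + r)"] by auto
  then have lim: "(\<lambda>n. M2_dist 0 T (xs n) x) \<longlonglongrightarrow> 0"
    using conv by (auto simp: converges_half_line_def)
  show "(\<lambda>n. graph_gap B r (xs n)) \<longlonglongrightarrow> graph_gap B r x"
  proof (rule tendstoI)
    fix e :: real assume "0 < e"
    define d where "d = e * r / 2"
    have d: "0 < d" "d / r = e / 2" using \<open>0 < e\<close> r by (auto simp: d_def)
    have "\<forall>\<^sub>F n in sequentially. M2_dist 0 T (xs n) x < d"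
      using lim d by (intro order_tendstoD) auto
    then show "\<forall>\<^sub>F n in sequentially. dist (graph_gap B r (xs n)) (graph_gap B r x) < e"
    proof eventually_elim
      case (elim n)
      have ne: "completed_graph 0 T y \<noteq> {}" for y
        using T half_line_graphI[of 0 y] by (force simp: completed_graph_half_line)
      note H = hausdorff_dist_lessD[OF bounded_completed_graph[OF cx(2)] bounded_completed_graph[OF cx(1)] ne ne
          elim[unfolded M2_dist_def]]
      have "graph_gap B r x \<le> graph_gap B r (xs n) + d / r"
        using H(1) T d(1) by (intro graph_gap_perturb[of _ T]) (auto simp: completed_graph_half_line)
      moreover have "graph_gap B r (xs n) \<le> graph_gap B r x + d / r"
        using H(2) T d(1) by (intro graph_gap_perturb[of _ T]) (auto simp: completed_graph_half_line dist_commute)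
      ultimately show ?case using d(2) \<open>0 < e\<close> by (simp add: dist_real_def)
    qed
  qed
qed

end

section \<open>Weak convergence from countably many events\<close>

lemma sets_completion_iff_AE:
  assumes V: "V \<in> sets (completion M)" and ae: "AE \<omega> in M. \<omega> \<in> A \<longleftrightarrow> \<omega> \<in> V" and "A \<subseteq> space M"
  shows "A \<in> sets (completion M)"
proof -
  obtain N where N: "N \<in> null_sets M" "{\<omega>\<in>space M. \<not> (\<omega> \<in> A \<longleftrightarrow> \<omega> \<in> V)} \<subseteq> N"
    using ae by (auto simp: eventually_ae_filter)
  have "A = (V - N) \<union> (A \<inter> N)"
    using N(2) \<open>A \<subseteq> space M\<close> sets.sets_into_space[OF V] by auto
  moreover have "V - N \<in> sets (completion M)" using V N(1) by auto
  moreover have "A \<inter> N \<in> sets (completion M)" using N(1) by (rule sets_completionI_sub) auto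
  ultimately show ?thesis by (metis sets.Un)
qed

lemma (in finite_measure) measure_conj_not:
  assumes [measurable]: "{\<omega> \<in> space M. P \<omega>} \<in> sets M" "{\<omega> \<in> space M. R \<omega>} \<in> sets M"
  shows "measure M {\<omega> \<in> space M. P \<omega> \<and> \<not> R \<omega>} =
    measure M {\<omega> \<in> space M. P \<omega>} - measure M {\<omega> \<in> space M. P \<omega> \<and> R \<omega>}"
proof -
  have "{\<omega> \<in> space M. P \<omega> \<and> \<not> R \<omega>} = {\<omega> \<in> space M. P \<omega>} - {\<omega> \<in> space M. P \<omega> \<and> R \<omega>}" by auto
  then show ?thesis by (simp add: finite_measure_Diff subset_eq)
qed

lemma random_element_measurable_continuous:
  fixes f :: "'s \<Rightarrow> real"
  assumes X: "random_element M \<tau> X" and f: "continuous_map \<tau> euclideanreal f"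
  shows "(\<lambda>\<omega>. f (X \<omega>)) \<in> borel_measurable (completion M)"
proof (rule borel_measurableI)
  fix U :: "real set" assume "open U"
  then have "openin \<tau> {x \<in> topspace \<tau>. f x \<in> U}"
    using f by (auto simp: continuous_map_def)
  then have 1: "X -` {x \<in> topspace \<tau>. f x \<in> U} \<inter> space M \<in> sets (completion M)"
    using X by (auto simp: random_element_def)
  have "AE \<omega> in M. X \<omega> \<in> topspace \<tau>"
    using X by (auto simp: random_element_def)
  then have "AE \<omega> in M. \<omega> \<in> (\<lambda>\<omega>. f (X \<omega>)) -` U \<inter> space M \<longleftrightarrow>
      \<omega> \<in> X -` {x \<in> topspace \<tau>. f x \<in> U} \<inter> space M"
    by eventually_elim auto
  then have "(\<lambda>\<omega>. f (X \<omega>)) -` U \<inter> space M \<in> sets (completion M)"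
    by (rule sets_completion_iff_AE[OF 1]) simp
  then show "(\<lambda>\<omega>. f (X \<omega>)) -` U \<inter> space (completion M) \<in> sets (completion M)"
    by simp
qed

section \<open>Convergence in law read off from a countable family of bits\<close>

context
  fixes S E :: "'s set" and conv :: "(nat \<Rightarrow> 's) \<Rightarrow> 's \<Rightarrow> bool" and b :: "nat \<Rightarrow> 's \<Rightarrow> bool"
  assumes ES: "E \<subseteq> S"
    and det: "\<And>x y. x \<in> E \<Longrightarrow> (\<And>k. y k \<in> E) \<Longrightarrow> (\<And>k j. j < k \<Longrightarrow> b j (y k) = b j x) \<Longrightarrow> conv y x"
begin

text \<open>The first \<open>k\<close> bits of a point. By \<open>det\<close>, points of
  \<open>E\<close> that share ever longer initial patterns with \<open>x\<close> converge to
  \<open>x\<close>; patterns thus play the role of cylinder neighbourhoods on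
  \<open>E\<close>.\<close>

definition pattern :: "nat \<Rightarrow> 's \<Rightarrow> nat set" where
  "pattern k x = {j. j < k \<and> b j x}"

lemma pattern_eq_iff: "pattern k x = pattern k y \<longleftrightarrow> (\<forall>j<k. b j x = b j y)"
  by (auto simp: pattern_def)

lemma pattern_in_Pow: "pattern k x \<in> Pow {..<k}"
  by (auto simp: pattern_def)

lemma pattern_sets:
  assumes "\<And>j. {\<omega> \<in> space M. b j (X \<omega>)} \<in> sets M"
  shows "{\<omega> \<in> space M. pattern k (X \<omega>) = P} \<in> sets M"
proof -
  have "{\<omega> \<in> space M. pattern k (X \<omega>) = P} =
      {\<omega> \<in> space M. P \<subseteq> {..<k} \<and> (\<forall>j<k. b j (X \<omega>) \<longleftrightarrow> j \<in> P)}"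
    by (auto simp: pattern_def)
  also have "\<dots> \<in> sets M"
    using assms by measurable
  finally show ?thesis .
qed

text \<open>Otherwise points of \<open>E\<close> outside \<open>U\<close> that agree with
  \<open>x\<close> in the first \<open>k\<close> bits, one for each \<open>k\<close>, converge to
  \<open>x\<close> by \<open>det\<close>, contradicting the sequential openness of
  \<open>U\<close>.\<close>

lemma open_pattern:
  assumes U: "openin (sequential_topology S conv) U" and x: "x \<in> E" "x \<in> U"
  shows "\<exists>k. \<forall>y\<in>E. pattern k y = pattern k x \<longrightarrow> y \<in> U"
proof (rule ccontr)
  assume "\<not> ?thesis"
  then obtain y where y: "\<And>k. y k \<in> E" "\<And>k. pattern k (y k) = pattern k x" "\<And>k. y k \<notin> U" by metis
  then have "conv y x" by (intro det x) (auto simp: pattern_eq_iff)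
  then have "\<forall>\<^sub>F n in sequentially. y n \<in> U"
    using U x(2) subsetD[OF ES y(1)] unfolding openin_sequential_topology by blast
  then show False using y(3) by (auto simp: eventually_sequentially)
qed

text \<open>On \<open>E\<close> every open set is a countable union of pattern sets, so its preimage
  agrees almost surely with a measurable set; the completion absorbs the exceptional null
  set.\<close>

lemma random_element_pattern:
  assumes ae: "AE \<omega> in M. X \<omega> \<in> E" and meas: "\<And>j. {\<omega> \<in> space M. b j (X \<omega>)} \<in> sets M"
  shows "random_element M (sequential_topology S conv) X"
  unfolding random_element_def
proof (intro conjI allI impI)
  show "AE \<omega> in M. X \<omega> \<in> topspace (sequential_topology S conv)"
    using ae by eventually_elim (use ES in auto)
next
  fix U assume U: "openin (sequential_topology S conv) U"
  define \<P> where "\<P> k = {P \<in> Pow {..<k}. \<forall>y\<in>E. pattern k y = P \<longrightarrow> y \<in> U}" for k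
  define V where "V = (\<Union>k. \<Union>P\<in>\<P> k. {\<omega> \<in> space M. pattern k (X \<omega>) = P})"
  have "V \<in> sets (completion M)"
    unfolding V_def
    by (intro sets.countable_UN'' sets.finite_UN sets_completionI_sets pattern_sets meas)
      (auto simp: \<P>_def intro!: finite_subset[of "{_. _}" "Pow {..<_}"])
  moreover have "AE \<omega> in M. \<omega> \<in> X -` U \<inter> space M \<longleftrightarrow> \<omega> \<in> V"
    using ae AE_space
  proof eventually_elim
    case (elim \<omega>)
    show ?case
    proof
      assume "\<omega> \<in> X -` U \<inter> space M"
      then obtain k where "\<forall>y\<in>E. pattern k y = pattern k (X \<omega>) \<longrightarrow> y \<in> U"
        using open_pattern[OF U elim(1)] by auto
      then have "pattern k (X \<omega>) \<in> \<P> k" using pattern_in_Pow by (auto simp: \<P>_def)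
      then show "\<omega> \<in> V" using elim by (auto simp: V_def)
    qed (use elim in \<open>auto simp: V_def \<P>_def\<close>)
  qed
  ultimately show "X -` U \<inter> space M \<in> sets (completion M)"
    by (rule sets_completion_iff_AE) auto
qed

text \<open>Only probabilities of conjunctions of positive bits are assumed to converge. A negated
  bit is removed by subtraction, P(A and not b) = P(A) - P(A and b), which enlarges \<open>J\<close>
  and shortens \<open>K\<close>.\<close>

lemma tendsto_pattern_prob:
  assumes M: "prob_space M" and N: "prob_space N"
    and mX: "\<forall>\<^sub>F i in F. \<forall>j. {\<omega> \<in> space M. b j (X i \<omega>)} \<in> sets M"
    and mY: "\<And>j. {\<omega> \<in> space N. b j (Y \<omega>)} \<in> sets N"
    and lim: "\<And>J. finite J \<Longrightarrow> ((\<lambda>i. measure M {\<omega> \<in> space M. \<forall>j\<in>J. b j (X i \<omega>)})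
                \<longlongrightarrow> measure N {\<omega> \<in> space N. \<forall>j\<in>J. b j (Y \<omega>)}) F"
    and "finite K" "finite J"
  shows "((\<lambda>i. measure M {\<omega> \<in> space M. (\<forall>j\<in>J. b j (X i \<omega>)) \<and> (\<forall>j\<in>K. \<not> b j (X i \<omega>))})
                \<longlongrightarrow> measure N {\<omega> \<in> space N. (\<forall>j\<in>J. b j (Y \<omega>)) \<and> (\<forall>j\<in>K. \<not> b j (Y \<omega>))}) F"
  using \<open>finite K\<close> \<open>finite J\<close>
proof (induction K arbitrary: J rule: finite_induct)
  case empty
  then show ?case using lim by simp
next
  case (insert k K)
  interpret M: prob_space M by (rule M)
  interpret N: prob_space N by (rule N)
  have rw: "(\<forall>j\<in>J. b j z) \<and> (\<forall>j\<in>insert k K. \<not> b j z) \<longleftrightarrow> ((\<forall>j\<in>J. b j z) \<and> (\<forall>j\<in>K. \<not> b j z)) \<and> \<not> b k z"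
    "(\<forall>j\<in>insert k J. b j z) \<and> (\<forall>j\<in>K. \<not> b j z) \<longleftrightarrow> ((\<forall>j\<in>J. b j z) \<and> (\<forall>j\<in>K. \<not> b j z)) \<and> b k z" for z
    by auto
  have "((\<lambda>i. measure M {\<omega> \<in> space M. (\<forall>j\<in>J. b j (X i \<omega>)) \<and> (\<forall>j\<in>K. \<not> b j (X i \<omega>))} -
        measure M {\<omega> \<in> space M. (\<forall>j\<in>insert k J. b j (X i \<omega>)) \<and> (\<forall>j\<in>K. \<not> b j (X i \<omega>))})
      \<longlongrightarrow> measure N {\<omega> \<in> space N. (\<forall>j\<in>J. b j (Y \<omega>)) \<and> (\<forall>j\<in>K. \<not> b j (Y \<omega>))} -
        measure N {\<omega> \<in> space N. (\<forall>j\<in>insert k J. b j (Y \<omega>)) \<and> (\<forall>j\<in>K. \<not> b j (Y \<omega>))}) F"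
    using insert by (intro tendsto_diff insert.IH) auto
  moreover have "\<forall>\<^sub>F i in F. measure M {\<omega> \<in> space M. (\<forall>j\<in>J. b j (X i \<omega>)) \<and> (\<forall>j\<in>insert k K. \<not> b j (X i \<omega>))} =
      measure M {\<omega> \<in> space M. (\<forall>j\<in>J. b j (X i \<omega>)) \<and> (\<forall>j\<in>K. \<not> b j (X i \<omega>))} -
        measure M {\<omega> \<in> space M. (\<forall>j\<in>insert k J. b j (X i \<omega>)) \<and> (\<forall>j\<in>K. \<not> b j (X i \<omega>))}"
    using mX
  proof eventually_elim
    case (elim i)
    then have [measurable]: "{\<omega> \<in> space M. b j (X i \<omega>)} \<in> sets M" for j by blast
    show ?case unfolding rw using insert.hyps(1) insert.prems
      by (intro M.measure_conj_not) measurable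
  qed
  moreover have "measure N {\<omega> \<in> space N. (\<forall>j\<in>J. b j (Y \<omega>)) \<and> (\<forall>j\<in>insert k K. \<not> b j (Y \<omega>))} =
      measure N {\<omega> \<in> space N. (\<forall>j\<in>J. b j (Y \<omega>)) \<and> (\<forall>j\<in>K. \<not> b j (Y \<omega>))} -
        measure N {\<omega> \<in> space N. (\<forall>j\<in>insert k J. b j (Y \<omega>)) \<and> (\<forall>j\<in>K. \<not> b j (Y \<omega>))}"
  proof -
    note mY [measurable]
    show ?thesis unfolding rw using insert.hyps(1) insert.prems
      by (intro N.measure_conj_not) measurable
  qed
  ultimately show ?case by (simp only: tendsto_cong)
qed

text \<open>Replaces \<open>f\<close> by a step function \<open>g\<close> of the pattern: the error
  is \<open>e\<close> on the patterns in \<open>G\<close> and an additional \<open>C\<close> on the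
  others, weighted by their probability.\<close>

lemma integral_pattern_approx:
  fixes f :: "'s \<Rightarrow> real"
  assumes M: "prob_space M" and ae: "AE \<omega> in M. X \<omega> \<in> E"
    and meas: "\<And>j. {\<omega> \<in> space M. b j (X \<omega>)} \<in> sets M"
    and f: "continuous_map (sequential_topology S conv) euclideanreal f"
    and bound: "\<And>x. x \<in> S \<Longrightarrow> \<bar>f x\<bar> \<le> C"
    and approx: "\<And>x. x \<in> E \<Longrightarrow> \<bar>f x - g (pattern k x)\<bar> \<le> e + (if pattern k x \<in> G then 0 else C)"
  shows "\<bar>(\<integral>\<omega>. f (X \<omega>) \<partial>completion M) -
      (\<Sum>P\<in>Pow {..<k}. g P * measure M {\<omega> \<in> space M. pattern k (X \<omega>) = P})\<bar>
    \<le> e + C * (\<Sum>P\<in>Pow {..<k} - G. measure M {\<omega> \<in> space M. pattern k (X \<omega>) = P})"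
proof -
  interpret M: prob_space M by (rule M)
  interpret C: prob_space "completion M" by (rule M.prob_space_completion)
  define A where "A P = {\<omega> \<in> space M. pattern k (X \<omega>) = P}" for P
  have A_sets: "A P \<in> sets (completion M)" "A P \<in> sets M" for P
    using pattern_sets[OF meas] by (auto simp: A_def)
  have ae': "AE \<omega> in completion M. X \<omega> \<in> E" using ae AE_completion by blast
  have fX: "integrable (completion M) (\<lambda>\<omega>. f (X \<omega>))"
  proof (rule C.integrable_const_bound[where B=C])
    show "AE \<omega> in completion M. norm (f (X \<omega>)) \<le> C"
      using ae' by eventually_elim (use bound ES in auto)
    show "(\<lambda>\<omega>. f (X \<omega>)) \<in> borel_measurable (completion M)"
      by (rule random_element_measurable_continuous[OF random_element_pattern[OF ae meas] f])
  qed
  have int_A: "integrable (completion M) (\<lambda>\<omega>. c * indicat_real (A P) \<omega>)" for c P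
    using A_sets by (auto intro!: integrable_mult_right integrable_real_indicator C.emeasure_finite simp: less_top[symmetric])
  have int_sum: "integrable (completion M) (\<lambda>\<omega>. \<Sum>P\<in>\<P>. c P * indicat_real (A P) \<omega>)" for c \<P>
    by (rule Bochner_Integration.integrable_sum) (rule int_A)
  have val: "(\<integral>\<omega>. (\<Sum>P\<in>\<P>. c P * indicat_real (A P) \<omega>) \<partial>completion M) = (\<Sum>P\<in>\<P>. c P * measure M (A P))" for c \<P>
    by (subst Bochner_Integration.integral_sum[OF int_A]) (simp add: A_sets)
  have "\<bar>(\<integral>\<omega>. f (X \<omega>) \<partial>completion M) - (\<Sum>P\<in>Pow {..<k}. g P * measure M (A P))\<bar> =
      \<bar>\<integral>\<omega>. f (X \<omega>) - (\<Sum>P\<in>Pow {..<k}. g P * indicat_real (A P) \<omega>) \<partial>completion M\<bar>"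
    by (simp only: Bochner_Integration.integral_diff[OF fX int_sum] val)
  also have "\<dots> \<le> (\<integral>\<omega>. \<bar>f (X \<omega>) - (\<Sum>P\<in>Pow {..<k}. g P * indicat_real (A P) \<omega>)\<bar> \<partial>completion M)"
    by (rule integral_abs_bound)
  also have "\<dots> \<le> (\<integral>\<omega>. e + (\<Sum>P\<in>Pow {..<k} - G. C * indicat_real (A P) \<omega>) \<partial>completion M)"
  proof (rule integral_mono_AE)
    show "AE \<omega> in completion M. \<bar>f (X \<omega>) - (\<Sum>P\<in>Pow {..<k}. g P * indicat_real (A P) \<omega>)\<bar>
        \<le> e + (\<Sum>P\<in>Pow {..<k} - G. C * indicat_real (A P) \<omega>)"
      using ae' AE_space
    proof eventually_elim
      case (elim \<omega>)
      have ind: "indicat_real (A P) \<omega> = (if P = pattern k (X \<omega>) then 1 else 0)" for P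
        using elim by (auto simp: A_def indicator_def)
      show ?case
        using approx[OF elim(1)] pattern_in_Pow[of k "X \<omega>"]
        by (simp add: ind if_distrib[of "\<lambda>z. _ * z"] sum.delta finite_Diff cong: if_cong) (auto split: if_splits)
    qed
  qed (intro integrable_abs Bochner_Integration.integrable_diff Bochner_Integration.integrable_add fX int_sum C.integrable_const)+
  also have "\<dots> = e + (\<Sum>P\<in>Pow {..<k} - G. C * measure M (A P))"
    by (simp only: Bochner_Integration.integral_add[OF C.integrable_const int_sum] val) (simp add: M.prob_space)
  finally show ?thesis by (simp add: A_def sum_distrib_left)
qed

text \<open>The depth \<open>k\<close> is chosen from the law of \<open>Y\<close> alone: at that
  depth the pattern fixes \<open>f\<close> up to \<open>e\<close> with probability above 1 - e. Both
  this bound and the expectation of the resulting step function depend on finitely many pattern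
  probabilities, hence pass to \<open>X i\<close>.\<close>

lemma converges_weakly_pattern:
  assumes M: "prob_space M" and N: "prob_space N"
    and aeX: "\<forall>\<^sub>F i in F. AE \<omega> in M. X i \<omega> \<in> E"
    and mX: "\<forall>\<^sub>F i in F. \<forall>j. {\<omega> \<in> space M. b j (X i \<omega>)} \<in> sets M"
    and aeY: "AE \<omega> in N. Y \<omega> \<in> E"
    and mY: "\<And>j. {\<omega> \<in> space N. b j (Y \<omega>)} \<in> sets N"
    and lim: "\<And>J. finite J \<Longrightarrow> ((\<lambda>i. measure M {\<omega> \<in> space M. \<forall>j\<in>J. b j (X i \<omega>)})
                \<longlongrightarrow> measure N {\<omega> \<in> space N. \<forall>j\<in>J. b j (Y \<omega>)}) F"
  shows "converges_weakly F (sequential_topology S conv) M X N Y"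
  unfolding converges_weakly_def
proof (intro conjI allI impI)
  show "\<forall>\<^sub>F i in F. random_element M (sequential_topology S conv) (X i)"
    using aeX mX by eventually_elim (blast intro: random_element_pattern)
  show "random_element N (sequential_topology S conv) Y"
    by (rule random_element_pattern[OF aeY mY])
next
  interpret N: prob_space N by (rule N)
  fix f :: "'s \<Rightarrow> real"
  assume "continuous_map (sequential_topology S conv) euclideanreal f \<and>
    bounded (f ` topspace (sequential_topology S conv))"
  then have f: "continuous_map (sequential_topology S conv) euclideanreal f" and "bounded (f ` S)" by auto
  then obtain C0 where "\<And>x. x \<in> S \<Longrightarrow> \<bar>f x\<bar> \<le> C0" by (auto simp: bounded_iff)
  then obtain C where C: "0 < C" "\<And>x. x \<in> S \<Longrightarrow> \<bar>f x\<bar> \<le> C"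
    by (metis abs_ge_zero le_max_iff_disj less_max_iff_disj zero_less_one)
  let ?p = "\<lambda>M X k P. measure M {\<omega> \<in> space M. pattern k (X \<omega>) = P}"
  have p_lim: "((\<lambda>i. ?p M (X i) k P) \<longlongrightarrow> ?p N Y k P) F" if P: "P \<in> Pow {..<k}" for k P
  proof -
    have eq: "pattern k z = P \<longleftrightarrow> (\<forall>j\<in>P. b j z) \<and> (\<forall>j\<in>{..<k} - P. \<not> b j z)" for z
      using P by (auto simp: pattern_def)
    have "finite P" using P by (auto intro: finite_subset)
    then show ?thesis
      unfolding eq by (intro tendsto_pattern_prob[OF M N mX mY lim]) auto
  qed
  show "((\<lambda>i. \<integral>\<omega>. f (X i \<omega>) \<partial>completion M) \<longlongrightarrow> (\<integral>\<omega>. f (Y \<omega>) \<partial>completion N)) F"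
  proof (rule tendstoI)
    fix e' :: real assume "0 < e'"
    \<comment> \<open>The two approximations by step functions cost at most e + C * e each and their
      comparison costs e; the total stays below 3 * e + 3 * (C * e).\<close>
    define e where "e = e' / (3 + 3 * C)"
    have "0 < e" using \<open>0 < e'\<close> \<open>0 < C\<close> by (simp add: e_def)
    moreover have "e * (3 + 3 * C) = e'" using \<open>0 < C\<close> by (simp add: e_def)
    ultimately have e: "0 < e" "e' = 3 * e + 3 * (C * e)" by (simp_all add: algebra_simps)
    \<comment> \<open>Patterns at depth \<open>k\<close> on which \<open>f\<close> varies by at most
      \<open>e\<close> over \<open>E\<close>. Refining a good pattern keeps it good, which makes the
      events \<open>A k\<close> below increasing.\<close>
    define G where "G k = {P. \<forall>x\<in>E. \<forall>y\<in>E. pattern k x = P \<longrightarrow> pattern k y = P \<longrightarrow> \<bar>f x - f y\<bar> \<le> e}" for k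
    have in_G: "\<exists>k. pattern k x \<in> G k" if x: "x \<in> E" for x
    proof -
      have "open {f x - e / 2<..<f x + e / 2}" by simp
      then have "openin (sequential_topology S conv) {y \<in> S. f y \<in> {f x - e / 2<..<f x + e / 2}}"
        using f by (auto simp: continuous_map_def simp del: greaterThanLessThan_iff)
      then obtain k where k: "\<And>y. y \<in> E \<Longrightarrow> pattern k y = pattern k x \<Longrightarrow> f y \<in> {f x - e / 2<..<f x + e / 2}"
        using open_pattern[of _ x] x ES e(1) by fastforce
      have "\<bar>f y - f z\<bar> \<le> e" if "y \<in> E" "z \<in> E" "pattern k y = pattern k x" "pattern k z = pattern k x" for y z
        using k[of y] k[of z] that by auto
      then show ?thesis unfolding G_def by blast
    qed
    have G_mono: "pattern (Suc k) x \<in> G (Suc k)" if "pattern k x \<in> G k" for k x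
    proof -
      have "pattern k y = pattern k x" if "pattern (Suc k) y = pattern (Suc k) x" for y
        using that by (auto simp: pattern_eq_iff)
      moreover have "\<bar>f y - f z\<bar> \<le> e"
        if "y \<in> E" "z \<in> E" "pattern k y = pattern k x" "pattern k z = pattern k x" for y z
        using \<open>pattern k x \<in> G k\<close> that unfolding G_def by simp
      ultimately show ?thesis unfolding G_def by (intro CollectI ballI impI) metis
    qed
    define A where "A k = {\<omega> \<in> space N. pattern k (Y \<omega>) \<in> G k}" for k
    have A_eq: "A k = (\<Union>P\<in>Pow {..<k} \<inter> G k. {\<omega> \<in> space N. pattern k (Y \<omega>) = P})" for k
      using pattern_in_Pow by (auto simp: A_def)
    have A_sets: "A k \<in> sets N" for k
      unfolding A_eq by (intro sets.finite_UN pattern_sets mY) auto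
    have "(\<lambda>k. measure N (A k)) \<longlonglongrightarrow> measure N (\<Union>k. A k)"
      using A_sets G_mono by (intro N.finite_Lim_measure_incseq incseq_SucI) (auto simp: A_def)
    moreover have "AE \<omega> in N. \<omega> \<in> (\<Union>k. A k)"
      using aeY AE_space by eventually_elim (use in_G in \<open>auto simp: A_def\<close>)
    then have "measure N (\<Union>k. A k) = 1"
      using A_sets by (subst N.prob_eq_1) auto
    ultimately have "\<forall>\<^sub>F k in sequentially. 1 - e < measure N (A k)"
      using e(1) by (intro order_tendstoD(1)) auto
    then obtain k where k: "1 - e < measure N (A k)" by (auto simp: eventually_sequentially)
    define g where "g P = (if P \<in> G k \<and> (\<exists>x\<in>E. pattern k x = P) then f (SOME x. x \<in> E \<and> pattern k x = P) else 0)" for P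
    have approx: "\<bar>f x - g (pattern k x)\<bar> \<le> e + (if pattern k x \<in> G k then 0 else C)" if x: "x \<in> E" for x
    proof (cases "pattern k x \<in> G k")
      case True
      define y where "y = (SOME y. y \<in> E \<and> pattern k y = pattern k x)"
      have "y \<in> E \<and> pattern k y = pattern k x" unfolding y_def by (rule someI[of _ x]) (use x in simp)
      then show ?thesis using True x unfolding G_def g_def y_def[symmetric] by auto
    next
      case False
      then show ?thesis using C(2)[of x] x ES e(1) by (auto simp: g_def)
    qed
    have sum_N: "(\<Sum>P\<in>Pow {..<k} - G k. ?p N Y k P) < e"
    proof -
      have "(\<Sum>P\<in>Pow {..<k} - G k. ?p N Y k P) =
          measure N (\<Union>P\<in>Pow {..<k} - G k. {\<omega> \<in> space N. pattern k (Y \<omega>) = P})"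
        using pattern_sets[OF mY] by (intro N.finite_measure_finite_Union[symmetric]) (auto simp: disjoint_family_on_def)
      also have "(\<Union>P\<in>Pow {..<k} - G k. {\<omega> \<in> space N. pattern k (Y \<omega>) = P}) = space N - A k"
        using pattern_in_Pow by (auto simp: A_def)
      finally show ?thesis using k by (simp add: N.prob_compl A_sets)
    qed
    have "((\<lambda>i. \<Sum>P\<in>Pow {..<k} - G k. ?p M (X i) k P) \<longlongrightarrow> (\<Sum>P\<in>Pow {..<k} - G k. ?p N Y k P)) F"
      by (intro tendsto_sum p_lim) auto
    then have ev1: "\<forall>\<^sub>F i in F. (\<Sum>P\<in>Pow {..<k} - G k. ?p M (X i) k P) < e"
      using sum_N by (rule order_tendstoD)
    have "((\<lambda>i. \<Sum>P\<in>Pow {..<k}. g P * ?p M (X i) k P) \<longlongrightarrow> (\<Sum>P\<in>Pow {..<k}. g P * ?p N Y k P)) F"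
      by (intro tendsto_sum tendsto_mult_left p_lim) auto
    from tendstoD[OF this e(1)]
    have ev2: "\<forall>\<^sub>F i in F. \<bar>(\<Sum>P\<in>Pow {..<k}. g P * ?p M (X i) k P) - (\<Sum>P\<in>Pow {..<k}. g P * ?p N Y k P)\<bar> < e"
      by (simp only: dist_real_def)
    have bound: "\<bar>(\<integral>\<omega>. f (Y \<omega>) \<partial>completion N) - (\<Sum>P\<in>Pow {..<k}. g P * ?p N Y k P)\<bar> < e + C * e"
      using integral_pattern_approx[OF N aeY mY f C(2) approx] mult_strict_left_mono[OF sum_N C(1)] by linarith
    show "\<forall>\<^sub>F i in F. dist (\<integral>\<omega>. f (X i \<omega>) \<partial>completion M) (\<integral>\<omega>. f (Y \<omega>) \<partial>completion N) < e'"
      using ev1 ev2 aeX mX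
    proof eventually_elim
      case (elim i)
      have "\<bar>(\<integral>\<omega>. f (X i \<omega>) \<partial>completion M) - (\<Sum>P\<in>Pow {..<k}. g P * ?p M (X i) k P)\<bar> \<le> e + C * e"
        using integral_pattern_approx[OF M elim(3) _ f C(2) approx] elim(4)
          mult_strict_left_mono[OF elim(1) C(1)] by fastforce
      then show ?case
        using elim(2) bound e mult_pos_pos[OF C(1) e(1)] unfolding dist_real_def by linarith
    qed
  qed
qed

end

section \<open>Lower bounds for events described by avoidance in the product M2 topology\<close>

lemma half_line_graph_restrict: "half_line_graph (\<lambda>t\<in>{0..}. x t) = half_line_graph x"
proof -
  have "left_lim 0 (\<lambda>t\<in>{0..}. x t) t = left_lim 0 x t" if "0 \<le> t" for t
  proof (cases "t = 0")
    case False
    then have "0 < t" using that by simp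
    then have "\<forall>\<^sub>F s in at_left t. 0 < s \<and> s < t" by (auto simp: eventually_at_left)
    then have "\<forall>\<^sub>F s in at_left t. (\<lambda>t\<in>{0..}. x t) s = x s"
      by eventually_elim auto
    then have "((\<lambda>t\<in>{0..}. x t) \<longlongrightarrow> l) (at_left t) \<longleftrightarrow> (x \<longlongrightarrow> l) (at_left t)" for l
      by (rule tendsto_cong)
    then show ?thesis using \<open>0 < t\<close> by (simp add: left_lim_def Topological_Spaces.Lim_def)
  qed (simp add: left_lim_def)
  then show ?thesis by (auto simp: half_line_graph_def)
qed

lemma converges_weakly_compose:
  assumes "converges_weakly G \<tau> M X N Y" "filterlim d G F"
  shows "converges_weakly F \<tau> M (\<lambda>i. X (d i)) N Y"
  using assms unfolding converges_weakly_def
  by (auto intro: filterlim_compose[OF _ assms(2)] eventually_compose_filterlim[OF _ assms(2)])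

text \<open>Half of the portmanteau theorem, tested on the open sets of paths whose completed graph avoids
  at least one of the sets \<open>B i\<close>.\<close>

lemma WM2_liminf:
  assumes M: "prob_space M" and N: "prob_space N"
    and weak: "converges_weakly F WM2_topology M V N W"
    and "countable I"
    and B: "\<And>i. i \<in> I \<Longrightarrow> B i \<noteq> {} \<and> B i \<subseteq> {..T i} \<times> UNIV"
    and E: "\<And>i. i \<in> I \<Longrightarrow> \<forall>\<^sub>F \<epsilon> in F. \<forall>\<omega>\<in>space M. half_line_graph (snd (V \<epsilon> \<omega>)) \<inter> B i = {} \<longrightarrow> \<omega> \<in> E \<epsilon>"
    and E_sets: "\<forall>\<^sub>F \<epsilon> in F. E \<epsilon> \<in> sets M"
    and Q: "Q \<in> sets N"
      "\<And>\<omega>. \<omega> \<in> Q \<Longrightarrow> \<exists>i\<in>I. \<exists>r>0. \<forall>p\<in>half_line_graph (snd (W \<omega>)). r \<le> infdist p (B i)"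
    and "0 < e"
  shows "\<forall>\<^sub>F \<epsilon> in F. measure N Q - e < measure M (E \<epsilon>)"
proof (cases "I = {}")
  case True
  then have "Q = {}" using Q(2) by blast
  then show ?thesis using \<open>0 < e\<close> by (auto intro!: always_eventually less_le_trans[OF _ measure_nonneg])
next
  case False
  interpret M: prob_space M by (rule M)
  interpret N: prob_space N by (rule N)
  interpret CM: prob_space "completion M" by (rule M.prob_space_completion)
  interpret CN: prob_space "completion N" by (rule N.prob_space_completion)
  define b where "b = from_nat_into I"
  have bI: "b n \<in> I" for n using False by (simp add: b_def from_nat_into)
  \<comment> \<open>The radius shrinks with \<open>k\<close>, since the distance guaranteed on
    \<open>Q\<close> depends on the sample point.\<close>
  define gap where "gap k n x = graph_gap (B (b n)) (1 / real (Suc k)) (snd x)" for k n and x :: "(real \<Rightarrow> real) \<times> (real \<Rightarrow> real)"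
  \<comment> \<open>A continuous function between 0 and 1 that vanishes if the graph meets each of
    the first k + 1 sets, and equals 1 once a single gap equals 1. On \<open>Q\<close> it is
    therefore 1 for all large \<open>k\<close>.\<close>
  define f where "f k x = 1 - (\<Prod>n\<in>{..k}. 1 - gap k n x)" for k x
  have gap: "0 \<le> gap k n x" "gap k n x \<le> 1" for k n x
    using graph_gap_nonneg[of "B (b n)" "T (b n)" "1 / real (Suc k)"]
      graph_gap_le_1[of "B (b n)" "T (b n)" "1 / real (Suc k)"] B[OF bI] by (auto simp: gap_def)
  have f01: "0 \<le> f k x" "f k x \<le> 1" for k x
    using gap by (simp_all add: f_def prod_le_1 prod_nonneg del: split_paired_All)
  have f_cont: "continuous_map WM2_topology euclideanreal (f k)" for k
    unfolding f_def gap_def WM2_topology_def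
    using B[OF bI]
    by (intro continuous_intros continuous_map_compose[OF continuous_map_snd, unfolded o_def] continuous_map_graph_gap) auto
  have f_lim: "((\<lambda>\<epsilon>. \<integral>\<omega>. f k (V \<epsilon> \<omega>) \<partial>completion M) \<longlongrightarrow> (\<integral>\<omega>. f k (W \<omega>) \<partial>completion N)) F" for k
    using weak f_cont[of k] f01 unfolding converges_weakly_def
    by (auto simp: bounded_iff intro!: exI[of _ 1])
  have W_meas: "(\<lambda>\<omega>. f k (W \<omega>)) \<in> borel_measurable (completion N)" for k
    using weak f_cont by (auto simp: converges_weakly_def intro: random_element_measurable_continuous)
  have Q_comp: "Q \<in> sets (completion N)" using Q(1) by simp
  have "(\<lambda>k. \<integral>\<omega>. f k (W \<omega>) * indicat_real Q \<omega> \<partial>completion N) \<longlonglongrightarrow> (\<integral>\<omega>. indicat_real Q \<omega> \<partial>completion N)"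
  proof (rule integral_dominated_convergence[where w="\<lambda>_. 1"])
    show "AE \<omega> in completion N. (\<lambda>k. f k (W \<omega>) * indicat_real Q \<omega>) \<longlonglongrightarrow> indicat_real Q \<omega>"
    proof (rule AE_I2)
      fix \<omega>
      show "(\<lambda>k. f k (W \<omega>) * indicat_real Q \<omega>) \<longlonglongrightarrow> indicat_real Q \<omega>"
      proof (cases "\<omega> \<in> Q")
        case True
        then obtain i r where ir: "i \<in> I" "r > 0" "\<And>p. p \<in> half_line_graph (snd (W \<omega>)) \<Longrightarrow> r \<le> infdist p (B i)"
          using Q(2) by blast
        obtain n where n: "b n = i"
          using ir(1) from_nat_into_surj[OF \<open>countable I\<close>] unfolding b_def by metis
        obtain m where m: "1 / real (Suc m) < r" using nat_approx_posE[OF ir(2)] by metis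
        have "f k (W \<omega>) = 1" if k: "k \<ge> max n m" for k
        proof -
          have "1 / real (Suc k) \<le> 1 / real (Suc m)" using k by (simp add: divide_simps)
          then have "gap k n (W \<omega>) = 1"
            unfolding gap_def using ir(3) m B[OF bI, of n] n
            by (intro graph_gap_eq_1[of _ "T i"]) force+
          then have "\<exists>j\<in>{..k}. 1 - gap k j (W \<omega>) = 0" using k by (intro bexI[of _ n]) auto
          then have "(\<Prod>j\<in>{..k}. 1 - gap k j (W \<omega>)) = 0" by (intro prod_zero) auto
          then show ?thesis by (simp add: f_def)
        qed
        then have "\<forall>\<^sub>F k in sequentially. f k (W \<omega>) * indicat_real Q \<omega> = indicat_real Q \<omega>"
          by (intro eventually_mono[OF eventually_ge_at_top[of "max n m"]]) simp
        then show ?thesis by (rule tendsto_eventually)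
      qed simp
    qed
    show "AE \<omega> in completion N. norm (f k (W \<omega>) * indicat_real Q \<omega>) \<le> 1" for k
      using f01 by (auto simp: indicator_def)
  qed (use W_meas Q_comp in auto)
  then have "(\<lambda>k. \<integral>\<omega>. f k (W \<omega>) * indicat_real Q \<omega> \<partial>completion N) \<longlonglongrightarrow> measure N Q"
    using Q(1) by simp
  then have "\<forall>\<^sub>F k in sequentially. measure N Q - e < (\<integral>\<omega>. f k (W \<omega>) * indicat_real Q \<omega> \<partial>completion N)"
    using \<open>0 < e\<close> by (intro order_tendstoD) auto
  then obtain k where "measure N Q - e < (\<integral>\<omega>. f k (W \<omega>) * indicat_real Q \<omega> \<partial>completion N)"
    by (auto simp: eventually_sequentially)
  also have "\<dots> \<le> (\<integral>\<omega>. f k (W \<omega>) \<partial>completion N)"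
  proof (rule integral_mono)
    show "integrable (completion N) (\<lambda>\<omega>. f k (W \<omega>))"
      using W_meas f01 by (intro CN.integrable_const_bound[where B=1]) auto
    show "integrable (completion N) (\<lambda>\<omega>. f k (W \<omega>) * indicat_real Q \<omega>)"
      using W_meas f01 Q_comp by (intro CN.integrable_const_bound[where B=1]) (auto simp: indicator_def)
  qed (use f01 in \<open>auto simp: indicator_def\<close>)
  finally have "\<forall>\<^sub>F \<epsilon> in F. measure N Q - e < (\<integral>\<omega>. f k (V \<epsilon> \<omega>) \<partial>completion M)"
    using f_lim by (intro order_tendstoD) auto
  \<comment> \<open>Only finitely many sets enter \<open>f k\<close>, so the thresholds for
    \<epsilon> in assumption \<open>E\<close> can be taken in common.\<close>
  moreover have "\<forall>\<^sub>F \<epsilon> in F. \<forall>n\<in>{..k}. \<forall>\<omega>\<in>space M. half_line_graph (snd (V \<epsilon> \<omega>)) \<inter> B (b n) = {} \<longrightarrow> \<omega> \<in> E \<epsilon>"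
    using E[OF bI] by (intro eventually_ball_finite) auto
  moreover have "\<forall>\<^sub>F \<epsilon> in F. random_element M WM2_topology (V \<epsilon>)"
    using weak by (simp add: converges_weakly_def)
  ultimately show ?thesis
    using E_sets
  proof eventually_elim
    case (elim \<epsilon>)
    have meas: "(\<lambda>\<omega>. f k (V \<epsilon> \<omega>)) \<in> borel_measurable (completion M)"
      by (rule random_element_measurable_continuous[OF elim(3) f_cont])
    have "(\<integral>\<omega>. f k (V \<epsilon> \<omega>) \<partial>completion M) \<le> (\<integral>\<omega>. indicat_real (E \<epsilon>) \<omega> \<partial>completion M)"
    proof (rule integral_mono)
      show "integrable (completion M) (\<lambda>\<omega>. f k (V \<epsilon> \<omega>))"
        using meas f01 by (intro CM.integrable_const_bound[where B=1]) auto
      have "E \<epsilon> \<in> sets (completion M)" using elim(4) by simp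
      then show "integrable (completion M) (indicat_real (E \<epsilon>))"
        by (intro CM.integrable_const_bound[where B=1]) (auto simp: indicator_def intro: borel_measurable_indicator)
      fix \<omega> assume \<omega>: "\<omega> \<in> space (completion M)"
      show "f k (V \<epsilon> \<omega>) \<le> indicat_real (E \<epsilon>) \<omega>"
      proof (cases "\<omega> \<in> E \<epsilon>")
        case False
        have "gap k n (V \<epsilon> \<omega>) = 0" if "n \<in> {..k}" for n
        proof (rule ccontr)
          assume "gap k n (V \<epsilon> \<omega>) \<noteq> 0"
          then have "0 < gap k n (V \<epsilon> \<omega>)" using gap(1)[of k n "V \<epsilon> \<omega>"] by linarith
          then have "half_line_graph (snd (V \<epsilon> \<omega>)) \<inter> B (b n) = {}"
            unfolding gap_def using B[OF bI, of n]
            by (intro graph_gap_pos_disjoint[of "B (b n)" "T (b n)" "1 / real (Suc k)"]) auto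
          then show False using elim(2) that \<omega> False by auto
        qed
        then show ?thesis by (simp add: f_def)
      qed (use f01 in simp)
    qed
    then show ?case using elim(1,4) by simp
  qed
qed

section \<open>Scaling limit of the stopping rule\<close>

text \<open>The condition moves from the index set into the value, so that an infimum over indices
  selected by the sample point becomes one over a fixed index set; this form gives measurability of
  the passage times.\<close>

lemma INF_Collect_eq_top:
  fixes f :: "'i \<Rightarrow> 'x::complete_lattice"
  shows "(INF n\<in>{n. n \<in> B \<and> P n}. f n) = (INF n\<in>B. if P n then f n else top)"
proof (rule antisym)
  show "(INF n\<in>{n. n \<in> B \<and> P n}. f n) \<le> (INF n\<in>B. if P n then f n else top)"
    by (rule INF_greatest) (simp add: INF_lower)
  show "(INF n\<in>B. if P n then f n else top) \<le> (INF n\<in>{n. n \<in> B \<and> P n}. f n)"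
  proof (rule INF_greatest)
    fix n assume n: "n \<in> {n. n \<in> B \<and> P n}"
    then have "(INF n\<in>B. if P n then f n else top) \<le> (if P n then f n else top)" by (intro INF_lower) simp
    then show "(INF n\<in>B. if P n then f n else top) \<le> f n" using n by simp
  qed
qed

text \<open>An infimum over a nonempty set of natural numbers is attained, which allows the
  non-strict inequality; \<open>limit_passage_less_iff\<close> below is strict because a real
  infimum need not be attained.\<close>

lemma INF_of_nat_le_iff:
  "(INF n\<in>A. of_nat n :: ennreal) \<le> ennreal y \<longleftrightarrow> (\<exists>n\<in>A. real n \<le> y)" if "0 \<le> y" for A :: "nat set"
proof
  assume le: "(INF n\<in>A. of_nat n :: ennreal) \<le> ennreal y"
  show "\<exists>n\<in>A. real n \<le> y"
  proof (cases "A = {}")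
    case True
    then show ?thesis using le by (simp add: top_unique)
  next
    case False
    then have "(LEAST n. n \<in> A) \<in> A" by (meson LeastI ex_in_conv)
    moreover have "of_nat (LEAST n. n \<in> A) \<le> (INF n\<in>A. of_nat n :: ennreal)"
      by (intro INF_greatest) (simp add: Least_le)
    then have "of_nat (LEAST n. n \<in> A) \<le> ennreal y" using le by (rule order_trans)
    ultimately show ?thesis using that by (auto simp: ennreal_of_nat_eq_real_of_nat)
  qed
next
  assume "\<exists>n\<in>A. real n \<le> y"
  then obtain n where "n \<in> A" "real n \<le> y" by blast
  then show "(INF n\<in>A. of_nat n :: ennreal) \<le> ennreal y"
    by (intro INF_lower2[of n]) (auto simp: ennreal_of_nat_eq_real_of_nat ennreal_leI)
qed

lemma stopping_rule_le_iff:
  "0 \<le> y \<Longrightarrow> stopping_rule Z2 \<nu> c \<epsilon> \<omega> \<le> ennreal y \<longleftrightarrow>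
    (\<exists>n::nat. \<epsilon> powr (-\<nu>) < real n \<and> c * (sqrt (Z2 (real n) \<omega>) / real n) < \<epsilon> \<and> real n \<le> y)"
  unfolding stopping_rule_def by (subst INF_of_nat_le_iff) (auto simp: real_sqrt_divide)

lemma limit_passage_less_iff:
  "limit_passage Y2 c u \<omega> < ennreal s \<longleftrightarrow> (\<exists>r. 0 < r \<and> r < s \<and> c * (sqrt (Y2 r \<omega>) / r) < u)"
  unfolding limit_passage_def by (auto simp: INF_less_iff ennreal_less_iff)

text \<open>The defining inequality is strict, so by right-continuity it persists just after
  \<open>s\<close>, where rational times are available. The passage time thus becomes a functional
  of countably many coordinates.\<close>

lemma limit_passage_eq_rat:
  assumes rc: "\<And>s. 0 < s \<Longrightarrow> ((\<lambda>s. sqrt (Y2 s \<omega>)) \<longlongrightarrow> sqrt (Y2 s \<omega>)) (at_right s)"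
  shows "limit_passage Y2 c u \<omega> = (INF s\<in>{s\<in>\<rat>. 0 < s}. if c * (sqrt (Y2 s \<omega>) / s) < u then ennreal s else top)"
proof (rule antisym)
  show "limit_passage Y2 c u \<omega> \<le> (INF s\<in>{s\<in>\<rat>. 0 < s}. if c * (sqrt (Y2 s \<omega>) / s) < u then ennreal s else top)"
    unfolding limit_passage_def by (subst INF_Collect_eq_top[symmetric], rule INF_superset_mono) auto
  show "(INF s\<in>{s\<in>\<rat>. 0 < s}. if c * (sqrt (Y2 s \<omega>) / s) < u then ennreal s else top) \<le> limit_passage Y2 c u \<omega>"
    unfolding limit_passage_def
  proof (intro INF_greatest)
    fix s assume "s \<in> {s. 0 < s \<and> c * (sqrt (Y2 s \<omega>) / s) < u}"
    then have s: "0 < s" "c * (sqrt (Y2 s \<omega>) / s) < u" by auto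
    have "((\<lambda>r. c * (sqrt (Y2 r \<omega>) / r)) \<longlongrightarrow> c * (sqrt (Y2 s \<omega>) / s)) (at_right s)"
      using s by (intro tendsto_mult_left tendsto_divide tendsto_ident_at rc) auto
    then have "\<forall>\<^sub>F r in at_right s. c * (sqrt (Y2 r \<omega>) / r) < u"
      using s by (intro order_tendstoD)
    then obtain b where b: "b > s" "\<And>r. s < r \<Longrightarrow> r < b \<Longrightarrow> c * (sqrt (Y2 r \<omega>) / r) < u"
      using eventually_at_right[of s "s + 1"] by auto
    show "(INF s\<in>{s\<in>\<rat>. 0 < s}. if c * (sqrt (Y2 s \<omega>) / s) < u then ennreal s else top) \<le> ennreal s"
    proof (rule dense_ge)
      fix y assume y: "ennreal s < y"
      then obtain b' where b': "s < b'" "ennreal b' \<le> y"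
      proof (cases y)
        case (real y')
        then show ?thesis using that[of y'] y s by (auto simp: ennreal_less_iff)
      qed (use that[of "s + 1"] in auto)
      obtain r where r: "r \<in> \<rat>" "s < r" "r < min b b'" using Rats_dense_in_real[of s "min b b'"] b b' by auto
      then have "(INF s\<in>{s\<in>\<rat>. 0 < s}. if c * (sqrt (Y2 s \<omega>) / s) < u then ennreal s else top) \<le> ennreal r"
        using s b(2)[of r] by (intro INF_lower2[of r]) auto
      also have "\<dots> \<le> y" using b' r by (intro order_trans[OF _ b'(2)] ennreal_leI) auto
      finally show "(INF s\<in>{s\<in>\<rat>. 0 < s}. if c * (sqrt (Y2 s \<omega>) / s) < u then ennreal s else top) \<le> y" .
    qed
  qed
qed

lemma cadlag_on_sqrt: "cadlag_on I x \<Longrightarrow> cadlag_on I (\<lambda>t. sqrt (x t))"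
  unfolding cadlag_on_def using tendsto_real_sqrt by fast

text \<open>Linear bounds pass to left limits, hence to the whole vertical segment of the
  graph.\<close>

lemma half_line_graph_bound_below:
  assumes x: "cadlag_on {0..} x" and m: "\<And>s. 0 < s \<Longrightarrow> s \<le> b \<Longrightarrow> m * s \<le> x s"
    and p: "(t, z) \<in> half_line_graph x" "0 < t" "t \<le> b"
  shows "m * t \<le> z"
proof -
  have "\<forall>\<^sub>F s in at_left t. 0 < s \<and> s < t" using p(2) by (auto simp: eventually_at_left)
  then have "\<forall>\<^sub>F s in at_left t. m * s \<le> x s" by eventually_elim (use m p in auto)
  moreover have "((\<lambda>s. m * s) \<longlongrightarrow> m * t) (at_left t)" by (intro tendsto_intros)
  ultimately have "m * t \<le> left_lim 0 x t"
    using tendsto_le[OF trivial_limit_at_left_real cadlag_on_left_lim[OF x p(2)]] by blast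
  moreover have "m * t \<le> x t" using m p by auto
  ultimately show ?thesis using p(1) by (auto simp: half_line_graph_def closed_segment_eq_real_ivl split: if_splits)
qed

lemma half_line_graph_bound_above:
  assumes x: "cadlag_on {0..} x" and m: "\<And>s. a < s \<Longrightarrow> s < b \<Longrightarrow> x s \<le> m * s"
    and p: "(t, z) \<in> half_line_graph x" "0 \<le> a" "a < t" "t < b"
  shows "z \<le> m * t"
proof -
  have t: "0 < t" using p by simp
  have "\<forall>\<^sub>F s in at_left t. a < s \<and> s < t" using p by (auto simp: eventually_at_left)
  then have "\<forall>\<^sub>F s in at_left t. x s \<le> m * s" by eventually_elim (use m p in auto)
  moreover have "((\<lambda>s. m * s) \<longlongrightarrow> m * t) (at_left t)" by (intro tendsto_intros)
  ultimately have "left_lim 0 x t \<le> m * t"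
    using tendsto_le[OF trivial_limit_at_left_real _ cadlag_on_left_lim[OF x t]] by blast
  moreover have "x t \<le> m * t" using m p by auto
  ultimately show ?thesis using p(1) by (auto simp: half_line_graph_def closed_segment_eq_real_ivl split: if_splits)
qed

lemma infdist_geI: "B \<noteq> {} \<Longrightarrow> (\<And>b. b \<in> B \<Longrightarrow> r \<le> dist p b) \<Longrightarrow> r \<le> infdist p B"
  unfolding infdist_def by (auto intro!: cINF_greatest)

lemma dist_real_prod_lessD:
  fixes t z t' z' r :: real
  assumes "dist (t, z) (t', z') < r"
  shows "\<bar>t - t'\<bar> < r" "\<bar>z - z'\<bar> < r"
  using assms dist_fst_le[of "(t, z)" "(t', z')"] dist_snd_le[of "(t, z)" "(t', z')"]
  by (auto simp: dist_real_def)

section \<open>Asymptotics of the time scale and measurability of the passage times\<close>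

locale stopping_limit = functional_limit M Z1 Z2 \<mu> h L N Y1 Y2
  for M :: "'a measure" and Z1 Z2 :: "real \<Rightarrow> 'a \<Rightarrow> real"
    and \<mu> h :: real and L :: "real \<Rightarrow> real"
    and N :: "'b measure" and Y1 Y2 :: "real \<Rightarrow> 'b \<Rightarrow> real" +
  fixes Ainv :: "real \<Rightarrow> real" and \<nu> c :: real
  assumes Ainv: "asymptotic_inverse (\<lambda>x. x powr (1 - h) * L x) Ainv"
    and \<nu>: "0 < \<nu>" "\<nu> < 1 / (1 - h)"
    and no_early: "no_early_stopping M Z2 (\<lambda>\<epsilon>. Ainv (1 / \<epsilon>)) \<nu>"
    and c: "0 < c"
begin

definition a :: "real \<Rightarrow> real" where "a \<epsilon> = Ainv (1 / \<epsilon>)"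
text \<open>This is A (a \<epsilon>), hence asymptotic to 1 / \<epsilon>. The spatial normalization
  at time scale \<open>a \<epsilon>\<close> is
  \<open>\<kappa> \<epsilon> / a \<epsilon>\<close>.\<close>

definition \<kappa> :: "real \<Rightarrow> real" where "\<kappa> \<epsilon> = a \<epsilon> powr (1 - h) * L (a \<epsilon>)"

abbreviation "T \<equiv> stopping_rule Z2 \<nu> c"
abbreviation "\<Phi> \<equiv> limit_passage Y2 c"

abbreviation "T_gt S \<epsilon> \<equiv> {\<omega> \<in> space M. \<forall>(u, s)\<in>S. ennreal (s * a \<epsilon>) < T (\<epsilon> / u) \<omega>}"
abbreviation "\<Phi>_gt S \<equiv> {\<omega> \<in> space N. \<forall>(u, s)\<in>S. ennreal s < \<Phi> (1 / u) \<omega>}"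
abbreviation "\<Phi>_ge S \<equiv> {\<omega> \<in> space N. \<forall>(u, s)\<in>S. ennreal s \<le> \<Phi> (1 / u) \<omega>}"
text \<open>Both margins strengthen \<open>\<Phi>_gt\<close>: the time horizon is prolonged by
  \<tau> and the line is steeper by the factor 1 / (1 - \<tau>). The second margin has to absorb the
  fluctuation of \<open>\<kappa> \<epsilon> * \<epsilon>\<close> about 1 and still leave a positive
  distance to a closed set.\<close>

abbreviation "\<Phi>_gt_perturbed \<tau> S \<equiv> {\<omega> \<in> space N. \<forall>(u, s)\<in>S. ennreal (s + \<tau>) < \<Phi> (1 / ((1 - \<tau>) * u)) \<omega>}"

definition V :: "real \<Rightarrow> 'a \<Rightarrow> (real \<Rightarrow> real) \<times> (real \<Rightarrow> real)" where
  "V \<delta> \<omega> = (\<lambda>t\<in>{0..}. \<delta> powr h * L (1 / \<delta>) * (Z1 (t / \<delta>) \<omega> - t / \<delta> * \<mu>),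
            \<lambda>t\<in>{0..}. \<delta> powr h * L (1 / \<delta>) * sqrt (Z2 (t / \<delta>) \<omega>))"

definition W :: "'b \<Rightarrow> (real \<Rightarrow> real) \<times> (real \<Rightarrow> real)" where
  "W \<omega> = (\<lambda>t\<in>{0..}. Y1 t \<omega>, \<lambda>t\<in>{0..}. sqrt (Y2 t \<omega>))"

lemma recip_at_top: "filterlim (\<lambda>\<epsilon>::real. 1 / \<epsilon>) at_top (at_right 0)"
  using filterlim_inverse_at_top_right by (simp add: inverse_eq_divide)

lemma a_at_top: "filterlim a at_top (at_right 0)"
  unfolding a_def using Ainv by (intro filterlim_compose[OF _ recip_at_top]) (simp add: asymptotic_inverse_def)

lemma a_gt: "\<forall>\<^sub>F \<epsilon> in at_right 0. y < a \<epsilon>"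
  using a_at_top by (simp add: filterlim_at_top_dense)

lemma \<kappa>_tendsto: "((\<lambda>\<epsilon>. \<kappa> \<epsilon> * \<epsilon>) \<longlongrightarrow> 1) (at_right 0)"
proof -
  have AB: "(\<lambda>x. Ainv x powr (1 - h) * L (Ainv x)) \<sim>[at_top] (\<lambda>x. x)"
    using Ainv by (auto simp: asymptotic_inverse_def)
  have "((\<lambda>x. (Ainv x powr (1 - h) * L (Ainv x)) / x) \<longlongrightarrow> 1) at_top"
    using asymp_equivD_strong[OF AB] by (simp add: eventually_gt_at_top eventually_mono[OF eventually_gt_at_top[of 0]])
  from filterlim_compose[OF this recip_at_top] show ?thesis by (simp add: \<kappa>_def a_def)
qed

lemma L_a_pos: "\<forall>\<^sub>F \<epsilon> in at_right 0. 0 < L (a \<epsilon>)"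
proof -
  obtain x0 where "\<forall>x\<ge>x0. 0 < L x" using L_slowly_varying by (auto simp: slowly_varying_def)
  then show ?thesis using a_gt[of x0] by (auto elim: eventually_mono)
qed

lemma \<kappa>_pos: "\<forall>\<^sub>F \<epsilon> in at_right 0. 0 < \<kappa> \<epsilon>"
  using L_a_pos a_gt[of 0] by eventually_elim (simp add: \<kappa>_def)

lemma powr_over_a: "((\<lambda>\<epsilon>. \<epsilon> powr (-\<nu>) / a \<epsilon>) \<longlongrightarrow> 0) (at_right 0)"
proof -
  have "((\<lambda>\<epsilon>. (1 / \<epsilon>) powr \<nu> / a \<epsilon>) \<longlongrightarrow> 0) (at_right 0)"
    unfolding a_def
    using filterlim_compose[OF asymptotic_inverse_bounds(1)[OF L_slowly_varying Ainv h_range \<nu>(2)] recip_at_top] .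
  moreover have "\<forall>\<^sub>F \<epsilon> in at_right 0. (1 / \<epsilon>) powr \<nu> / a \<epsilon> = \<epsilon> powr (-\<nu>) / a \<epsilon>"
    using eventually_at_right_less[of "0::real"] by eventually_elim (simp add: powr_divide powr_minus_divide)
  ultimately show ?thesis by (rule Lim_transform_eventually)
qed

lemma a_times_powr:
  assumes "\<gamma> > 1 / (1 - h)"
  shows "((\<lambda>\<epsilon>. \<epsilon> powr \<gamma> * a \<epsilon>) \<longlongrightarrow> 0) (at_right 0)"
proof -
  have "((\<lambda>\<epsilon>. a \<epsilon> / (1 / \<epsilon>) powr \<gamma>) \<longlongrightarrow> 0) (at_right 0)"
    unfolding a_def
    using filterlim_compose[OF asymptotic_inverse_bounds(2)[OF L_slowly_varying Ainv h_range assms] recip_at_top] .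
  moreover have "\<forall>\<^sub>F \<epsilon> in at_right 0. a \<epsilon> / (1 / \<epsilon>) powr \<gamma> = \<epsilon> powr \<gamma> * a \<epsilon>"
    using eventually_at_right_less[of "0::real"] by eventually_elim (simp add: powr_divide)
  ultimately show ?thesis by (rule Lim_transform_eventually)
qed

lemma a_scale_bound:
  assumes "0 < u" shows "\<exists>C>0. \<forall>\<^sub>F \<epsilon> in at_right 0. a \<epsilon> \<le> C * a (\<epsilon> / u)"
proof -
  obtain C where "C > 0" "\<forall>\<^sub>F x in at_top. Ainv x \<le> C * Ainv (u * x)"
    using asymptotic_inverse_bounds(3)[OF L_slowly_varying Ainv h_range assms] by blast
  moreover from eventually_compose_filterlim[OF this(2) recip_at_top]
  have "\<forall>\<^sub>F \<epsilon> in at_right 0. a \<epsilon> \<le> C * a (\<epsilon> / u)" by (simp add: a_def)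
  ultimately show ?thesis by blast
qed

lemma scale_at_right_0:
  assumes "0 < u" shows "filterlim (\<lambda>\<epsilon>::real. \<epsilon> / u) (at_right 0) (at_right 0)"
proof -
  have "((\<lambda>\<epsilon>. \<epsilon> / u) \<longlongrightarrow> 0 / u) (at_right 0)" using assms by (intro tendsto_intros) auto
  moreover have "\<forall>\<^sub>F \<epsilon>::real in at_right 0. 0 < \<epsilon> / u"
    using eventually_at_right_less[of "0::real"] by eventually_elim (use assms in simp)
  ultimately show ?thesis by (auto simp: filterlim_at elim!: eventually_mono)
qed

lemma weak_limit_a: "converges_weakly (at_right 0) WM2_topology M (\<lambda>\<epsilon>. V (1 / a \<epsilon>)) N W"
proof -
  have "filterlim (\<lambda>\<epsilon>. 1 / a \<epsilon>) (at_right 0) (at_right 0)"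
  proof -
    have "((\<lambda>\<epsilon>. 1 / a \<epsilon>) \<longlongrightarrow> 0) (at_right 0)"
      using tendsto_inverse_0_at_top[OF a_at_top] by (simp add: inverse_eq_divide)
    moreover have "\<forall>\<^sub>F \<epsilon> in at_right 0. 0 < 1 / a \<epsilon>"
      using a_gt[of 0] by eventually_elim simp
    ultimately show ?thesis by (simp add: filterlim_at eventually_mono)
  qed
  moreover have "converges_weakly (at_right 0) WM2_topology M V N W"
    using weak_limit unfolding V_def[abs_def] W_def[abs_def] .
  ultimately show ?thesis by (rule converges_weakly_compose[rotated])
qed

text \<open>\<open>T\<close> sees the path only at integers; these are the corresponding points of
  the rescaled graph.\<close>

lemma V_grid:
  assumes "0 < a \<epsilon>"
  shows "(real n / a \<epsilon>, \<kappa> \<epsilon> * sqrt (Z2 (real n) \<omega>) / a \<epsilon>) \<in> half_line_graph (snd (V (1 / a \<epsilon>) \<omega>))"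
proof -
  have "(1 / a \<epsilon>) powr h * L (a \<epsilon>) = \<kappa> \<epsilon> / a \<epsilon>"
    using assms by (simp add: \<kappa>_def powr_divide powr_diff)
  then have "snd (V (1 / a \<epsilon>) \<omega>) (real n / a \<epsilon>) = \<kappa> \<epsilon> * sqrt (Z2 (real n) \<omega>) / a \<epsilon>"
    using assms by (simp add: V_def)
  then show ?thesis using half_line_graphI[of "real n / a \<epsilon>" "snd (V (1 / a \<epsilon>) \<omega>)"] assms by simp
qed

lemma graph_W: "half_line_graph (snd (W \<omega>)) = half_line_graph (\<lambda>t. sqrt (Y2 t \<omega>))"
  by (simp add: W_def half_line_graph_restrict)

lemma cadlag_sqrt_Y2: "\<omega> \<in> space N \<Longrightarrow> cadlag_on {0..} (\<lambda>t. sqrt (Y2 t \<omega>))"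
  using Y2_cadlag by (auto simp: cadlag_process_def intro: cadlag_on_sqrt)

lemma T_measurable [measurable]: "T \<epsilon> \<in> borel_measurable M"
proof -
  have [measurable]: "Z2 (real n) \<in> borel_measurable M" for n
    using Z2_cadlag by (auto simp: cadlag_process_def)
  have eq: "T \<epsilon> = (\<lambda>\<omega>. INF n. if real n > \<epsilon> powr (-\<nu>) \<and> c * sqrt (Z2 (real n) \<omega> / (real n)\<^sup>2) < \<epsilon> then of_nat n else top)"
    unfolding stopping_rule_def
    using INF_Collect_eq_top[where B=UNIV and f="of_nat :: nat \<Rightarrow> ennreal"] by (intro ext) simp
  show ?thesis by (subst eq) measurable
qed

lemma \<Phi>_eq_rat:
  assumes \<omega>: "\<omega> \<in> space N"
  shows "\<Phi> u \<omega> = (INF s\<in>{s\<in>\<rat>. 0 < s}. if c * (sqrt (Y2 s \<omega>) / s) < u then ennreal s else top)"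
  using cadlag_on_at_right[OF cadlag_sqrt_Y2[OF \<omega>]] by (intro limit_passage_eq_rat) simp

lemma countable_pos_rats: "countable {s\<in>\<rat>. 0 < (s::real)}"
  using countable_rat by (rule countable_subset[rotated]) auto

lemma \<Phi>_measurable [measurable]: "\<Phi> u \<in> borel_measurable N"
proof -
  have [measurable]: "Y2 s \<in> borel_measurable N" if "0 < s" for s
    using Y2_cadlag that by (auto simp: cadlag_process_def)
  have "(\<lambda>\<omega>. INF s\<in>{s\<in>\<rat>. 0 < s}. if c * (sqrt (Y2 s \<omega>) / s) < u then ennreal s else top) \<in> borel_measurable N"
    by (intro borel_measurable_INF countable_pos_rats) measurable
  then show ?thesis by (subst measurable_cong[OF \<Phi>_eq_rat])
qed


section \<open>Asymptotic inequalities for finitely many stopping events\<close>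

lemma T_gt_sets: assumes "finite S" shows "T_gt S \<epsilon> \<in> sets M"
  using assms unfolding case_prod_beta by measurable

lemma \<Phi>_ge_sets: assumes "finite S" shows "\<Phi>_ge S \<in> sets N"
  using assms unfolding case_prod_beta by measurable

text \<open>Since \<nu> < 1 / (1 - h), the cut-off imposed on the index in \<open>T\<close> lies
  before any fixed positive time on the scale \<open>a \<epsilon>\<close>.\<close>

lemma start_small:
  assumes "0 < u" "0 < p"
  shows "\<forall>\<^sub>F \<epsilon> in at_right 0. (\<epsilon> / u) powr (-\<nu>) < p * a \<epsilon>"
proof -
  have "((\<lambda>\<epsilon>. u powr \<nu> * (\<epsilon> powr (-\<nu>) / a \<epsilon>)) \<longlongrightarrow> u powr \<nu> * 0) (at_right 0)"
    by (intro tendsto_mult_left powr_over_a)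
  then have "\<forall>\<^sub>F \<epsilon> in at_right 0. u powr \<nu> * (\<epsilon> powr (-\<nu>) / a \<epsilon>) < p"
    using assms by (intro order_tendstoD(2)) auto
  then show ?thesis
    using a_gt[of 0] eventually_at_right_less[of "0::real"]
  proof eventually_elim
    case (elim \<epsilon>)
    then have "u powr \<nu> * \<epsilon> powr (-\<nu>) < p * a \<epsilon>" by (simp add: pos_divide_less_eq)
    then show ?case using elim assms by (simp add: powr_divide powr_minus_divide)
  qed
qed

text \<open>Proved for the complements. If \<open>\<Phi> (1 / u)\<close> is less than s, the limit
  path lies below its line with a margin throughout some time interval before s. A nearby prelimit
  path does the same, and that interval contains an integer time on the scale
  \<open>a \<epsilon>\<close>, by which \<open>T\<close> must have stopped.\<close>

lemma T_upper:
  assumes S: "finite S" "S \<subseteq> {0<..} \<times> {0<..}" and "0 < e"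
  shows "\<forall>\<^sub>F \<epsilon> in at_right 0. measure M (T_gt S \<epsilon>)
    < measure N (\<Phi>_ge S) + e"
proof -
  \<comment> \<open>Rational parameters keep the family countable, as \<open>WM2_liminf\<close>
    requires. Here [p, q] is the time interval and \<theta> the margin in the slope.\<close>
  define I where "I = {(u, s, p, q, \<theta>). (u, s) \<in> S \<and> p \<in> \<rat> \<and> q \<in> \<rat> \<and> \<theta> \<in> \<rat> \<and> 0 < p \<and> p < q \<and> q < s \<and> 0 < \<theta> \<and> \<theta> < (1::real)}"
  \<comment> \<open>Avoiding this region over [p, q] means lying strictly below the line of slope (1
    - \<theta>) / (c * u); the margin \<theta> compensates for
    \<open>\<kappa> \<epsilon> * \<epsilon>\<close> being only close to 1.\<close>
  define B where "B = (\<lambda>(u, s::real, p, q, \<theta>). {(t, z). p \<le> t \<and> t \<le> q \<and> (1 - \<theta>) * t \<le> c * u * (z::real)})"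
  define E where "E \<epsilon> = {\<omega> \<in> space M. \<not> (\<forall>(u, s)\<in>S. ennreal (s * a \<epsilon>) < T (\<epsilon> / u) \<omega>)}" for \<epsilon>
  define Q where "Q = {\<omega> \<in> space N. \<not> (\<forall>(u, s)\<in>S. ennreal s \<le> \<Phi> (1 / u) \<omega>)}"
  have E_eq: "E \<epsilon> = space M - T_gt S \<epsilon>" for \<epsilon>
    unfolding E_def by blast
  have Q_eq: "Q = space N - (\<Phi>_ge S)"
    unfolding Q_def by blast
  have I_D: "(u, s) \<in> S" "0 < p" "p < q" "q < s" "0 < \<theta>" "\<theta> < 1" "0 < u" "0 < s"
    if "(u, s, p, q, \<theta>) \<in> I" for u s p q \<theta>
    using that S(2) by (auto simp: I_def)
  have "\<forall>\<^sub>F \<epsilon> in at_right 0. measure N Q - e < measure M (E \<epsilon>)"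
  proof (rule WM2_liminf[OF M.prob_space_axioms N.prob_space_axioms weak_limit_a, where B=B and I=I and T="\<lambda>(u, s, p, q, \<theta>). q"])
    have "I \<subseteq> (\<lambda>((u, s), p, q, \<theta>). (u, s, p, q, \<theta>)) ` (S \<times> \<rat> \<times> \<rat> \<times> \<rat>)"
    proof
      fix i assume "i \<in> I"
      then obtain u s p q \<theta> where "i = (u, s, p, q, \<theta>)" "((u, s), p, q, \<theta>) \<in> S \<times> \<rat> \<times> \<rat> \<times> \<rat>"
        by (auto simp: I_def)
      then show "i \<in> (\<lambda>((u, s), p, q, \<theta>). (u, s, p, q, \<theta>)) ` (S \<times> \<rat> \<times> \<rat> \<times> \<rat>)"
        by (intro image_eqI[of _ _ "((u, s), p, q, \<theta>)"]) auto
    qed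
    moreover have "countable (S \<times> (\<rat> :: real set) \<times> (\<rat> :: real set) \<times> (\<rat> :: real set))"
      using S(1) countable_rat by (intro countable_SIGMA) (auto intro: countable_finite)
    ultimately show "countable I" by (meson countable_image countable_subset)
  next
    fix i assume "i \<in> I"
    then obtain u s p q \<theta> where i: "i = (u, s, p, q, \<theta>)" "(u, s, p, q, \<theta>) \<in> I" by (cases i) auto
    note D = I_D[OF i(2)]
    have "(q, (1 - \<theta>) * q / (c * u)) \<in> B i" using D c by (simp add: i B_def)
    then have "B i \<noteq> {}" by blast
    then show "B i \<noteq> {} \<and> B i \<subseteq> {..(\<lambda>(u, s, p, q, \<theta>). q) i} \<times> UNIV"
      by (intro conjI) (auto simp: i B_def)
    have "\<forall>\<^sub>F \<epsilon> in at_right 0. 1 - \<theta> < \<kappa> \<epsilon> * \<epsilon>"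
      using D by (intro order_tendstoD(1)[OF \<kappa>_tendsto]) auto
    then show "\<forall>\<^sub>F \<epsilon> in at_right 0. \<forall>\<omega>\<in>space M. half_line_graph (snd (V (1 / a \<epsilon>) \<omega>)) \<inter> B i = {} \<longrightarrow> \<omega> \<in> E \<epsilon>"
      using start_small[OF D(7,2)] a_gt[of 0] a_gt[of "1 / (q - p)"] \<kappa>_pos
    proof eventually_elim
      case (elim \<epsilon>)
      \<comment> \<open>The window from p * a \<epsilon> to q * a \<epsilon> is longer than one, so
        it contains the integer \<open>n\<close> chosen next.\<close>
      have gap: "p * a \<epsilon> + 1 < q * a \<epsilon>" using elim(4) D by (simp add: pos_divide_less_eq algebra_simps)
      define n where "n = nat \<lceil>p * a \<epsilon>\<rceil>"
      have "real n = of_int \<lceil>p * a \<epsilon>\<rceil>" using D elim(3) by (simp add: n_def)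
      then have n: "p * a \<epsilon> \<le> real n" "real n < q * a \<epsilon>" using gap by linarith+
      then have n_pos: "0 < real n" using mult_pos_pos[OF D(2) elim(3)] by linarith
      show ?case
      proof (intro ballI impI)
        fix \<omega> assume \<omega>: "\<omega> \<in> space M" and disj: "half_line_graph (snd (V (1 / a \<epsilon>) \<omega>)) \<inter> B i = {}"
        define z where "z = sqrt (Z2 (real n) \<omega>)"
        have "(real n / a \<epsilon>, \<kappa> \<epsilon> * z / a \<epsilon>) \<notin> B i"
          using V_grid[OF elim(3), of n \<omega>] disj unfolding z_def by blast
        then have "c * u * (\<kappa> \<epsilon> * z / a \<epsilon>) < (1 - \<theta>) * (real n / a \<epsilon>)"
          using n elim(3) by (simp add: i B_def field_simps)
        then have "\<kappa> \<epsilon> * (c * u * z) < (1 - \<theta>) * real n"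
          using elim(3) by (simp add: field_simps)
        also have "\<dots> < \<kappa> \<epsilon> * \<epsilon> * real n" using elim(1) n_pos by simp
        finally have "c * u * z < \<epsilon> * real n"
          using elim(5) by (simp add: mult.assoc)
        then have "c * (z / real n) < \<epsilon> / u" using n_pos D by (simp add: field_simps)
        moreover have "real n \<le> s * a \<epsilon>"
          using n(2) mult_strict_right_mono[OF D(4) elim(3)] by linarith
        moreover have "(\<epsilon> / u) powr (-\<nu>) < real n" using elim(2) n(1) by linarith
        ultimately have "T (\<epsilon> / u) \<omega> \<le> ennreal (s * a \<epsilon>)"
          using elim(3) D
          by (subst stopping_rule_le_iff) (auto intro!: exI[of _ n] simp: z_def)
        then have "\<not> ennreal (s * a \<epsilon>) < T (\<epsilon> / u) \<omega>" by simp
        then show "\<omega> \<in> E \<epsilon>" using D(1) \<omega> unfolding E_def by fast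
      qed
    qed
  next
    show "\<forall>\<^sub>F \<epsilon> in at_right 0. E \<epsilon> \<in> sets M" unfolding E_eq using T_gt_sets[OF S(1)] by auto
    show "Q \<in> sets N" unfolding Q_eq using \<Phi>_ge_sets[OF S(1)] by auto
  next
    fix \<omega> assume "\<omega> \<in> Q"
    then obtain u s where us: "(u, s) \<in> S" "\<Phi> (1 / u) \<omega> < ennreal s" and \<omega>: "\<omega> \<in> space N"
      unfolding Q_def by (auto simp: not_le)
    have "0 < u" "0 < s" using us(1) S(2) by auto
    define Y where "Y t = sqrt (Y2 t \<omega>)" for t
    have Y: "cadlag_on {0..} Y" using cadlag_sqrt_Y2[OF \<omega>] by (simp add: Y_def[abs_def])
    obtain r where r: "0 < r" "r < s" "c * (Y r / r) < 1 / u"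
      using us(2) by (auto simp: limit_passage_less_iff Y_def)
    define m where "m = u * (c * (Y r / r))"
    have "m < 1" using r(3) \<open>0 < u\<close> by (simp add: m_def field_simps)
    \<comment> \<open>Less than half of 1 - m: the path then stays under the relative slope 1 - 2 *
      \<theta> just after r, and the remaining \<theta> separates it from
      \<open>B i\<close>.\<close>
    then obtain \<theta> where \<theta>: "\<theta> \<in> \<rat>" "0 < \<theta>" "\<theta> < (1 - m) / 2" "\<theta> < 1"
      using Rats_dense_in_real[of 0 "min 1 ((1 - m) / 2)"] by auto
    have "m < 1 - 2 * \<theta>" using \<theta> by simp
    then have "c * (Y r / r) < (1 - 2 * \<theta>) / u" using \<open>0 < u\<close> by (simp add: m_def field_simps)
    moreover have "((\<lambda>t. c * (Y t / t)) \<longlongrightarrow> c * (Y r / r)) (at_right r)"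
      using r(1) by (intro tendsto_mult_left tendsto_divide tendsto_ident_at cadlag_on_at_right[OF Y]) auto
    ultimately have "\<forall>\<^sub>F t in at_right r. c * (Y t / t) < (1 - 2 * \<theta>) / u"
      by (intro order_tendstoD(2))
    then obtain b0 where b0: "b0 > r" "\<And>t. r < t \<Longrightarrow> t < b0 \<Longrightarrow> c * (Y t / t) < (1 - 2 * \<theta>) / u"
      using eventually_at_right[of r "r + 1"] by auto
    define b where "b = min b0 s"
    have "r < b" using b0 r by (simp add: b_def)
    then obtain p where p: "p \<in> \<rat>" "r < p" "p < b" using Rats_dense_in_real by blast
    obtain q where q: "q \<in> \<rat>" "p < q" "q < b" using Rats_dense_in_real[OF p(3)] by blast
    have above: "z \<le> (1 - 2 * \<theta>) / (c * u) * t" if "(t, z) \<in> half_line_graph Y" "r < t" "t < b" for t z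
    proof (rule half_line_graph_bound_above[OF Y _ that(1), of r b])
      fix t assume t: "r < t" "t < b"
      then have "c * (Y t / t) < (1 - 2 * \<theta>) / u" using b0(2)[of t] by (simp add: b_def)
      then show "Y t \<le> (1 - 2 * \<theta>) / (c * u) * t" using c \<open>0 < u\<close> t r(1) by (simp add: field_simps)
    qed (use that r in auto)
    define i where "i = (u, s, p, q, \<theta>)"
    \<comment> \<open>The first two terms keep every point of the graph within \<rho> of
      \<open>B i\<close> inside the time interval (r, b), where \<open>above\<close> applies. The
      third is too small to bridge the difference of more than \<theta> * r between the two lines; c
      * u + 1 accounts for the errors in both coordinates.\<close>
    define \<rho> where "\<rho> = min (min (p - r) (b - q)) (\<theta> * r / (c * u + 1))"
    have cu: "0 < c * u" using c \<open>0 < u\<close> by simp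
    have "i \<in> I" using us(1) p q \<theta> r by (auto simp: i_def I_def b_def)
    moreover have "0 < \<rho>" using p q \<theta> r cu by (simp add: \<rho>_def)
    moreover have "\<rho> \<le> infdist x (B i)" if x: "x \<in> half_line_graph (snd (W \<omega>))" for x
    proof (rule infdist_geI)
      have "(q, (1 - \<theta>) * q / (c * u)) \<in> B i" using q c \<open>0 < u\<close> by (simp add: i_def B_def)
      then show "B i \<noteq> {}" by blast
      fix y assume "y \<in> B i"
      then obtain t' z' where y: "y = (t', z')" "p \<le> t'" "t' \<le> q" "(1 - \<theta>) * t' \<le> c * u * z'"
        by (auto simp: i_def B_def)
      obtain t z where xtz: "x = (t, z)" by (cases x)
      show "\<rho> \<le> dist x y"
      proof (rule ccontr)
        assume "\<not> ?thesis"
        then have near: "\<bar>t - t'\<bar> < \<rho>" "\<bar>z - z'\<bar> < \<rho>"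
          using dist_real_prod_lessD[of t z t' z' \<rho>] by (auto simp: xtz y(1))
        have "\<rho> \<le> p - r" "\<rho> \<le> b - q" "\<rho> \<le> \<theta> * r / (c * u + 1)" by (simp_all add: \<rho>_def)
        then have t: "r < t" "t < b" and \<rho>': "\<rho> * (c * u + 1) \<le> \<theta> * r"
          using near y cu by (auto simp: pos_le_divide_eq)
        have "z \<le> (1 - 2 * \<theta>) / (c * u) * t"
          using x t by (intro above) (simp_all add: xtz graph_W Y_def[abs_def])
        then have z: "c * u * z \<le> (1 - 2 * \<theta>) * t" using cu by (simp add: field_simps)
        have "(1 - \<theta>) * (t - \<rho>) \<le> (1 - \<theta>) * t'" using near(1) \<theta>(4) by (intro mult_left_mono) auto
        also have "\<dots> \<le> c * u * z'" by (rule y(4))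
        also have "\<dots> \<le> c * u * (z + \<rho>)" using near(2) cu by (intro mult_left_mono) auto
        also have "\<dots> \<le> (1 - 2 * \<theta>) * t + c * u * \<rho>" using z by (simp add: algebra_simps)
        finally have "\<theta> * t \<le> \<rho> * (c * u + 1) - \<theta> * \<rho>" by (simp add: algebra_simps)
        moreover have "0 < \<theta> * \<rho>" using \<open>0 < \<rho>\<close> \<theta> by simp
        moreover have "\<theta> * r < \<theta> * t" using t \<theta> by simp
        ultimately show False using \<rho>' by linarith
      qed
    qed
    ultimately show "\<exists>i\<in>I. \<exists>r>0. \<forall>p\<in>half_line_graph (snd (W \<omega>)). r \<le> infdist p (B i)" by blast
  qed fact
  then show ?thesis
  proof eventually_elim
    case (elim \<epsilon>)
    then show ?case
      unfolding E_eq Q_eq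
      using N.prob_compl[OF \<Phi>_ge_sets[OF S(1)]] M.prob_compl[OF T_gt_sets[OF S(1)]] by simp
  qed
qed

section \<open>Stopping near time zero\<close>

definition early :: "real \<Rightarrow> real \<Rightarrow> real \<Rightarrow> 'a set" where
  "early u \<eta> \<epsilon> = {\<omega> \<in> space M. T (\<epsilon> / u) \<omega> \<le> ennreal (\<eta> * a \<epsilon>)}"

lemma early_sets: "early u \<eta> \<epsilon> \<in> sets M"
  unfolding early_def by measurable

text \<open>The no-early-stopping condition is applied with K = 1 / c at \<epsilon> / u. Its range
  of indices is expressed in a (\<epsilon> / u), and the constant \<open>C\<close> of
  \<open>a_scale_bound\<close> bounds \<eta> * a \<epsilon> by \<eta> * C * a (\<epsilon> /
  u).\<close>

lemma early_small:
  assumes "0 < u" "0 < e"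
  shows "\<forall>\<^sub>F \<eta> in at_right 0. \<forall>\<^sub>F \<epsilon> in at_right 0. measure M (early u \<eta> \<epsilon>) < e"
proof -
  define P where "P \<eta> \<epsilon> = {\<omega> \<in> space M. (INF n\<in>{n::nat. \<epsilon> powr (-\<nu>) \<le> real n \<and> real n \<le> \<eta> * a \<epsilon>}.
            ereal (sqrt (Z2 (real n) \<omega>) / real n)) \<le> ereal (1 / c * \<epsilon>)}" for \<eta> \<epsilon>
  have "0 < 1 / c" using c by simp
  then have "((\<lambda>\<eta>. Limsup (at_right 0) (\<lambda>\<epsilon>. emeasure M (P \<eta> \<epsilon>))) \<longlongrightarrow> 0) (at_right 0)"
    using no_early unfolding no_early_stopping_def P_def a_def by blast
  then have "\<forall>\<^sub>F \<eta> in at_right 0. Limsup (at_right 0) (\<lambda>\<epsilon>. emeasure M (P \<eta> \<epsilon>)) < ennreal e"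
    using \<open>0 < e\<close> by (intro order_tendstoD(2)) auto
  then obtain \<eta>1 where \<eta>1: "0 < \<eta>1" "\<And>\<eta>. 0 < \<eta> \<Longrightarrow> \<eta> < \<eta>1 \<Longrightarrow> Limsup (at_right 0) (\<lambda>\<epsilon>. emeasure M (P \<eta> \<epsilon>)) < ennreal e"
    using eventually_at_right[of "0::real" 1] by auto
  obtain C where C: "0 < C" "\<forall>\<^sub>F \<epsilon> in at_right 0. a \<epsilon> \<le> C * a (\<epsilon> / u)"
    using a_scale_bound[OF \<open>0 < u\<close>] by blast
  have "\<forall>\<^sub>F \<eta> in at_right (0::real). 0 < \<eta> \<and> \<eta> < \<eta>1 / C"
    using \<eta>1(1) C(1) by (auto simp: eventually_at_right[of _ 1] intro!: exI[of _ "\<eta>1 / C"])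
  then show ?thesis
  proof eventually_elim
    case (elim \<eta>)
    then have "0 < \<eta> * C" "\<eta> * C < \<eta>1" using C(1) by (auto simp: field_simps)
    then have "\<forall>\<^sub>F \<epsilon> in at_right 0. emeasure M (P (\<eta> * C) \<epsilon>) < ennreal e"
      using \<eta>1(2) by (intro Limsup_lessD) auto
    from eventually_compose_filterlim[OF this scale_at_right_0[OF \<open>0 < u\<close>]]
    show ?case
      using C(2) a_gt[of 0] eventually_at_right_less[of "0::real"]
    proof eventually_elim
      case (elim \<epsilon>)
      have "early u \<eta> \<epsilon> \<subseteq> P (\<eta> * C) (\<epsilon> / u)"
      proof
        fix \<omega> assume "\<omega> \<in> early u \<eta> \<epsilon>"
        then obtain n :: nat where n: "(\<epsilon> / u) powr (-\<nu>) < real n" "c * (sqrt (Z2 (real n) \<omega>) / real n) < \<epsilon> / u"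
            "real n \<le> \<eta> * a \<epsilon>" and \<omega>: "\<omega> \<in> space M"
          using stopping_rule_le_iff[of "\<eta> * a \<epsilon>" Z2 \<nu> c "\<epsilon> / u" \<omega>] elim(3) \<open>0 < \<eta> \<and> \<eta> < \<eta>1 / C\<close>
          by (auto simp: early_def)
        have "\<eta> * a \<epsilon> \<le> \<eta> * (C * a (\<epsilon> / u))"
          using elim(2) \<open>0 < \<eta> \<and> \<eta> < \<eta>1 / C\<close> by (intro mult_left_mono) auto
        then have "n \<in> {n::nat. (\<epsilon> / u) powr (-\<nu>) \<le> real n \<and> real n \<le> \<eta> * C * a (\<epsilon> / u)}"
          using n by (simp add: mult.assoc)
        moreover have "sqrt (Z2 (real n) \<omega>) / real n \<le> 1 / c * (\<epsilon> / u)"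
        proof -
          have "1 / c * (c * (sqrt (Z2 (real n) \<omega>) / real n)) \<le> 1 / c * (\<epsilon> / u)"
            using n(2) c by (intro mult_left_mono) auto
          then show ?thesis using c by simp
        qed
        ultimately show "\<omega> \<in> P (\<eta> * C) (\<epsilon> / u)"
          using \<omega> by (auto simp: P_def simp del: mem_Collect_eq intro!: INF_lower2[of n])
      qed
      moreover have "P (\<eta> * C) (\<epsilon> / u) \<in> sets M"
      proof -
        have [measurable]: "Z2 (real n) \<in> borel_measurable M" for n
          using Z2_cadlag by (auto simp: cadlag_process_def)
        show ?thesis unfolding P_def by measurable
      qed
      ultimately have "emeasure M (early u \<eta> \<epsilon>) \<le> emeasure M (P (\<eta> * C) (\<epsilon> / u))"
        by (rule emeasure_mono)
      also note elim(1)
      finally have "emeasure M (early u \<eta> \<epsilon>) < ennreal e" .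
      then show ?case using \<open>0 < e\<close> by (simp add: M.emeasure_eq_measure ennreal_less_iff)
    qed
  qed
qed

text \<open>If the rescaled graph avoids \<open>B\<close>, no integer time between \<eta> * a
  \<epsilon> and s * a \<epsilon> can trigger \<open>T\<close>. What remains is stopping up to
  \<eta> * a \<epsilon>, which is charged to the events \<open>early\<close>.\<close>

lemma T_lower:
  assumes S: "finite S" "S \<subseteq> {0<..} \<times> {0<..}" and "0 < e" and \<tau>: "0 < \<tau>" "\<tau> < 1"
  shows "\<forall>\<^sub>F \<epsilon> in at_right 0.
    measure N (\<Phi>_gt_perturbed \<tau> S) - e <
    measure M (T_gt S \<epsilon>)"
proof (cases "S = {}")
  case True
  then show ?thesis using \<open>0 < e\<close> by (simp add: M.prob_space N.prob_space)
next
  case False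
  \<comment> \<open>Half of \<open>e\<close> pays for the early events, shared equally by the
    elements of \<open>S\<close>; the other half goes to \<open>WM2_liminf\<close>.\<close>
  define e1 where "e1 = e / (2 * real (card S))"
  have e1: "0 < e1" "real (card S) * e1 = e / 2" using S(1) False \<open>0 < e\<close> by (auto simp: e1_def card_gt_0_iff)
  have "\<forall>\<^sub>F \<eta> in at_right 0. \<forall>x\<in>S. (\<forall>\<^sub>F \<epsilon> in at_right 0. measure M (early (fst x) \<eta> \<epsilon>) < e1) \<and> \<eta> < snd x"
  proof (intro eventually_ball_finite[OF S(1)] ballI eventually_conj)
    fix x assume x: "x \<in> S"
    then have "0 < fst x" "0 < snd x" using S(2) by auto
    then show "\<forall>\<^sub>F \<eta> in at_right 0. \<forall>\<^sub>F \<epsilon> in at_right 0. measure M (early (fst x) \<eta> \<epsilon>) < e1"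
      using early_small e1(1) by simp
    show "\<forall>\<^sub>F \<eta> in at_right 0. \<eta> < snd x"
      by (rule order_tendstoD(2)[OF tendsto_ident_at]) fact
  qed
  with eventually_at_right_less[of "0::real"]
  have "\<forall>\<^sub>F \<eta> in at_right 0. 0 < \<eta> \<and> (\<forall>x\<in>S. (\<forall>\<^sub>F \<epsilon> in at_right 0. measure M (early (fst x) \<eta> \<epsilon>) < e1) \<and> \<eta> < snd x)"
    by (rule eventually_conj)
  from eventually_happens'[OF trivial_limit_at_right_real this]
  obtain \<eta> where "0 < \<eta>"
    and \<eta>S: "\<forall>x\<in>S. (\<forall>\<^sub>F \<epsilon> in at_right 0. measure M (early (fst x) \<eta> \<epsilon>) < e1) \<and> \<eta> < snd x"
    by (elim exE conjE)
  have \<eta>: "0 < \<eta>" "\<And>u s. (u, s) \<in> S \<Longrightarrow> \<eta> < s" using \<open>0 < \<eta>\<close> \<eta>S by auto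
  \<comment> \<open>Points on or below the line of slope (1 + \<tau>) / (c * u). The factor 1 +
    \<tau> lies between \<open>\<kappa> \<epsilon> * \<epsilon>\<close>, which tends to 1, and the
    factor 1 / (1 - \<tau>) guaranteed on \<open>Q\<close>.\<close>
  define B where "B = {(t, z). \<exists>(u, s)\<in>S. \<eta> \<le> t \<and> t \<le> s \<and> c * u * z \<le> (1 + \<tau>) * (t::real)}"
  define G where "G \<epsilon> = T_gt S \<epsilon>" for \<epsilon>
  define E where "E \<epsilon> = G \<epsilon> \<union> (\<Union>x\<in>S. early (fst x) \<eta> \<epsilon>)" for \<epsilon>
  define Q where "Q = (\<Phi>_gt_perturbed \<tau> S)"
  have G_sets: "G \<epsilon> \<in> sets M" for \<epsilon> unfolding G_def by (rule T_gt_sets[OF S(1)])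
  have E_sets: "E \<epsilon> \<in> sets M" for \<epsilon> 
    unfolding E_def by (intro sets.Un sets.finite_UN G_sets early_sets S(1))
  have B_I: "(t, z) \<in> B" if "(u, s) \<in> S" "\<eta> \<le> t" "t \<le> s" "c * u * z \<le> (1 + \<tau>) * t" for u s t z
    unfolding B_def using that by blast
  have B_ne: "B \<noteq> {}"
  proof -
    obtain u s where us: "(u, s) \<in> S" using False by auto
    have "0 < u" using us S(2) by auto
    then have "(s, (1 + \<tau>) * s / (c * u)) \<in> B" using \<eta>(2)[OF us] c by (intro B_I[OF us]) auto
    then show ?thesis by blast
  qed
  have "\<forall>\<^sub>F \<epsilon> in at_right 0. measure N Q - e / 2 < measure M (E \<epsilon>)"
  proof (rule WM2_liminf[OF M.prob_space_axioms N.prob_space_axioms weak_limit_a, where B="\<lambda>_. B" and I="{()}" and T="\<lambda>_. \<Sum>x\<in>S. snd x"])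
    \<comment> \<open>The sum of all levels is a convenient common bound for the times occurring in
      \<open>B\<close>.\<close>
    have "t \<le> (\<Sum>x\<in>S. snd x)" if "(u, s) \<in> S" "t \<le> s" for t u s
      using member_le_sum[OF that(1), of snd] S that(2) by fastforce
    then show "B \<noteq> {} \<and> B \<subseteq> {..\<Sum>x\<in>S. snd x} \<times> UNIV" using B_ne by (auto simp: B_def)
  next
    have "\<forall>\<^sub>F \<epsilon> in at_right 0. \<kappa> \<epsilon> * \<epsilon> < 1 + \<tau>"
      using \<tau> by (intro order_tendstoD(2)[OF \<kappa>_tendsto]) auto
    then show "\<forall>\<^sub>F \<epsilon> in at_right 0. \<forall>\<omega>\<in>space M. half_line_graph (snd (V (1 / a \<epsilon>) \<omega>)) \<inter> B = {} \<longrightarrow> \<omega> \<in> E \<epsilon>"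
      using a_gt[of 0] \<kappa>_pos
    proof eventually_elim
      case (elim \<epsilon>)
      show ?case
      proof (intro ballI impI, rule ccontr)
        fix \<omega> assume \<omega>: "\<omega> \<in> space M" and disj: "half_line_graph (snd (V (1 / a \<epsilon>) \<omega>)) \<inter> B = {}"
          and "\<omega> \<notin> E \<epsilon>"
        then obtain u s where us: "(u, s) \<in> S" "T (\<epsilon> / u) \<omega> \<le> ennreal (s * a \<epsilon>)"
          and late: "\<not> T (\<epsilon> / u) \<omega> \<le> ennreal (\<eta> * a \<epsilon>)"
          by (fastforce simp: E_def G_def early_def not_less)
        have "0 < u" "0 < s" using us(1) S(2) by auto
        obtain n :: nat where n: "(\<epsilon> / u) powr (-\<nu>) < real n" "c * (sqrt (Z2 (real n) \<omega>) / real n) < \<epsilon> / u"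
            "real n \<le> s * a \<epsilon>"
          using us(2) \<open>0 < s\<close> elim(2) by (auto simp: stopping_rule_le_iff)
        have n2: "\<eta> * a \<epsilon> < real n"
          using late n(1,2) \<eta>(1) elim(2) by (subst (asm) stopping_rule_le_iff) (auto simp: not_le)
        then have n_pos: "0 < real n" using mult_pos_pos[OF \<eta>(1) elim(2)] by linarith
        define z where "z = sqrt (Z2 (real n) \<omega>)"
        have "c * u * z < \<epsilon> * real n" using n(2) n_pos \<open>0 < u\<close> by (simp add: z_def field_simps)
        then have "\<kappa> \<epsilon> * (c * u * z) < \<kappa> \<epsilon> * (\<epsilon> * real n)" using elim(3) by simp
        also have "\<dots> \<le> (1 + \<tau>) * real n" using elim(1) by (simp add: mult.assoc[symmetric] mult_right_mono)
        finally have "c * u * (\<kappa> \<epsilon> * z / a \<epsilon>) \<le> (1 + \<tau>) * (real n / a \<epsilon>)"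
          using elim(2) by (simp add: field_simps)
        then have "(real n / a \<epsilon>, \<kappa> \<epsilon> * z / a \<epsilon>) \<in> B"
          using n(3) n2 elim(2) by (intro B_I[OF us(1)]) (simp_all add: pos_le_divide_eq pos_divide_le_eq)
        then show False using V_grid[OF elim(2), of n \<omega>] disj unfolding z_def by blast
      qed
    qed
  next
    show "Q \<in> sets N" unfolding Q_def case_prod_beta using S(1) by measurable
  next
    fix \<omega> assume Q: "\<omega> \<in> Q"
    then have \<omega>: "\<omega> \<in> space N" by (simp add: Q_def)
    define Y where "Y t = sqrt (Y2 t \<omega>)" for t
    have Y: "cadlag_on {0..} Y" using cadlag_sqrt_Y2[OF \<omega>] by (simp add: Y_def[abs_def])
    have "\<exists>\<rho>>0. \<forall>x\<in>half_line_graph Y. \<forall>t' z'. \<eta> \<le> t' \<and> t' \<le> s \<and> c * u * z' \<le> (1 + \<tau>) * t' \<longrightarrow> \<rho> \<le> dist x (t', z')"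
      if us: "(u, s) \<in> S" for u s
    proof -
      have u: "0 < u" "0 < s" using us S(2) by auto
      define m where "m = 1 / (c * ((1 - \<tau>) * u))"
      have below: "m * t \<le> Y t" if t: "0 < t" "t \<le> s + \<tau>" for t
      proof -
        have "ennreal (s + \<tau>) < \<Phi> (1 / ((1 - \<tau>) * u)) \<omega>" using Q us by (auto simp: Q_def)
        moreover have "\<Phi> (1 / ((1 - \<tau>) * u)) \<omega> \<le> ennreal t" if "c * (Y t / t) < 1 / ((1 - \<tau>) * u)"
          unfolding limit_passage_def using that t by (intro INF_lower) (simp add: Y_def)
        ultimately have "\<not> c * (Y t / t) < 1 / ((1 - \<tau>) * u)"
          using t ennreal_leI[OF t(2)] by (meson leD order_trans)
        then show ?thesis using c u \<tau> t by (simp add: m_def field_simps not_less)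
      qed
      have cu: "0 < c * u" using c u by simp
      \<comment> \<open>The surplus of 1 / (1 - \<tau>) over 1 + \<tau> is at least \<tau>^2, so at
        times after \<eta> / 2 the path exceeds the line of \<open>B\<close>, in units of 1 / (c *
        u), by more than \<eta> / 2 * \<tau>^2. The third term is this surplus divided by c * u + 2,
        a bound for the combined effect of errors in both coordinates.\<close>
      define \<rho> where "\<rho> = min (min (\<eta> / 2) \<tau>) (\<eta> * \<tau>\<^sup>2 / (2 * (c * u + 2)))"
      have \<rho>: "\<rho> \<le> \<eta> / 2" "\<rho> \<le> \<tau>" "\<rho> \<le> \<eta> * \<tau>\<^sup>2 / (2 * (c * u + 2))"
        unfolding \<rho>_def by (meson min.cobounded1 min.cobounded2 order_trans)+
      have \<rho>_pos: "0 < \<rho>" using \<eta>(1) \<tau> cu by (simp add: \<rho>_def)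
      have \<rho>': "\<rho> * (c * u + 2) \<le> \<eta> / 2 * \<tau>\<^sup>2" using \<rho>(3) cu by (simp add: field_simps)
      have "\<rho> \<le> dist (t, z) (t', z')"
        if tz: "(t, z) \<in> half_line_graph Y" and t'z': "\<eta> \<le> t'" "t' \<le> s" "c * u * z' \<le> (1 + \<tau>) * t'" for t z t' z'
      proof (rule ccontr)
        assume "\<not> ?thesis"
        then have near: "\<bar>t - t'\<bar> < \<rho>" "\<bar>z - z'\<bar> < \<rho>"
          using dist_real_prod_lessD[of t z t' z' \<rho>] by auto
        have t: "\<eta> / 2 < t" "t \<le> s + \<tau>" using near(1) \<rho> t'z' by linarith+
        have "m * t \<le> z"
          using t \<eta>(1) below by (intro half_line_graph_bound_below[OF Y _ tz]) auto
        then have "c * u * (m * t) \<le> c * u * z" using cu by (intro mult_left_mono) auto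
        moreover have "c * u * (m * t) = t / (1 - \<tau>)" using c u \<tau> by (simp add: m_def)
        moreover have "t * (1 + \<tau> + \<tau>\<^sup>2) \<le> t / (1 - \<tau>)"
        proof -
          have "(1 + \<tau> + \<tau>\<^sup>2) * (1 - \<tau>) = 1 - \<tau> ^ 3" by (simp add: algebra_simps power2_eq_square power3_eq_cube)
          then have "1 + \<tau> + \<tau>\<^sup>2 \<le> 1 / (1 - \<tau>)" using \<tau> by (simp add: pos_le_divide_eq)
          then have "t * (1 + \<tau> + \<tau>\<^sup>2) \<le> t * (1 / (1 - \<tau>))" using t \<eta>(1) by (intro mult_left_mono) auto
          then show ?thesis by simp
        qed
        ultimately have "t * (1 + \<tau> + \<tau>\<^sup>2) \<le> c * u * z" by linarith
        also have "\<dots> \<le> c * u * (z' + \<rho>)" using near(2) cu by (intro mult_left_mono) auto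
        also have "\<dots> \<le> (1 + \<tau>) * t' + c * u * \<rho>" using t'z'(3) by (simp add: algebra_simps)
        also have "\<dots> \<le> (1 + \<tau>) * (t + \<rho>) + c * u * \<rho>" using near(1) \<tau> by (intro add_right_mono mult_left_mono) auto
        finally have "t * \<tau>\<^sup>2 \<le> \<rho> * (c * u + 1 + \<tau>)" by (simp add: algebra_simps)
        also have "\<dots> \<le> \<rho> * (c * u + 2)" using \<rho>_pos \<tau> by (intro mult_left_mono) auto
        also have "\<dots> \<le> \<eta> / 2 * \<tau>\<^sup>2" by (rule \<rho>')
        also have "\<dots> < t * \<tau>\<^sup>2" using t(1) \<tau> by (intro mult_strict_right_mono) auto
        finally show False by simp
      qed
      then show ?thesis using \<rho>_pos by (intro exI[of _ \<rho>]) auto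
    qed
    then have "\<forall>y\<in>S. \<exists>\<rho>>0. \<forall>x\<in>half_line_graph Y. \<forall>t' z'. \<eta> \<le> t' \<and> t' \<le> snd y \<and> c * fst y * z' \<le> (1 + \<tau>) * t' \<longrightarrow> \<rho> \<le> dist x (t', z')"
      by simp
    from bchoice[OF this] obtain \<rho> where \<rho>S: "\<forall>y\<in>S. 0 < \<rho> y \<and> (\<forall>x\<in>half_line_graph Y. \<forall>t' z'.
        \<eta> \<le> t' \<and> t' \<le> snd y \<and> c * fst y * z' \<le> (1 + \<tau>) * t' \<longrightarrow> \<rho> y \<le> dist x (t', z'))"
      by blast
    have \<rho>: "0 < \<rho> y" if "y \<in> S" for y using \<rho>S that by blast
    have \<rho>_dist: "\<rho> (u, s) \<le> dist x (t', z')"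
      if "(u, s) \<in> S" "x \<in> half_line_graph Y" "\<eta> \<le> t'" "t' \<le> s" "c * u * z' \<le> (1 + \<tau>) * t'" for u s x t' z'
      using bspec[OF \<rho>S that(1)] that(2-) by simp
    have "Min (\<rho> ` S) \<le> infdist x B" if x: "x \<in> half_line_graph (snd (W \<omega>))" for x
    proof (rule infdist_geI[OF B_ne])
      fix y assume "y \<in> B"
      then obtain t' z' u s where y: "y = (t', z')" "(u, s) \<in> S" "\<eta> \<le> t'" "t' \<le> s" "c * u * z' \<le> (1 + \<tau>) * t'"
        by (auto simp: B_def)
      then have "Min (\<rho> ` S) \<le> \<rho> (u, s)" using S(1) by auto
      also have "\<dots> \<le> dist x y" unfolding y(1) using x y by (intro \<rho>_dist) (auto simp: graph_W Y_def[abs_def])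
      finally show "Min (\<rho> ` S) \<le> dist x y" .
    qed
    moreover have "0 < Min (\<rho> ` S)" using S(1) False \<rho> by simp
    ultimately show "\<exists>i\<in>{()}. \<exists>r>0. \<forall>p\<in>half_line_graph (snd (W \<omega>)). r \<le> infdist p B" by blast
  qed (use E_sets \<open>0 < e\<close> in auto)
  moreover have "\<forall>\<^sub>F \<epsilon> in at_right 0. \<forall>x\<in>S. measure M (early (fst x) \<eta> \<epsilon>) < e1"
    using \<eta>S S(1) by (intro eventually_ball_finite) auto
  ultimately show ?thesis
  proof eventually_elim
    case (elim \<epsilon>)
    have "measure M (E \<epsilon>) \<le> measure M (G \<epsilon>) + measure M (\<Union>x\<in>S. early (fst x) \<eta> \<epsilon>)"
      unfolding E_def using S(1) early_sets G_sets by (intro measure_Un_le sets.finite_UN) auto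
    also have "measure M (\<Union>x\<in>S. early (fst x) \<eta> \<epsilon>) \<le> (\<Sum>x\<in>S. measure M (early (fst x) \<eta> \<epsilon>))"
      using S(1) early_sets by (intro measure_UNION_le) auto
    also have "\<dots> \<le> (\<Sum>x\<in>S. e1)" using elim(2) by (intro sum_mono) (auto intro: less_imp_le)
    also have "\<dots> = e / 2" using e1(2) by simp
    finally show ?case using elim(1) by (simp add: G_def Q_def)
  qed
qed

end

section \<open>Self-similarity and finiteness of the limit passage time\<close>

lemma INF_ennreal_mult_left:
  fixes f :: "'i \<Rightarrow> ennreal"
  assumes "0 < k"
  shows "(INF x\<in>A. ennreal k * f x) = ennreal k * (INF x\<in>A. f x)"
proof (rule antisym)
  have inv: "ennreal (1 / k) * (ennreal k * z) = z" "ennreal k * (ennreal (1 / k) * z) = z" for z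
    using assms by (simp_all add: mult.assoc[symmetric] ennreal_mult[symmetric])
  have "ennreal (1 / k) * (INF x\<in>A. ennreal k * f x) \<le> f x" if "x \<in> A" for x
    using mult_left_mono[OF INF_lower[OF that, of "\<lambda>x. ennreal k * f x"], of "ennreal (1 / k)"] by (simp add: inv)
  then have "ennreal (1 / k) * (INF x\<in>A. ennreal k * f x) \<le> (INF x\<in>A. f x)" by (rule INF_greatest)
  from mult_left_mono[OF this, of "ennreal k"]
  show "(INF x\<in>A. ennreal k * f x) \<le> ennreal k * (INF x\<in>A. f x)" by (simp add: inv)
  show "ennreal k * (INF x\<in>A. f x) \<le> (INF x\<in>A. ennreal k * f x)"
    by (intro INF_greatest mult_left_mono INF_lower) auto
qed

text \<open>Substitution s = k * r in the infimum.\<close>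

lemma limit_passage_rescale:
  assumes "0 < k"
  shows "limit_passage Y2 c v \<omega> = ennreal k * limit_passage (\<lambda>s. Y2 (k * s)) c (v * k) \<omega>"
proof -
  have "{s. 0 < s \<and> c * (sqrt (Y2 s \<omega>) / s) < v} =
      (*) k ` {r. 0 < r \<and> c * (sqrt (Y2 (k * r) \<omega>) / r) < v * k}" (is "?A = ?B")
  proof
    show "?A \<subseteq> ?B"
    proof
      fix s assume s: "s \<in> ?A"
      show "s \<in> ?B"
        using s assms by (intro image_eqI[of _ _ "s / k"]) (auto simp: field_simps)
    qed
    show "?B \<subseteq> ?A" using assms by (auto simp: field_simps)
  qed
  then have "limit_passage Y2 c v \<omega> =
      (INF r\<in>{r. 0 < r \<and> c * (sqrt (Y2 (k * r) \<omega>) / r) < v * k}. ennreal k * ennreal r)"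
    unfolding limit_passage_def using assms by (auto simp: image_comp ennreal_mult intro!: INF_cong)
  then show ?thesis
    unfolding limit_passage_def using INF_ennreal_mult_left[OF assms] by metis
qed

lemma limit_passage_antimono: "u \<le> v \<Longrightarrow> limit_passage Y2 c v \<omega> \<le> limit_passage Y2 c u \<omega>"
  unfolding limit_passage_def by (rule INF_superset_mono) auto

lemma snd_component_measurable:
  fixes s :: real
  assumes "0 < s"
  shows "(\<lambda>w. snd (w s)) \<in> borel_measurable (Pi\<^sub>M {0..} (\<lambda>_. borel :: (real \<times> real) measure))"
proof (rule measurable_compose[where f="\<lambda>w. w s" and g=snd])
  show "(\<lambda>w. w s) \<in> Pi\<^sub>M {0..} (\<lambda>_. borel :: (real \<times> real) measure) \<rightarrow>\<^sub>M borel"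
    using assms by (intro measurable_component_singleton) auto
  show "(snd :: real \<times> real \<Rightarrow> real) \<in> borel_measurable borel"
    by (intro borel_measurable_continuous_onI continuous_intros)
qed

context stopping_limit
begin

text \<open>Self-similarity is an identity of laws on the product \<sigma>-algebra, so
  \<open>\<Phi>\<close> has to be written as a measurable functional there; the restriction to
  rational times achieves this.\<close>

definition rat_passage :: "real \<Rightarrow> (real \<Rightarrow> real \<times> real) \<Rightarrow> ennreal" where
  "rat_passage v w = (INF s\<in>{s\<in>\<rat>. 0 < s}. if c * (sqrt (snd (w s)) / s) < v then ennreal s else top)"

lemma rat_passage_measurable [measurable]: "rat_passage v \<in> borel_measurable (Pi\<^sub>M {0..} (\<lambda>_. borel))"
proof -
  show ?thesis
    unfolding rat_passage_def[abs_def]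
  proof (intro borel_measurable_INF countable_pos_rats)
    fix s :: real assume "s \<in> {s\<in>\<rat>. 0 < s}"
    then have "0 < s" by simp
    then show "(\<lambda>w. if c * (sqrt (snd (w s)) / s) < v then ennreal s else top) \<in>
        borel_measurable (Pi\<^sub>M {0..} (\<lambda>_. borel :: (real \<times> real) measure))"
      by (intro measurable_compose[OF snd_component_measurable, where g="\<lambda>y. if c * (sqrt y / s) < v then ennreal s else top"])
        measurable
  qed
qed

lemma path_measurable:
  assumes "0 < k"
  shows "(\<lambda>\<omega>. \<lambda>t\<in>{0..}. (p * Y1 (k * t) \<omega>, q * Y2 (k * t) \<omega>)) \<in> N \<rightarrow>\<^sub>M Pi\<^sub>M {0..} (\<lambda>_. borel :: (real \<times> real) measure)"
proof (rule measurable_restrict)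
  fix t :: real assume "t \<in> {0..}"
  then have [measurable]: "Y1 (k * t) \<in> borel_measurable N" "Y2 (k * t) \<in> borel_measurable N"
    using Y1_cadlag Y2_cadlag assms by (auto simp: cadlag_process_def)
  show "(\<lambda>\<omega>. (p * Y1 (k * t) \<omega>, q * Y2 (k * t) \<omega>)) \<in> borel_measurable N"
    by (intro borel_measurable_Pair) measurable
qed

lemma self_similar_distr:
  assumes "0 < k" and f: "f \<in> Pi\<^sub>M {0..} (\<lambda>_. borel) \<rightarrow>\<^sub>M borel"
  shows "distr N borel (\<lambda>\<omega>. f (\<lambda>t\<in>{0..}. (Y1 (k * t) \<omega>, Y2 (k * t) \<omega>))) =
    distr N borel (\<lambda>\<omega>. f (\<lambda>t\<in>{0..}. (k powr h * Y1 t \<omega>, k powr (2 * h) * Y2 t \<omega>)))"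
proof -
  let ?P = "Pi\<^sub>M {0..} (\<lambda>_. borel :: (real \<times> real) measure)"
  have 1: "(\<lambda>\<omega>. \<lambda>t\<in>{0..}. (Y1 (k * t) \<omega>, Y2 (k * t) \<omega>)) \<in> N \<rightarrow>\<^sub>M ?P"
    using path_measurable[OF assms(1), of 1 1] by simp
  have 2: "(\<lambda>\<omega>. \<lambda>t\<in>{0..}. (k powr h * Y1 t \<omega>, k powr (2 * h) * Y2 t \<omega>)) \<in> N \<rightarrow>\<^sub>M ?P"
    using path_measurable[OF zero_less_one, of "k powr h" "k powr (2 * h)"] by (simp only: mult_1)
  show ?thesis
    using arg_cong[OF self_similar[OF assms(1)], of "\<lambda>Q. distr Q borel f"]
    unfolding distr_distr[OF f 1] distr_distr[OF f 2] comp_def .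
qed

text \<open>Running time at rate k multiplies the level by k, by
  \<open>limit_passage_rescale\<close>, and self-similarity multiplies the path by k powr h. The net
  factor k powr (1 - h) has to equal 1 / b, which determines k.\<close>

lemma \<Phi>_scaling:
  assumes "0 < t" "0 < b"
  shows "distr N borel (\<Phi> (b * t)) = distr N borel (\<lambda>\<omega>. ennreal (b powr (1 / (h - 1))) * \<Phi> t \<omega>)"
proof -
  define k where "k = b powr (1 / (h - 1))"
  define v where "v = b * t * k"
  have k: "0 < k" using assms by (simp add: k_def)
  have kb: "k powr h * t = v"
  proof -
    have "1 / (h - 1) * (1 - h) = -1" using h_range by (simp add: field_simps)
    then have "k powr (1 - h) = b powr (-1)" by (simp add: k_def powr_powr)
    then have "k powr (1 - h) * b = 1" using assms by (simp add: powr_minus_divide)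
    moreover have "k = k powr (1 - h) * k powr h" using k by (simp add: powr_add[symmetric])
    ultimately show ?thesis unfolding v_def by (metis mult.assoc mult.commute mult.left_neutral)
  qed
  have lhs: "\<Phi> (b * t) \<omega> = ennreal k * rat_passage v (\<lambda>t\<in>{0..}. (Y1 (k * t) \<omega>, Y2 (k * t) \<omega>))"
    if \<omega>: "\<omega> \<in> space N" for \<omega>
  proof -
    have "((\<lambda>s. sqrt (Y2 (k * s) \<omega>)) \<longlongrightarrow> sqrt (Y2 (k * s) \<omega>)) (at_right s)" if "0 < s" for s
      using k that by (intro filterlim_compose[OF cadlag_on_at_right[OF cadlag_sqrt_Y2[OF \<omega>]]]
          filterlim_times_pos[OF filterlim_ident]) auto
    then have "limit_passage (\<lambda>s. Y2 (k * s)) c v \<omega> =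
        (INF s\<in>{s\<in>\<rat>. 0 < s}. if c * (sqrt (Y2 (k * s) \<omega>) / s) < v then ennreal s else top)"
      by (rule limit_passage_eq_rat)
    also have "\<dots> = rat_passage v (\<lambda>t\<in>{0..}. (Y1 (k * t) \<omega>, Y2 (k * t) \<omega>))"
      unfolding rat_passage_def by (intro INF_cong) auto
    finally show ?thesis using limit_passage_rescale[OF k, of Y2 c "b * t" \<omega>] by (simp add: v_def)
  qed
  have rhs: "\<Phi> t \<omega> = rat_passage v (\<lambda>t\<in>{0..}. (k powr h * Y1 t \<omega>, k powr (2 * h) * Y2 t \<omega>))"
    if \<omega>: "\<omega> \<in> space N" for \<omega>
  proof -
    have "sqrt (k powr (2 * h)) = k powr h"
      using powr_half_sqrt_powr[of k "2 * h"] k by simp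
    then have sq: "sqrt (k powr (2 * h) * y) = k powr h * sqrt y" for y by (simp add: real_sqrt_mult)
    have "c * (k powr h * z / s) < v \<longleftrightarrow> c * (z / s) < t" for z s
    proof -
      have "c * (k powr h * z / s) = k powr h * (c * (z / s))" by simp
      moreover have "0 < k powr h" using k by simp
      ultimately show ?thesis unfolding kb[symmetric] by (simp only: mult_less_cancel_left_pos)
    qed
    then show ?thesis
      unfolding \<Phi>_eq_rat[OF \<omega>] rat_passage_def by (intro INF_cong) (auto simp: sq)
  qed
  have "distr N borel (\<Phi> (b * t)) =
      distr N borel (\<lambda>\<omega>. ennreal k * rat_passage v (\<lambda>t\<in>{0..}. (Y1 (k * t) \<omega>, Y2 (k * t) \<omega>)))"
    by (intro distr_cong lhs) auto
  also have "\<dots> = distr N borel (\<lambda>\<omega>. ennreal k * rat_passage v (\<lambda>t\<in>{0..}. (k powr h * Y1 t \<omega>, k powr (2 * h) * Y2 t \<omega>)))"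
    by (rule self_similar_distr[OF k, where f="\<lambda>w. ennreal k * rat_passage v w"]) measurable
  also have "\<dots> = distr N borel (\<lambda>\<omega>. ennreal k * \<Phi> t \<omega>)"
    by (intro distr_cong) (auto simp: rhs)
  finally show ?thesis by (simp add: k_def)
qed

lemma Y2_marginal:
  assumes "0 < k"
  shows "measure N {\<omega> \<in> space N. y \<le> Y2 k \<omega>} = measure N {\<omega> \<in> space N. y \<le> k powr (2 * h) * Y2 1 \<omega>}"
proof -
  have [measurable]: "Y2 k \<in> borel_measurable N" "Y2 1 \<in> borel_measurable N"
    using Y2_cadlag assms by (auto simp: cadlag_process_def)
  have "distr N borel (Y2 k) = distr N borel (\<lambda>\<omega>. k powr (2 * h) * Y2 1 \<omega>)"
    using self_similar_distr[OF assms snd_component_measurable[of 1]] by simp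
  then have "measure (distr N borel (Y2 k)) {y..} = measure (distr N borel (\<lambda>\<omega>. k powr (2 * h) * Y2 1 \<omega>)) {y..}"
    by simp
  then show ?thesis by (simp add: measure_distr vimage_def Int_def conj_commute)
qed

text \<open>An infinite passage time forces sqrt (Y2 s) to be at least t * s / c for every positive
  s. By self-similarity, the probability of this at time s is that of Y2 1 reaching a fixed positive
  multiple of s powr (2 - 2 * h), which tends to zero because h < 1.\<close>

lemma \<Phi>_finite:
  assumes t: "0 < t"
  shows "AE \<omega> in N. \<Phi> t \<omega> < \<infinity>"
proof -
  have [measurable]: "Y2 1 \<in> borel_measurable N" "Y2 (real (Suc n)) \<in> borel_measurable N" for n
    using Y2_cadlag by (auto simp: cadlag_process_def)
  define A where "A n = {\<omega> \<in> space N. (t / c)\<^sup>2 * real (Suc n) powr (2 - 2 * h) \<le> Y2 1 \<omega>}" for n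
  have [measurable]: "A n \<in> sets N" for n unfolding A_def by measurable
  have le: "measure N {\<omega> \<in> space N. \<Phi> t \<omega> = \<infinity>} \<le> measure N (A n)" for n
  proof -
    define s where "s = real (Suc n)"
    have s: "0 < s" by (simp add: s_def)
    have [measurable]: "Y2 s \<in> borel_measurable N" unfolding s_def by measurable
    have eq: "(t * s / c)\<^sup>2 \<le> s powr (2 * h) * y \<longleftrightarrow> (t / c)\<^sup>2 * s powr (2 - 2 * h) \<le> y" for y
    proof -
      have "s powr 2 = s\<^sup>2" using s by (simp add: powr_numeral)
      then have "(t * s / c)\<^sup>2 = s powr (2 * h) * ((t / c)\<^sup>2 * s powr (2 - 2 * h))"
        using s by (simp add: powr_diff power_mult_distrib power_divide)
      then show ?thesis using s by simp
    qed
    have "{\<omega> \<in> space N. \<Phi> t \<omega> = \<infinity>} \<subseteq> {\<omega> \<in> space N. (t * s / c)\<^sup>2 \<le> Y2 s \<omega>}"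
    proof
      fix \<omega> assume "\<omega> \<in> {\<omega> \<in> space N. \<Phi> t \<omega> = \<infinity>}"
      then have \<omega>: "\<omega> \<in> space N" "\<Phi> t \<omega> = \<infinity>" by auto
      have "\<Phi> t \<omega> \<le> ennreal s" if "c * (sqrt (Y2 s \<omega>) / s) < t"
        unfolding limit_passage_def using that s by (intro INF_lower) simp
      then have "t \<le> c * (sqrt (Y2 s \<omega>) / s)" using \<omega>(2) by (force simp: top_unique not_less[symmetric])
      then have "t * s / c \<le> sqrt (Y2 s \<omega>)" using c s by (simp add: field_simps)
      then have "(t * s / c)\<^sup>2 \<le> (sqrt (Y2 s \<omega>))\<^sup>2" using t s c by (intro power_mono) auto
      then show "\<omega> \<in> {\<omega> \<in> space N. (t * s / c)\<^sup>2 \<le> Y2 s \<omega>}" using Y2_nonneg[OF \<omega>(1), of s] s \<omega> by simp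
    qed
    then have "measure N {\<omega> \<in> space N. \<Phi> t \<omega> = \<infinity>} \<le> measure N {\<omega> \<in> space N. (t * s / c)\<^sup>2 \<le> Y2 s \<omega>}"
      by (intro N.finite_measure_mono) auto
    also have "\<dots> = measure N {\<omega> \<in> space N. (t * s / c)\<^sup>2 \<le> s powr (2 * h) * Y2 1 \<omega>}"
      by (rule Y2_marginal[OF s])
    also have "\<dots> = measure N (A n)" unfolding A_def s_def[symmetric] eq ..
    finally show ?thesis .
  qed
  have "(\<lambda>n. measure N (A n)) \<longlonglongrightarrow> measure N (\<Inter>n. A n)"
  proof (rule N.finite_Lim_measure_decseq)
    show "decseq A"
    proof (rule decseq_SucI)
      fix n
      have "(t / c)\<^sup>2 * real (Suc n) powr (2 - 2 * h) \<le> (t / c)\<^sup>2 * real (Suc (Suc n)) powr (2 - 2 * h)"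
        using h_range by (intro mult_left_mono powr_mono2) auto
      then show "A (Suc n) \<subseteq> A n" by (auto simp: A_def simp del: of_nat_Suc)
    qed
  qed auto
  moreover have "(\<Inter>n. A n) = {}"
  proof (rule ccontr)
    assume "(\<Inter>n. A n) \<noteq> {}"
    then obtain \<omega> where "\<And>n. \<omega> \<in> A n" by blast
    then have le: "(t / c)\<^sup>2 * real (Suc n) powr (2 - 2 * h) \<le> Y2 1 \<omega>" for n by (simp add: A_def)
    have "(t / c)\<^sup>2 \<le> Y2 1 \<omega> * real (Suc n) powr (2 * h - 2)" for n
    proof -
      have "real (Suc n) powr (2 - 2 * h) * real (Suc n) powr (2 * h - 2) = 1"
        by (simp add: powr_add[symmetric] del: of_nat_Suc)
      then have "(t / c)\<^sup>2 = (t / c)\<^sup>2 * real (Suc n) powr (2 - 2 * h) * real (Suc n) powr (2 * h - 2)"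
        by (simp only: mult.assoc mult_1_right)
      also have "\<dots> \<le> Y2 1 \<omega> * real (Suc n) powr (2 * h - 2)"
        by (intro mult_right_mono le) simp
      finally show ?thesis .
    qed
    moreover have "(\<lambda>n. Y2 1 \<omega> * real (Suc n) powr (2 * h - 2)) \<longlonglongrightarrow> Y2 1 \<omega> * 0"
      using h_range by (intro tendsto_mult_left tendsto_neg_powr filterlim_compose[OF filterlim_real_sequentially filterlim_Suc]) auto
    ultimately have "(t / c)\<^sup>2 \<le> 0" using LIMSEQ_le_const by fastforce
    then show False using t c by simp
  qed
  ultimately have "(\<lambda>n. measure N (A n)) \<longlonglongrightarrow> 0" by simp
  then have "measure N {\<omega> \<in> space N. \<Phi> t \<omega> = \<infinity>} \<le> 0"
    by (rule LIMSEQ_le_const) (use le in auto)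
  then have "measure N {\<omega> \<in> space N. \<Phi> t \<omega> = \<infinity>} = 0" by (simp add: measure_le_0_iff)
  then have "AE \<omega> in N. \<not> \<Phi> t \<omega> = \<infinity>"
    by (subst (asm) N.prob_Collect_eq_0) auto
  then show ?thesis by eventually_elim (simp add: less_top)
qed

end

section \<open>Sample paths of both processes and their coding by comparisons\<close>

definition nonneg_mono_paths :: "(real \<Rightarrow> real) set" where
  "nonneg_mono_paths = {x \<in> mono_paths. \<forall>u>0. 0 \<le> x u}"

lemma nonneg_mono_paths_enn2real:
  fixes F :: "real \<Rightarrow> ennreal"
  assumes "0 < k" and mono: "\<And>u v. 0 < u \<Longrightarrow> u \<le> v \<Longrightarrow> F u \<le> F v" and fin: "\<And>u. 0 < u \<Longrightarrow> F u < \<infinity>"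
    and rc: "\<And>u s. 0 < u \<Longrightarrow> F u < s \<Longrightarrow> \<forall>\<^sub>F v in at_right u. F v < s"
  shows "(\<lambda>u\<in>{0<..}. enn2real (F u) / k) \<in> nonneg_mono_paths"
proof -
  have "((\<lambda>u\<in>{0<..}. enn2real (F u) / k) \<longlongrightarrow> enn2real (F u) / k) (at_right u)" if u: "0 < u" for u
  proof -
    have right: "\<forall>\<^sub>F v in at_right u. u < v" by (rule eventually_at_right_less)
    have "(F \<longlongrightarrow> F u) (at_right u)"
    proof (rule order_tendstoI)
      fix y assume "y < F u"
      then show "\<forall>\<^sub>F v in at_right u. y < F v"
        using right mono[OF u] by (auto elim!: eventually_mono intro: less_le_trans)
    qed (rule rc[OF u])
    then have "((\<lambda>v. enn2real (F v)) \<longlongrightarrow> enn2real (F u)) (at_right u)"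
      using fin[OF u] by (intro tendsto_enn2real) (auto simp: less_top)
    then have "((\<lambda>v. enn2real (F v) / k) \<longlongrightarrow> enn2real (F u) / k) (at_right u)"
      using \<open>0 < k\<close> by (intro tendsto_divide tendsto_const) auto
    moreover have "\<forall>\<^sub>F v in at_right u. enn2real (F v) / k = (\<lambda>u\<in>{0<..}. enn2real (F u) / k) v"
      using right by eventually_elim (use u in simp)
    ultimately show ?thesis by (rule Lim_transform_eventually)
  qed
  moreover have "mono_on {0<..} (\<lambda>u\<in>{0<..}. enn2real (F u) / k)"
    using \<open>0 < k\<close> fin by (intro mono_onI) (auto intro!: divide_right_mono enn2real_mono mono simp: less_top)
  ultimately show ?thesis
    using \<open>0 < k\<close> by (auto simp: nonneg_mono_paths_def mono_paths_def)
qed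

text \<open>The bits at a fixed time u in \<open>U\<close> compare the value with all levels in
  \<open>D\<close>, so agreement of more and more bits forces pointwise convergence on
  \<open>U\<close>, and monotonicity upgrades this to M1. Levels below 0 are handled by
  nonnegativity, since \<open>D\<close> is assumed dense only in the nonnegative half-line.\<close>

lemma nonneg_mono_paths_bits_converge:
  assumes x: "x \<in> nonneg_mono_paths" and y: "\<And>k. y k \<in> nonneg_mono_paths"
    and U: "\<And>u. u \<in> U \<Longrightarrow> 0 < u" "\<And>s t. 0 < s \<Longrightarrow> s < t \<Longrightarrow> \<exists>u\<in>U. s < u \<and> u < t"
    and D: "\<And>s t. 0 \<le> s \<Longrightarrow> s < t \<Longrightarrow> \<exists>r\<in>D. s < r \<and> r < t"
    and p: "range p = U \<times> D"
    and bits: "\<And>k j. j < k \<Longrightarrow> (snd (p j) < y k (fst (p j))) = (snd (p j) < x (fst (p j)))"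
  shows "converges_locally M1_dist y x"
proof (rule mono_paths_converges_locally[where D=U])
  show "x \<in> mono_paths" "\<And>k. y k \<in> mono_paths" using x y by (auto simp: nonneg_mono_paths_def)
  show "\<And>s t. 0 < s \<Longrightarrow> s < t \<Longrightarrow> \<exists>u\<in>U. s < u \<and> u < t" by (rule U(2))
  fix u assume u: "u \<in> U"
  have bit: "\<forall>\<^sub>F k in sequentially. (s < y k u) = (s < x u)" if "s \<in> D" for s
  proof -
    have "(u, s) \<in> range p" using p u that by simp
    then obtain j where j: "(u, s) = p j" by (rule rangeE)
    show ?thesis
      using eventually_gt_at_top[of j] by eventually_elim (use bits[of j] in \<open>simp add: j[symmetric]\<close>)
  qed
  have nn: "0 \<le> x u" "0 \<le> y k u" for k using x y U(1)[OF u] by (auto simp: nonneg_mono_paths_def)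
  show "(\<lambda>k. y k u) \<longlonglongrightarrow> x u"
  proof (rule order_tendstoI)
    fix l assume "l < x u"
    show "\<forall>\<^sub>F k in sequentially. l < y k u"
    proof (cases "l < 0")
      case True
      then show ?thesis using nn(2) by (intro always_eventually allI) (rule less_le_trans)
    next
      case False
      then obtain s where s: "s \<in> D" "l < s" "s < x u" using D[of l "x u"] \<open>l < x u\<close> by auto
      from bit[OF s(1)] show ?thesis by eventually_elim (use s in auto)
    qed
  next
    fix l assume "x u < l"
    then obtain s where s: "s \<in> D" "x u < s" "s < l" using D[OF nn(1)] by auto
    from bit[OF s(1)] show "\<forall>\<^sub>F k in sequentially. y k u < l" by eventually_elim (use s in auto)
  qed
qed

context stopping_limit
begin

lemma T_antimono: "0 < \<epsilon> \<Longrightarrow> \<epsilon> \<le> \<epsilon>' \<Longrightarrow> T \<epsilon>' \<omega> \<le> T \<epsilon> \<omega>"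
  unfolding stopping_rule_def
proof (rule INF_superset_mono)
  assume \<epsilon>: "0 < \<epsilon>" "\<epsilon> \<le> \<epsilon>'"
  have "\<epsilon>' powr (-\<nu>) \<le> \<epsilon> powr (-\<nu>)" using \<epsilon> \<nu> by (intro powr_mono2') auto
  then show "{n::nat. \<epsilon> powr (-\<nu>) < real n \<and> c * sqrt (Z2 (real n) \<omega> / (real n)\<^sup>2) < \<epsilon>}
      \<subseteq> {n. \<epsilon>' powr (-\<nu>) < real n \<and> c * sqrt (Z2 (real n) \<omega> / (real n)\<^sup>2) < \<epsilon>'}"
    using \<epsilon> by auto
qed simp

lemma T_less_iff: "T \<epsilon> \<omega> < s \<longleftrightarrow>
    (\<exists>n::nat. \<epsilon> powr (-\<nu>) < real n \<and> c * sqrt (Z2 (real n) \<omega> / (real n)\<^sup>2) < \<epsilon> \<and> of_nat n < s)"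
  unfolding stopping_rule_def by (auto simp: INF_less_iff)

text \<open>Both conditions on an admissible index are strict inequalities, so an index that is
  admissible at \<epsilon> / u remains so at \<epsilon> / v for v slightly above u.\<close>

lemma T_right_continuous:
  assumes "0 < \<epsilon>" "0 < u" "T (\<epsilon> / u) \<omega> < s"
  shows "\<forall>\<^sub>F v in at_right u. T (\<epsilon> / v) \<omega> < s"
proof -
  obtain n where n: "(\<epsilon> / u) powr (-\<nu>) < real n" "c * sqrt (Z2 (real n) \<omega> / (real n)\<^sup>2) < \<epsilon> / u" "of_nat n < s"
    using assms(3) unfolding T_less_iff by blast
  have t: "((\<lambda>v. \<epsilon> / v) \<longlongrightarrow> \<epsilon> / u) (at_right u)"
    using assms(2) by (intro tendsto_divide tendsto_const tendsto_ident_at) auto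
  then have "((\<lambda>v. (\<epsilon> / v) powr (-\<nu>)) \<longlongrightarrow> (\<epsilon> / u) powr (-\<nu>)) (at_right u)"
    using assms by (intro tendsto_powr tendsto_const) auto
  from order_tendstoD(2)[OF this n(1)] order_tendstoD(1)[OF t n(2)]
  show ?thesis by eventually_elim (use n(3) T_less_iff in blast)
qed

text \<open>The almost sure convergence of Z2 t / t^2 to zero lets every positive level be undercut
  at some index beyond the cut-off, simultaneously for all \<epsilon>.\<close>

lemma T_finite: "AE \<omega> in M. \<forall>\<epsilon>>0. T \<epsilon> \<omega> < \<infinity>"
  using Z2_lln
proof eventually_elim
  case (elim \<omega>)
  have "((\<lambda>n. Z2 (real n) \<omega> / (real n)\<^sup>2) \<longlongrightarrow> 0) sequentially"
    by (rule filterlim_compose[OF elim filterlim_real_sequentially])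
  then have "((\<lambda>n. c * sqrt (Z2 (real n) \<omega> / (real n)\<^sup>2)) \<longlongrightarrow> c * sqrt 0) sequentially"
    by (intro tendsto_mult_left tendsto_real_sqrt)
  then have lim: "((\<lambda>n. c * sqrt (Z2 (real n) \<omega> / (real n)\<^sup>2)) \<longlongrightarrow> 0) sequentially" by simp
  show ?case
  proof (intro allI impI)
    fix \<epsilon> :: real assume "0 < \<epsilon>"
    have "\<forall>\<^sub>F n in sequentially. \<epsilon> powr (-\<nu>) < real n"
      using filterlim_real_sequentially by (simp add: filterlim_at_top_dense)
    with order_tendstoD(2)[OF lim \<open>0 < \<epsilon>\<close>]
    have "\<forall>\<^sub>F n in sequentially. \<epsilon> powr (-\<nu>) < real n \<and> c * sqrt (Z2 (real n) \<omega> / (real n)\<^sup>2) < \<epsilon>"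
      by eventually_elim simp
    then obtain n :: nat where "\<epsilon> powr (-\<nu>) < real n \<and> c * sqrt (Z2 (real n) \<omega> / (real n)\<^sup>2) < \<epsilon>"
      using eventually_happens' sequentially_bot by blast
    moreover have "(of_nat n :: ennreal) < \<infinity>" by (simp add: of_nat_less_top)
    ultimately show "T \<epsilon> \<omega> < \<infinity>" unfolding T_less_iff by blast
  qed
qed

lemma T_path: "0 < \<epsilon> \<Longrightarrow> 0 < k \<Longrightarrow> AE \<omega> in M. (\<lambda>u\<in>{0<..}. enn2real (T (\<epsilon> / u) \<omega>) / k) \<in> nonneg_mono_paths"
  using T_finite
proof eventually_elim
  case (elim \<omega>)
  show ?case
  proof (rule nonneg_mono_paths_enn2real)
    show "T (\<epsilon> / u) \<omega> \<le> T (\<epsilon> / v) \<omega>" if "0 < u" "u \<le> v" for u v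
      using that elim by (intro T_antimono) (auto intro: divide_left_mono)
  qed (use elim T_right_continuous in auto)
qed

text \<open>Monotonicity in the level reduces uncountably many null sets to countably many.\<close>

lemma \<Phi>_finite_all: "AE \<omega> in N. \<forall>u>0. \<Phi> u \<omega> < \<infinity>"
proof -
  have "AE \<omega> in N. \<forall>n. \<Phi> (1 / real (Suc n)) \<omega> < \<infinity>"
    unfolding AE_all_countable by (intro allI \<Phi>_finite) simp
  then show ?thesis
  proof eventually_elim
    case (elim \<omega>)
    show ?case
    proof (intro allI impI)
      fix u :: real assume "0 < u"
      then obtain n where "1 / real (Suc n) < u" using nat_approx_posE by metis
      then have "\<Phi> u \<omega> \<le> \<Phi> (1 / real (Suc n)) \<omega>" by (intro limit_passage_antimono) simp
      then show "\<Phi> u \<omega> < \<infinity>" using elim by (meson le_less_trans)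
    qed
  qed
qed

lemma \<Phi>_right_continuous:
  assumes "0 < u" "\<Phi> (1 / u) \<omega> < s"
  shows "\<forall>\<^sub>F v in at_right u. \<Phi> (1 / v) \<omega> < s"
proof -
  obtain r where r: "0 < r" "c * (sqrt (Y2 r \<omega>) / r) < 1 / u" "ennreal r < s"
    using assms(2) by (auto simp: limit_passage_def INF_less_iff)
  have "((\<lambda>v. 1 / v) \<longlongrightarrow> 1 / u) (at_right u)"
    using assms(1) by (intro tendsto_divide tendsto_const tendsto_ident_at) auto
  from order_tendstoD(1)[OF this r(2)]
  show ?thesis
    by eventually_elim (use r in \<open>auto simp: limit_passage_def INF_less_iff\<close>)
qed

lemma \<Phi>_path: "AE \<omega> in N. (\<lambda>u\<in>{0<..}. enn2real (\<Phi> (1 / u) \<omega>)) \<in> nonneg_mono_paths"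
  using \<Phi>_finite_all
proof eventually_elim
  case (elim \<omega>)
  have "(\<lambda>u\<in>{0<..}. enn2real (\<Phi> (1 / u) \<omega>) / 1) \<in> nonneg_mono_paths"
  proof (rule nonneg_mono_paths_enn2real)
    show "\<Phi> (1 / u) \<omega> \<le> \<Phi> (1 / v) \<omega>" if "0 < u" "u \<le> v" for u v
      using that by (intro limit_passage_antimono) (auto intro: divide_left_mono)
  qed (use elim \<Phi>_right_continuous in auto)
  then show ?case by simp
qed

section \<open>Vanishing perturbations and fixed jumps of the limit process\<close>

definition \<tau> :: "nat \<Rightarrow> real" where "\<tau> k = 1 / real (k + 2)"

lemma \<tau>: "0 < \<tau> k" "\<tau> k < 1" "j \<le> k \<Longrightarrow> \<tau> k \<le> \<tau> j" "\<tau> \<longlonglongrightarrow> 0"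
proof -
  show "0 < \<tau> k" "\<tau> k < 1" "j \<le> k \<Longrightarrow> \<tau> k \<le> \<tau> j" by (auto simp: \<tau>_def field_simps)
  show "\<tau> \<longlonglongrightarrow> 0" unfolding \<tau>_def[abs_def]
    by (rule LIMSEQ_ignore_initial_segment[OF lim_1_over_n])
qed

lemma \<Phi>_perturb_mono:
  assumes "0 < u" "j \<le> k" "ennreal (s + \<tau> j) < \<Phi> (1 / ((1 - \<tau> j) * u)) \<omega>"
  shows "ennreal (s + \<tau> k) < \<Phi> (1 / ((1 - \<tau> k) * u)) \<omega>"
proof -
  have "ennreal (s + \<tau> k) \<le> ennreal (s + \<tau> j)" using \<tau>(3)[OF assms(2)] by (intro ennreal_leI) simp
  also note assms(3)
  also have "\<Phi> (1 / ((1 - \<tau> j) * u)) \<omega> \<le> \<Phi> (1 / ((1 - \<tau> k) * u)) \<omega>"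
    using \<tau>(2)[of j] \<tau>(2)[of k] \<tau>(3)[OF assms(2)] assms(1)
    by (intro limit_passage_antimono divide_left_mono mult_right_mono mult_pos_pos) auto
  finally show ?thesis .
qed

text \<open>Almost sure continuity of \<open>u \<mapsto> \<Phi> (1 / u)\<close> at every fixed \<open>u\<close>: by monotonicity the left limit is at
  most the value, and by the scaling relation both have the same distribution.\<close>

lemma \<Phi>_left_continuous:
  assumes "0 < u" "0 < s"
  shows "AE \<omega> in N. ennreal s < \<Phi> (1 / u) \<omega> \<longrightarrow> (\<exists>k. ennreal (s + \<tau> k) < \<Phi> (1 / ((1 - \<tau> k) * u)) \<omega>)"
proof -
  define m where "m k = (1 - \<tau> k) powr (1 / (1 - h))" for k
  define A where "A k = {\<omega> \<in> space N. ennreal (s + \<tau> k) < \<Phi> (1 / ((1 - \<tau> k) * u)) \<omega>}" for k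
  \<comment> \<open>\<open>A' k\<close> has the same probability as \<open>A k\<close> by scaling,
    but it involves the single variable \<open>\<Phi> (1 / u)\<close>, so the union can be
    identified with \<open>G\<close> pointwise because m k tends to 1.\<close>
  define A' where "A' k = {\<omega> \<in> space N. ennreal (s + \<tau> k) < ennreal (m k) * \<Phi> (1 / u) \<omega>}" for k
  define G where "G = {\<omega> \<in> space N. ennreal s < \<Phi> (1 / u) \<omega>}"
  have [measurable]: "A k \<in> sets N" "A' k \<in> sets N" "G \<in> sets N" for k
    unfolding A_def A'_def G_def by measurable
  have m: "0 < m k" "m k \<le> 1" for k
    using \<tau>(1,2)[of k] h_range by (auto simp: m_def intro: powr_le1)
  have m_mono: "m j \<le> m k" if "j \<le> k" for j k
    unfolding m_def using \<tau>(2)[of j] \<tau>(3)[OF that] h_range by (intro powr_mono2) auto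
  have m_lim: "m \<longlonglongrightarrow> 1"
  proof -
    have "(\<lambda>k. (1 - \<tau> k) powr (1 / (1 - h))) \<longlonglongrightarrow> (1 - 0) powr (1 / (1 - h))"
      by (intro tendsto_powr tendsto_diff tendsto_const \<tau>(4)) auto
    then show ?thesis by (simp add: m_def[abs_def])
  qed
  have eq: "measure N (A k) = measure N (A' k)" for k
  proof -
    define b where "b = 1 / (1 - \<tau> k)"
    have b: "0 < b" using \<tau>(2)[of k] by (simp add: b_def)
    have "b powr (1 / (h - 1)) = m k"
    proof -
      have "1 / (h - 1) = - (1 / (1 - h))" using h_range by (simp add: field_simps)
      then show ?thesis using \<tau>(2)[of k] by (simp add: b_def m_def powr_divide powr_minus_divide)
    qed
    then have "distr N borel (\<Phi> (b * (1 / u))) = distr N borel (\<lambda>\<omega>. ennreal (m k) * \<Phi> (1 / u) \<omega>)"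
      using \<Phi>_scaling[of "1 / u" b] b assms(1) by simp
    then have "measure (distr N borel (\<Phi> (b * (1 / u)))) {ennreal (s + \<tau> k)<..} =
        measure (distr N borel (\<lambda>\<omega>. ennreal (m k) * \<Phi> (1 / u) \<omega>)) {ennreal (s + \<tau> k)<..}" by simp
    moreover have "b * (1 / u) = 1 / ((1 - \<tau> k) * u)" by (simp add: b_def)
    ultimately show ?thesis
      by (simp add: measure_distr A_def A'_def vimage_def Int_def conj_commute)
  qed
  have "incseq A" unfolding incseq_def A_def using \<Phi>_perturb_mono[OF assms(1)] by blast
  then have "(\<lambda>k. measure N (A k)) \<longlonglongrightarrow> measure N (\<Union>k. A k)"
    by (intro N.finite_Lim_measure_incseq) auto
  moreover have "(\<lambda>k. measure N (A' k)) \<longlonglongrightarrow> measure N (\<Union>k. A' k)"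
  proof (intro N.finite_Lim_measure_incseq)
    show "incseq A'"
      unfolding incseq_def
    proof (intro allI impI subsetI)
      fix j k \<omega> assume jk: "j \<le> k" and "\<omega> \<in> A' j"
      then have \<omega>: "\<omega> \<in> space N" "ennreal (s + \<tau> j) < ennreal (m j) * \<Phi> (1 / u) \<omega>" by (auto simp: A'_def)
      have "ennreal (s + \<tau> k) \<le> ennreal (s + \<tau> j)" using \<tau>(3)[OF jk] by (intro ennreal_leI) simp
      also note \<omega>(2)
      also have "ennreal (m j) * \<Phi> (1 / u) \<omega> \<le> ennreal (m k) * \<Phi> (1 / u) \<omega>"
        using m_mono[OF jk] by (intro mult_right_mono ennreal_leI) auto
      finally show "\<omega> \<in> A' k" using \<omega>(1) by (simp add: A'_def)
    qed
  qed auto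
  moreover have "(\<Union>k. A' k) = G"
  proof
    show "(\<Union>k. A' k) \<subseteq> G"
    proof
      fix \<omega> assume "\<omega> \<in> (\<Union>k. A' k)"
      then obtain k where \<omega>: "\<omega> \<in> space N" "ennreal (s + \<tau> k) < ennreal (m k) * \<Phi> (1 / u) \<omega>" by (auto simp: A'_def)
      have "ennreal s \<le> ennreal (s + \<tau> k)" using \<tau>(1)[of k] by (intro ennreal_leI) simp
      also note \<omega>(2)
      also have "ennreal (m k) * \<Phi> (1 / u) \<omega> \<le> ennreal 1 * \<Phi> (1 / u) \<omega>"
        using m(2)[of k] by (intro mult_right_mono ennreal_leI) auto
      finally show "\<omega> \<in> G" using \<omega>(1) by (simp add: G_def)
    qed
    show "G \<subseteq> (\<Union>k. A' k)"
    proof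
      fix \<omega> assume "\<omega> \<in> G"
      then have \<omega>: "\<omega> \<in> space N" "ennreal s < \<Phi> (1 / u) \<omega>" by (auto simp: G_def)
      have "\<exists>k. ennreal (s + \<tau> k) < ennreal (m k) * \<Phi> (1 / u) \<omega>"
      proof (cases "\<Phi> (1 / u) \<omega>")
        case top
        then show ?thesis using m(1)[of 0] by (auto simp: ennreal_mult_top intro!: exI[of _ 0])
      next
        case (real r)
        then have "s < r" using \<omega>(2) assms(2) by (simp add: ennreal_less_iff)
        have "(\<lambda>k. m k * r - (s + \<tau> k)) \<longlonglongrightarrow> 1 * r - (s + 0)"
          by (intro tendsto_intros m_lim \<tau>(4))
        then have "\<forall>\<^sub>F k in sequentially. 0 < m k * r - (s + \<tau> k)"
          using \<open>s < r\<close> by (intro order_tendstoD(1)) auto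
        then obtain k where "0 < m k * r - (s + \<tau> k)" by (auto simp: eventually_sequentially)
        then have "ennreal (s + \<tau> k) < ennreal (m k * r)"
          using assms(2) \<tau>(1)[of k] by (intro ennreal_lessI) auto
        then show ?thesis using real m(1)[of k] by (auto simp: ennreal_mult)
      qed
      then show "\<omega> \<in> (\<Union>k. A' k)" using \<omega>(1) by (auto simp: A'_def)
    qed
  qed
  ultimately have meas_eq: "measure N (\<Union>k. A k) = measure N G"
    unfolding eq by (metis LIMSEQ_unique)
  have "(\<Union>k. A k) \<subseteq> G"
  proof
    fix \<omega> assume "\<omega> \<in> (\<Union>k. A k)"
    then obtain k where \<omega>: "\<omega> \<in> space N" "ennreal (s + \<tau> k) < \<Phi> (1 / ((1 - \<tau> k) * u)) \<omega>" by (auto simp: A_def)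
    have "ennreal s \<le> ennreal (s + \<tau> k)" using \<tau>(1)[of k] by (intro ennreal_leI) simp
    also note \<omega>(2)
    also have "\<Phi> (1 / ((1 - \<tau> k) * u)) \<omega> \<le> \<Phi> (1 / u) \<omega>"
      using \<tau>(1,2)[of k] assms(1) mult_left_le_one_le[of u "1 - \<tau> k"] by (intro limit_passage_antimono divide_left_mono) auto
    finally show "\<omega> \<in> G" using \<omega>(1) by (simp add: G_def)
  qed
  \<comment> \<open>The union is contained in \<open>G\<close> and has the same probability, so the
    difference is null.\<close>
  then have "measure N (G - (\<Union>k. A k)) = 0"
    using meas_eq by (subst N.finite_measure_Diff) auto
  then have "AE \<omega> in N. \<omega> \<notin> G - (\<Union>k. A k)"
    by (intro AE_not_in) (auto simp: null_sets_def N.emeasure_eq_measure)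
  then show ?thesis
    using AE_space by eventually_elim (auto simp: G_def A_def)
qed

text \<open>The perturbed events increase in k, and \<open>\<Phi>_left_continuous\<close> identifies
  their union with \<open>\<Phi>_gt S\<close> up to a null set; for finitely many pairs the largest
  of the individual k works for all.\<close>

lemma \<Phi>_perturb_tendsto:
  assumes S: "finite S" "S \<subseteq> {0<..} \<times> {0<..}"
  shows "(\<lambda>k. measure N (\<Phi>_gt_perturbed (\<tau> k) S))
    \<longlonglongrightarrow> measure N (\<Phi>_gt S)"
proof -
  define A where "A k = (\<Phi>_gt_perturbed (\<tau> k) S)" for k
  have A_sets: "A k \<in> sets N" for k using S(1) unfolding A_def case_prod_beta by measurable
  have G_sets: "\<Phi>_gt S \<in> sets N"
    using S(1) unfolding case_prod_beta by measurable
  have "incseq A"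
    unfolding incseq_def
  proof (intro allI impI subsetI)
    fix j k \<omega> assume jk: "j \<le> k" and \<omega>: "\<omega> \<in> A j"
    have "ennreal (s + \<tau> k) < \<Phi> (1 / ((1 - \<tau> k) * u)) \<omega>" if us: "(u, s) \<in> S" for u s
      using \<omega> us S(2) by (intro \<Phi>_perturb_mono[OF _ jk]) (auto simp: A_def)
    then show "\<omega> \<in> A k" using \<omega> by (auto simp: A_def)
  qed
  then have "(\<lambda>k. measure N (A k)) \<longlonglongrightarrow> measure N (\<Union>k. A k)"
    using A_sets by (intro N.finite_Lim_measure_incseq) auto
  moreover have "measure N (\<Union>k. A k) = measure N (\<Phi>_gt S)"
  proof (rule N.finite_measure_eq_AE[OF _ _ G_sets])
    have "AE \<omega> in N. \<forall>x\<in>S. ennreal (snd x) < \<Phi> (1 / fst x) \<omega> \<longrightarrow>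
        (\<exists>k. ennreal (snd x + \<tau> k) < \<Phi> (1 / ((1 - \<tau> k) * fst x)) \<omega>)"
      using S by (intro AE_finite_allI \<Phi>_left_continuous) auto
    then show "AE \<omega> in N. \<omega> \<in> (\<Union>k. A k) \<longleftrightarrow> \<omega> \<in> (\<Phi>_gt S)"
      using AE_space
    proof eventually_elim
      case (elim \<omega>)
      show ?case
      proof
        assume "\<omega> \<in> (\<Union>k. A k)"
        then obtain k where k: "\<And>u s. (u, s) \<in> S \<Longrightarrow> ennreal (s + \<tau> k) < \<Phi> (1 / ((1 - \<tau> k) * u)) \<omega>"
          by (auto simp: A_def)
        have "ennreal s < \<Phi> (1 / u) \<omega>" if us: "(u, s) \<in> S" for u s
        proof -
          have "ennreal s \<le> ennreal (s + \<tau> k)" using \<tau>(1)[of k] by (intro ennreal_leI) simp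
          also note k[OF us]
          also have "\<Phi> (1 / ((1 - \<tau> k) * u)) \<omega> \<le> \<Phi> (1 / u) \<omega>"
            using \<tau>(1,2)[of k] us S(2) mult_left_le_one_le[of u "1 - \<tau> k"] by (intro limit_passage_antimono divide_left_mono) auto
          finally show ?thesis .
        qed
        then show "\<omega> \<in> (\<Phi>_gt S)" using elim(2) by auto
      next
        assume "\<omega> \<in> (\<Phi>_gt S)"
        then have "\<forall>x\<in>S. ennreal (snd x) < \<Phi> (1 / fst x) \<omega>" by (simp add: case_prod_beta)
        then have "\<forall>x\<in>S. \<exists>k. ennreal (snd x + \<tau> k) < \<Phi> (1 / ((1 - \<tau> k) * fst x)) \<omega>"
          using elim(1) by blast
        from bchoice[OF this] obtain k where
          k: "\<forall>x\<in>S. ennreal (snd x + \<tau> (k x)) < \<Phi> (1 / ((1 - \<tau> (k x)) * fst x)) \<omega>" by blast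
        have "ennreal (s + \<tau> (Max (k ` S))) < \<Phi> (1 / ((1 - \<tau> (Max (k ` S))) * u)) \<omega>" if us: "(u, s) \<in> S" for u s
        proof (rule \<Phi>_perturb_mono)
          show "0 < u" using us S(2) by auto
          show "k (u, s) \<le> Max (k ` S)" using us S(1) by simp
          show "ennreal (s + \<tau> (k (u, s))) < \<Phi> (1 / ((1 - \<tau> (k (u, s))) * u)) \<omega>"
            using bspec[OF k us] by simp
        qed
        then show "\<omega> \<in> (\<Union>k. A k)" using elim(2) by (auto simp: A_def)
      qed
    qed
  qed (use A_sets in auto)
  ultimately show ?thesis by (simp add: A_def)
qed

end

lemma sets_usual_augmentationI:
  assumes "\<And>s. t < s \<or> s = \<infinity> \<Longrightarrow> A \<in> sigma_sets (space M) (natural_generator M X s \<union> null_sets (completion M))"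
  shows "A \<in> sets (usual_augmentation M X t)"
proof -
  have gen: "natural_generator M X s \<union> null_sets (completion M) \<subseteq> Pow (space M)" for s
    using sets.sets_into_space[of _ "completion M"] by (fastforce simp: natural_generator_def null_sets_def)
  let ?I = "\<Inter>s\<in>{s. t < s \<or> s = \<infinity>}. sigma_sets (space M) (natural_generator M X s \<union> null_sets (completion M))"
  have "?I \<subseteq> sigma_sets (space M) (natural_generator M X \<infinity> \<union> null_sets (completion M))" by blast
  also have "\<dots> \<subseteq> Pow (space M)" using sigma_sets_into_sp[OF gen] by blast
  finally have "sets (usual_augmentation M X t) = sigma_sets (space M) ?I"
    unfolding usual_augmentation_def by (rule sets_measure_of)
  moreover have "A \<in> ?I" using assms by blast
  ultimately show ?thesis by (auto intro: sigma_sets.Basic)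
qed

lemma space_usual_augmentation: "space (usual_augmentation M X t) = space M"
  by (simp add: usual_augmentation_def space_measure_of_conv)

section \<open>Joint convergence of the comparisons and of the processes\<close>

context stopping_limit
begin

text \<open>The atoms of countably many laws form a countable set. Multiplying the positive
  rationals by a generic \<xi> avoids it altogether and keeps the levels countable and
  dense.\<close>

lemma generic_levels:
  "\<exists>D. countable D \<and> (\<forall>s\<in>D. 0 < s) \<and> (\<forall>s t. 0 \<le> s \<and> s < t \<longrightarrow> (\<exists>r\<in>D. s < r \<and> r < t)) \<and>
    (\<forall>s\<in>D. \<forall>u\<in>{u\<in>\<rat>. 0 < u}. AE \<omega> in N. \<Phi> (1 / u) \<omega> \<noteq> ennreal s)"
proof -
  define Q :: "real set" where "Q = {u\<in>\<rat>. 0 < u}"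
  have Q: "countable Q" unfolding Q_def by (rule countable_pos_rats)
  define bad where "bad = (\<Union>u\<in>Q. {s. measure (distr N borel (\<lambda>\<omega>. enn2real (\<Phi> (1 / u) \<omega>))) {s} \<noteq> 0})"
  have "countable {s. measure (distr N borel (\<lambda>\<omega>. enn2real (\<Phi> (1 / u) \<omega>))) {s} \<noteq> 0}" for u
    by (intro finite_measure.countable_support N.finite_measure_distr) measurable
  then have "countable bad" unfolding bad_def using Q by (intro countable_UN) auto
  then have "countable (\<Union>q\<in>Q. (\<lambda>s. s / q) ` bad)" using Q by (intro countable_UN) auto
  moreover have "uncountable {0<..<1::real}" by (simp add: uncountable_open_interval)
  ultimately have "\<not> {0<..<1} \<subseteq> (\<Union>q\<in>Q. (\<lambda>s. s / q) ` bad)" using countable_subset by blast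
  then obtain \<xi> where "\<xi> \<in> {0<..<1}" and \<xi>_bad: "\<xi> \<notin> (\<Union>q\<in>Q. (\<lambda>s. s / q) ` bad)" by blast
  then have \<xi>: "0 < \<xi>" by simp
  define D where "D = (\<lambda>q. q * \<xi>) ` Q"
  have "countable D" using Q by (simp add: D_def)
  moreover have D_pos: "\<forall>s\<in>D. 0 < s" using \<xi> by (auto simp: D_def Q_def)
  moreover have "\<exists>r\<in>D. s < r \<and> r < t" if st: "0 \<le> s \<and> s < t" for s t
  proof -
    have "s / \<xi> < t / \<xi>" using st \<xi> by (simp add: divide_strict_right_mono)
    then obtain q where q: "q \<in> \<rat>" "s / \<xi> < q" "q < t / \<xi>" using Rats_dense_in_real by blast
    have "0 \<le> s / \<xi>" using st \<xi> by simp
    then have "q \<in> Q" using q by (simp add: Q_def)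
    moreover have "s < q * \<xi>" "q * \<xi> < t" using q \<xi> by (simp_all add: field_simps)
    ultimately show ?thesis by (auto simp: D_def)
  qed
  moreover have "AE \<omega> in N. \<Phi> (1 / u) \<omega> \<noteq> ennreal s" if s: "s \<in> D" and u: "u \<in> Q" for s u
  proof -
    obtain q where q: "q \<in> Q" "s = q * \<xi>" using s by (auto simp: D_def)
    then have "\<xi> = s / q" by (auto simp: Q_def)
    then have "s \<notin> bad" using \<xi>_bad q(1) by blast
    then have "measure (distr N borel (\<lambda>\<omega>. enn2real (\<Phi> (1 / u) \<omega>))) {s} = 0" using u by (auto simp: bad_def)
    then have "measure N {\<omega> \<in> space N. enn2real (\<Phi> (1 / u) \<omega>) = s} = 0"
      by (simp add: measure_distr vimage_def Int_def conj_commute)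
    then have "AE \<omega> in N. enn2real (\<Phi> (1 / u) \<omega>) \<noteq> s"
      by (subst (asm) N.prob_Collect_eq_0) auto
    then show ?thesis using D_pos s by (auto elim!: eventually_mono)
  qed
  ultimately show ?thesis unfolding Q_def[symmetric] by (intro exI[of _ D]) simp
qed

text \<open>\<open>T_upper\<close> bounds the probabilities by that of \<open>\<Phi>_ge S\<close>,
  \<open>T_lower\<close> by those of perturbed events. Absence of atoms at the levels turns
  \<open>\<Phi>_ge\<close> into \<open>\<Phi>_gt\<close>; by \<open>\<Phi>_perturb_tendsto\<close> a
  small perturbation can be fixed before \<epsilon> tends to zero.\<close>

lemma T_prob_tendsto:
  assumes S: "finite S" "S \<subseteq> {0<..} \<times> {0<..}"
    and atoms: "\<And>u s. (u, s) \<in> S \<Longrightarrow> AE \<omega> in N. \<Phi> (1 / u) \<omega> \<noteq> ennreal s"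
  shows "((\<lambda>\<epsilon>. measure M (T_gt S \<epsilon>))
    \<longlongrightarrow> measure N (\<Phi>_gt S)) (at_right 0)"
proof (rule tendstoI)
  fix e :: real assume "0 < e"
  define p where "p = measure N (\<Phi>_gt S)"
  have G_sets: "\<Phi>_gt S \<in> sets N"
    using S(1) unfolding case_prod_beta by measurable
  have "AE \<omega> in N. \<forall>x\<in>S. ennreal (snd x) \<noteq> \<Phi> (1 / fst x) \<omega>"
  proof (rule AE_finite_allI[OF S(1)])
    fix x assume "x \<in> S"
    then have "AE \<omega> in N. \<Phi> (1 / fst x) \<omega> \<noteq> ennreal (snd x)" by (intro atoms) simp
    then show "AE \<omega> in N. ennreal (snd x) \<noteq> \<Phi> (1 / fst x) \<omega>" by eventually_elim (rule not_sym)
  qed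
  then have ae: "AE \<omega> in N. \<omega> \<in> (\<Phi>_ge S) \<longleftrightarrow>
      \<omega> \<in> (\<Phi>_gt S)"
    by eventually_elim (auto simp: le_less case_prod_beta)
  have p_le: "measure N (\<Phi>_ge S) = p"
    unfolding p_def by (rule N.finite_measure_eq_AE[OF ae \<Phi>_ge_sets[OF S(1)] G_sets])
  have "\<forall>\<^sub>F k in sequentially. p - e / 2 <
      measure N (\<Phi>_gt_perturbed (\<tau> k) S)"
    using \<open>0 < e\<close> by (intro order_tendstoD(1)[OF \<Phi>_perturb_tendsto[OF S]]) (simp add: p_def)
  then obtain k where k: "p - e / 2 <
      measure N (\<Phi>_gt_perturbed (\<tau> k) S)"
    using eventually_happens' sequentially_bot by blast
  have "0 < e / 2" using \<open>0 < e\<close> by simp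
  from T_lower[OF S this \<tau>(1,2)[of k]] T_upper[OF S \<open>0 < e\<close>]
  show "\<forall>\<^sub>F \<epsilon> in at_right 0. dist (measure M (T_gt S \<epsilon>))
      (measure N (\<Phi>_gt S)) < e"
    unfolding p_def[symmetric] p_le
    by eventually_elim (use k in \<open>unfold dist_real_def, linarith\<close>)
qed

lemma T_converges_weakly:
  "converges_weakly (at_right 0) M1_local_topology
     M (\<lambda>\<epsilon> \<omega>. \<lambda>u\<in>{0<..}. enn2real (T (\<epsilon> / u) \<omega>) / a \<epsilon>)
     N (\<lambda>\<omega>. \<lambda>u\<in>{0<..}. enn2real (\<Phi> (1 / u) \<omega>))"
proof -
  define U :: "real set" where "U = {u\<in>\<rat>. 0 < u}"
  obtain D where D: "countable D" "\<And>s. s \<in> D \<Longrightarrow> 0 < s" "\<And>s t. 0 \<le> s \<Longrightarrow> s < t \<Longrightarrow> \<exists>r\<in>D. s < r \<and> r < t"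
    and atoms: "\<And>s u. s \<in> D \<Longrightarrow> u \<in> U \<Longrightarrow> AE \<omega> in N. \<Phi> (1 / u) \<omega> \<noteq> ennreal s"
    using generic_levels unfolding U_def[symmetric] by (elim exE conjE) simp
  have U: "countable U" "\<And>u. u \<in> U \<Longrightarrow> 0 < u" "\<And>s t. 0 < s \<Longrightarrow> s < t \<Longrightarrow> \<exists>u\<in>U. s < u \<and> u < t"
  proof -
    show "countable U" unfolding U_def by (rule countable_pos_rats)
    fix s t :: real assume st: "0 < s" "s < t"
    then obtain u where "u \<in> \<rat>" "s < u" "u < t" using Rats_dense_in_real by blast
    then show "\<exists>u\<in>U. s < u \<and> u < t" using st(1) by (intro bexI[of _ u]) (auto simp: U_def)
  qed (simp add: U_def)
  have "U \<times> D \<noteq> {}" using U(3)[of 1 2] D(3)[of 1 2] by auto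
  \<comment> \<open>One enumeration of all pairs of a rational time and a generic level; finitely
    many bits then correspond to a finite set \<open>S\<close> in
    \<open>T_prob_tendsto\<close>.\<close>
  define p where "p = from_nat_into (U \<times> D)"
  have p: "range p = U \<times> D"
    unfolding p_def using U(1) D(1) \<open>U \<times> D \<noteq> {}\<close> by (intro range_from_nat_into) auto
  have p_in: "fst (p j) \<in> U" "snd (p j) \<in> D" "0 < fst (p j)" "0 < snd (p j)" for j
    using p U(2) D(2) rangeI[of p j] by auto
  define b where "b j x = (snd (p j) < x (fst (p j)))" for j and x :: "real \<Rightarrow> real"
  let ?X = "\<lambda>\<epsilon> \<omega>. \<lambda>u\<in>{0<..}. enn2real (T (\<epsilon> / u) \<omega>) / a \<epsilon>"
  let ?Y = "\<lambda>\<omega>. \<lambda>u\<in>{0<..}. enn2real (\<Phi> (1 / u) \<omega>)"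
  have bX: "b j (?X \<epsilon> \<omega>) \<longleftrightarrow> snd (p j) < enn2real (T (\<epsilon> / fst (p j)) \<omega>) / a \<epsilon>" for j \<epsilon> \<omega>
    using p_in by (simp add: b_def)
  have bY: "b j (?Y \<omega>) \<longleftrightarrow> snd (p j) < enn2real (\<Phi> (1 / fst (p j)) \<omega>)" for j \<omega>
    using p_in by (simp add: b_def)
  have X_sets: "{\<omega> \<in> space M. b j (?X \<epsilon> \<omega>)} \<in> sets M" for j \<epsilon>
    unfolding bX by measurable
  have Y_sets: "{\<omega> \<in> space N. b j (?Y \<omega>)} \<in> sets N" for j
    unfolding bY by measurable
  have lim: "((\<lambda>\<epsilon>. measure M {\<omega> \<in> space M. \<forall>j\<in>J. b j (?X \<epsilon> \<omega>)})
      \<longlongrightarrow> measure N {\<omega> \<in> space N. \<forall>j\<in>J. b j (?Y \<omega>)}) (at_right 0)" if J: "finite J" for J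
  proof -
    let ?S = "p ` J"
    have S: "finite ?S" "?S \<subseteq> {0<..} \<times> {0<..}"
      using J p_in by (simp_all add: image_subset_iff mem_Times_iff)
    have limS: "((\<lambda>\<epsilon>. measure M (T_gt ?S \<epsilon>))
        \<longlongrightarrow> measure N (\<Phi>_gt ?S)) (at_right 0)"
    proof (rule T_prob_tendsto[OF S])
      fix u s assume "(u, s) \<in> ?S"
      then have "u \<in> U" "s \<in> D" using p by auto
      then show "AE \<omega> in N. \<Phi> (1 / u) \<omega> \<noteq> ennreal s" by (rule atoms[rotated])
    qed
    \<comment> \<open>Comparisons in the extended half-line and after \<open>enn2real\<close> agree
      off the null set where some passage time is infinite.\<close>
    have "measure N (\<Phi>_gt ?S) = measure N {\<omega> \<in> space N. \<forall>j\<in>J. b j (?Y \<omega>)}"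
    proof (rule N.finite_measure_eq_AE)
      show "(\<Phi>_gt ?S) \<in> sets N"
        using S(1) unfolding case_prod_beta by measurable
      show "{\<omega> \<in> space N. \<forall>j\<in>J. b j (?Y \<omega>)} \<in> sets N"
        using J unfolding bY by measurable
      show "AE \<omega> in N. \<omega> \<in> (\<Phi>_gt ?S) \<longleftrightarrow>
          \<omega> \<in> {\<omega> \<in> space N. \<forall>j\<in>J. b j (?Y \<omega>)}"
        using \<Phi>_finite_all
      proof eventually_elim
        case (elim \<omega>)
        have "ennreal (snd (p j)) < \<Phi> (1 / fst (p j)) \<omega> \<longleftrightarrow> snd (p j) < enn2real (\<Phi> (1 / fst (p j)) \<omega>)" for j
        proof -
          have "\<Phi> (1 / fst (p j)) \<omega> < \<infinity>" using elim p_in(3)[of j] by simp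
          then show ?thesis using p_in(4)[of j]
            by (cases "\<Phi> (1 / fst (p j)) \<omega>") (auto simp: ennreal_less_iff)
        qed
        then show ?case by (simp add: bY case_prod_beta del: restrict_apply)
      qed
    qed
    moreover have "\<forall>\<^sub>F \<epsilon> in at_right 0. measure M (T_gt ?S \<epsilon>) =
        measure M {\<omega> \<in> space M. \<forall>j\<in>J. b j (?X \<epsilon> \<omega>)}"
      using a_gt[of 0] eventually_at_right_less[of "0::real"]
    proof eventually_elim
      case (elim \<epsilon>)
      show ?case
      proof (rule M.finite_measure_eq_AE)
        show "T_gt ?S \<epsilon> \<in> sets M"
          by (rule T_gt_sets[OF S(1)])
        show "{\<omega> \<in> space M. \<forall>j\<in>J. b j (?X \<epsilon> \<omega>)} \<in> sets M"
          using J unfolding bX by measurable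
        show "AE \<omega> in M. \<omega> \<in> (T_gt ?S \<epsilon>) \<longleftrightarrow>
            \<omega> \<in> {\<omega> \<in> space M. \<forall>j\<in>J. b j (?X \<epsilon> \<omega>)}"
          using T_finite
        proof eventually_elim
          case fin: (elim \<omega>)
          have "ennreal (snd (p j) * a \<epsilon>) < T (\<epsilon> / fst (p j)) \<omega> \<longleftrightarrow> snd (p j) < enn2real (T (\<epsilon> / fst (p j)) \<omega>) / a \<epsilon>" for j
          proof -
            have "T (\<epsilon> / fst (p j)) \<omega> < \<infinity>" using fin elim(2) p_in(3)[of j] by simp
            moreover have "0 < snd (p j) * a \<epsilon>" using p_in(4)[of j] elim(1) by simp
            ultimately show ?thesis using elim(1)
              by (cases "T (\<epsilon> / fst (p j)) \<omega>") (auto simp: ennreal_less_iff pos_less_divide_eq)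
          qed
          then show ?case by (simp add: bX case_prod_beta del: restrict_apply)
        qed
      qed
    qed
    ultimately show ?thesis using Lim_transform_eventually[OF limS] by simp
  qed
  show ?thesis
    unfolding M1_local_topology_def
  proof (rule converges_weakly_pattern[where E=nonneg_mono_paths and b=b])
    show "nonneg_mono_paths \<subseteq> cadlag_space {0<..}"
      using mono_paths_subset_cadlag by (auto simp: nonneg_mono_paths_def)
    show "converges_locally M1_dist y x"
      if "x \<in> nonneg_mono_paths" "\<And>k. y k \<in> nonneg_mono_paths" "\<And>k j. j < k \<Longrightarrow> b j (y k) = b j x" for x y
      by (rule nonneg_mono_paths_bits_converge[OF that(1,2) U(2,3) D(3) p])
        (use that(3) in \<open>simp_all add: b_def\<close>)
    show "\<forall>\<^sub>F \<epsilon> in at_right 0. AE \<omega> in M. ?X \<epsilon> \<omega> \<in> nonneg_mono_paths"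
      using a_gt[of 0] eventually_at_right_less[of "0::real"] by eventually_elim (rule T_path)
    show "\<forall>\<^sub>F \<epsilon> in at_right 0. \<forall>j. {\<omega> \<in> space M. b j (?X \<epsilon> \<omega>)} \<in> sets M"
      using X_sets by simp
  qed (use M.prob_space_axioms N.prob_space_axioms \<Phi>_path Y_sets lim in simp_all)
qed

text \<open>With s fixed so that \<open>\<Phi> 1\<close> rarely reaches s, \<open>T_upper\<close>
  for the single pair (1, s) bounds the probability that T \<epsilon> exceeds s * a \<epsilon>.
  Since \<epsilon> powr \<gamma> * a \<epsilon> tends to zero, the event in question is eventually
  contained in that one.\<close>

lemma T_negligible:
  assumes \<gamma>: "\<gamma> > 1 / (1 - h)" and "0 < \<delta>"
  shows "((\<lambda>\<epsilon>. measure M {\<omega> \<in> space M. ennreal (\<epsilon> powr \<gamma>) * T \<epsilon> \<omega> > ennreal \<delta>}) \<longlongrightarrow> 0) (at_right 0)"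
proof (rule tendstoI)
  fix e :: real assume "0 < e"
  define A where "A n = {\<omega> \<in> space N. ennreal (real (Suc n)) \<le> \<Phi> 1 \<omega>}" for n
  have [measurable]: "A n \<in> sets N" for n unfolding A_def by measurable
  have "(\<lambda>n. measure N (A n)) \<longlonglongrightarrow> measure N (\<Inter>n. A n)"
  proof (rule N.finite_Lim_measure_decseq)
    show "decseq A"
      by (intro decseq_SucI) (auto simp: A_def intro: order_trans[rotated] ennreal_leI simp del: of_nat_Suc)
  qed auto
  moreover have "measure N (\<Inter>n. A n) = 0"
  proof -
    have "AE \<omega> in N. \<omega> \<notin> (\<Inter>n. A n)"
      using \<Phi>_finite[OF zero_less_one]
    proof eventually_elim
      case (elim \<omega>)
      then obtain n :: nat where "\<Phi> 1 \<omega> < of_nat n" using ennreal_Ex_less_of_nat[of "\<Phi> 1 \<omega>"] by (auto simp: less_top)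
      also have "(of_nat n :: ennreal) \<le> ennreal (real (Suc n))" by (simp add: ennreal_of_nat_eq_real_of_nat ennreal_leI)
      finally show ?case by (auto simp: A_def not_le intro!: exI[of _ n])
    qed
    then show ?thesis by (subst N.prob_eq_0) auto
  qed
  ultimately have "(\<lambda>n. measure N (A n)) \<longlonglongrightarrow> 0" by simp
  then have "\<forall>\<^sub>F n in sequentially. measure N (A n) < e / 2"
    using \<open>0 < e\<close> by (intro order_tendstoD(2)) auto
  then obtain n where n: "measure N (A n) < e / 2" using eventually_happens' sequentially_bot by blast
  define s where "s = real (Suc n)"
  have s: "0 < s" by (simp add: s_def)
  have "\<forall>\<^sub>F \<epsilon> in at_right 0. measure M {\<omega> \<in> space M. ennreal (s * a \<epsilon>) < T \<epsilon> \<omega>} < measure N (A n) + e / 2"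
    using T_upper[of "{(1, s)}" "e / 2"] s \<open>0 < e\<close> by (simp add: A_def s_def)
  moreover have "\<forall>\<^sub>F \<epsilon> in at_right 0. \<epsilon> powr \<gamma> * a \<epsilon> < \<delta> / s"
    using \<open>0 < \<delta>\<close> s by (intro order_tendstoD(2)[OF a_times_powr[OF \<gamma>]]) simp
  ultimately show "\<forall>\<^sub>F \<epsilon> in at_right 0.
      dist (measure M {\<omega> \<in> space M. ennreal (\<epsilon> powr \<gamma>) * T \<epsilon> \<omega> > ennreal \<delta>}) 0 < e"
    using a_gt[of 0]
  proof eventually_elim
    case (elim \<epsilon>)
    have "{\<omega> \<in> space M. ennreal (\<epsilon> powr \<gamma>) * T \<epsilon> \<omega> > ennreal \<delta>} \<subseteq> {\<omega> \<in> space M. ennreal (s * a \<epsilon>) < T \<epsilon> \<omega>}"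
    proof (intro Collect_mono impI conjI; elim conjE)
      fix \<omega> assume gt: "ennreal (\<epsilon> powr \<gamma>) * T \<epsilon> \<omega> > ennreal \<delta>"
      show "ennreal (s * a \<epsilon>) < T \<epsilon> \<omega>"
      proof (rule ccontr)
        assume "\<not> ?thesis"
        then have "ennreal (\<epsilon> powr \<gamma>) * T \<epsilon> \<omega> \<le> ennreal (\<epsilon> powr \<gamma>) * ennreal (s * a \<epsilon>)"
          by (intro mult_left_mono) auto
        also have "\<dots> = ennreal (\<epsilon> powr \<gamma> * (s * a \<epsilon>))"
          using elim(3) s by (simp add: ennreal_mult)
        also have "\<dots> \<le> ennreal \<delta>"
          using elim(2) s by (intro ennreal_leI) (simp add: field_simps)
        finally show False using gt by simp
      qed
    qed
    then have "measure M {\<omega> \<in> space M. ennreal (\<epsilon> powr \<gamma>) * T \<epsilon> \<omega> > ennreal \<delta>} \<le>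
        measure M {\<omega> \<in> space M. ennreal (s * a \<epsilon>) < T \<epsilon> \<omega>}"
      by (intro M.finite_measure_mono) auto
    then show ?case using elim(1) n by (simp add: dist_real_def)
  qed
qed

section \<open>Predictability of the limit passage time\<close>

abbreviation "\<F> \<equiv> usual_augmentation N (\<lambda>t \<omega>. (Y1 t \<omega>, Y2 t \<omega>))"

abbreviation "\<G> s \<equiv>
  sigma_sets (space N) (natural_generator N (\<lambda>t \<omega>. (Y1 t \<omega>, Y2 t \<omega>)) s \<union> null_sets (completion N))"

lemma \<Phi>_less_rat_iff:
  assumes "\<omega> \<in> space N"
  shows "\<Phi> u \<omega> < ennreal y \<longleftrightarrow> (\<exists>r\<in>\<rat>. 0 < r \<and> r < y \<and> c * (sqrt (Y2 r \<omega>) / r) < u)"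
  unfolding \<Phi>_eq_rat[OF assms] INF_less_iff by (auto simp: ennreal_less_iff split: if_splits)

text \<open>The strict inequality uses \<open>Y2\<close> only at rational times before y, all of
  which are at most s.\<close>

lemma \<Phi>_less_generated:
  assumes "ennreal b \<le> s" "0 \<le> y" "y \<le> b"
  shows "{\<omega> \<in> space N. \<Phi> u \<omega> < ennreal y} \<in>
    \<G> s"
proof -
  let ?gen = "natural_generator N (\<lambda>t \<omega>. (Y1 t \<omega>, Y2 t \<omega>)) s \<union> null_sets (completion N)"
  let ?G = "sigma (space N) ?gen"
  have gen: "?gen \<subseteq> Pow (space N)"
    using sets.sets_into_space[of _ "completion N"] by (fastforce simp: natural_generator_def null_sets_def)
  have Y2_meas: "Y2 r \<in> borel_measurable ?G" if r: "0 < r" "r < y" for r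
  proof (rule measurableI)
    fix B :: "real set" assume "B \<in> sets borel"
    moreover have "(snd :: real \<times> real \<Rightarrow> real) \<in> borel_measurable borel"
      by (intro borel_measurable_continuous_onI continuous_intros)
    ultimately have B: "snd -` B \<in> sets (borel :: (real \<times> real) measure)"
      using measurable_sets[of snd borel borel B] by simp
    have "ennreal r \<le> s" using r assms by (intro order_trans[OF _ assms(1)] ennreal_leI) simp
    then have "(\<lambda>\<omega>. (Y1 r \<omega>, Y2 r \<omega>)) -` (snd -` B) \<inter> space N \<in> ?gen"
      using B r unfolding natural_generator_def
      by (intro UnI1 CollectI exI[of _ r] exI[of _ "snd -` B"] conjI) simp_all
    then have "Y2 r -` B \<inter> space N \<in> ?gen" by (simp add: vimage_def)
    then show "Y2 r -` B \<inter> space ?G \<in> sets ?G" using gen by (simp add: space_measure_of_conv sets_measure_of sigma_sets.Basic)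
  qed simp
  have "{\<omega> \<in> space N. \<Phi> u \<omega> < ennreal y} = (\<Union>r\<in>{r\<in>\<rat>. 0 < r \<and> r < y}. {\<omega> \<in> space ?G. c * (sqrt (Y2 r \<omega>) / r) < u})"
    using assms(2) by (auto simp: \<Phi>_less_rat_iff space_measure_of_conv)
  also have "\<dots> \<in> sets ?G"
  proof (rule sets.countable_UN'')
    show "countable {r\<in>\<rat>. 0 < r \<and> r < y}" by (rule countable_subset[OF _ countable_rat]) auto
    fix r assume "r \<in> {r\<in>\<rat>. 0 < r \<and> r < y}"
    then have [measurable]: "Y2 r \<in> borel_measurable ?G" using Y2_meas by simp
    show "{\<omega> \<in> space ?G. c * (sqrt (Y2 r \<omega>) / r) < u} \<in> sets ?G" by measurable
  qed
  finally show ?thesis using gen by (simp add: sets_measure_of)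
qed

text \<open>For finite t, the event that \<open>\<Phi> u\<close> is at most t is an intersection of
  events with strict inequalities at levels y n decreasing to t. These levels can be kept from
  exceeding any prescribed s > t, which is what the right-continuous filtration asks for.\<close>

lemma \<Phi>_stopping_time: "stopping_time \<F> (\<Phi> u)"
proof (rule stopping_timeI)
  fix t :: ennreal
  have "{\<omega> \<in> space N. \<Phi> u \<omega> \<le> t} \<in> sets (\<F> t)"
  proof (rule sets_usual_augmentationI)
    fix s :: ennreal assume s: "t < s \<or> s = \<infinity>"
    show "{\<omega> \<in> space N. \<Phi> u \<omega> \<le> t} \<in> \<G> s"
    proof (cases t)
      case top
      then show ?thesis using sigma_sets_top by simp
    next
      case (real t')
      then have "t < s" using s by auto
      then obtain b where b: "t' < b" "ennreal b \<le> s"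
      proof (cases s)
        case (real s')
        then show ?thesis using that[of s'] \<open>t < s\<close> \<open>t = ennreal t'\<close> \<open>0 \<le> t'\<close> by (auto simp: ennreal_less_iff)
      qed (use that[of "t' + 1"] in auto)
      define y where "y n = t' + (b - t') / real (Suc n)" for n
      have y: "t' < y n" "y n \<le> b" for n
      proof -
        show "t' < y n" using b(1) by (simp add: y_def)
        have "(b - t') / real (Suc n) \<le> (b - t') / 1" using b(1) by (intro divide_left_mono) auto
        then show "y n \<le> b" by (simp add: y_def)
      qed
      have y_lim: "y \<longlonglongrightarrow> t'"
      proof -
        have "(\<lambda>n. t' + (b - t') * inverse (real (Suc n))) \<longlonglongrightarrow> t' + (b - t') * 0"
          by (intro tendsto_intros LIMSEQ_inverse_real_of_nat)
        then show ?thesis by (simp add: y_def[abs_def] divide_inverse)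
      qed
      have "{\<omega> \<in> space N. \<Phi> u \<omega> \<le> t} = (\<Inter>n. {\<omega> \<in> space N. \<Phi> u \<omega> < ennreal (y n)})"
      proof
        show "{\<omega> \<in> space N. \<Phi> u \<omega> \<le> t} \<subseteq> (\<Inter>n. {\<omega> \<in> space N. \<Phi> u \<omega> < ennreal (y n)})"
        proof
          fix \<omega> assume \<omega>: "\<omega> \<in> {\<omega> \<in> space N. \<Phi> u \<omega> \<le> t}"
          have "t < ennreal (y n)" for n using y(1)[of n] real by (simp add: ennreal_less_iff)
          then show "\<omega> \<in> (\<Inter>n. {\<omega> \<in> space N. \<Phi> u \<omega> < ennreal (y n)})" using \<omega> by (auto intro: le_less_trans)
        qed
        show "(\<Inter>n. {\<omega> \<in> space N. \<Phi> u \<omega> < ennreal (y n)}) \<subseteq> {\<omega> \<in> space N. \<Phi> u \<omega> \<le> t}"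
        proof
          fix \<omega> assume \<omega>: "\<omega> \<in> (\<Inter>n. {\<omega> \<in> space N. \<Phi> u \<omega> < ennreal (y n)})"
          have "(\<lambda>n. ennreal (y n)) \<longlonglongrightarrow> ennreal t'" by (rule tendsto_ennrealI[OF y_lim])
          then have "\<Phi> u \<omega> \<le> ennreal t'"
            by (rule LIMSEQ_le_const) (use \<omega> in \<open>auto intro!: exI[of _ 0] less_imp_le\<close>)
          then show "\<omega> \<in> {\<omega> \<in> space N. \<Phi> u \<omega> \<le> t}" using \<omega> real by auto
        qed
      qed
      also have "\<dots> \<in> \<G> s"
      proof (rule sigma_sets_INTER)
        show "{\<omega> \<in> space N. \<Phi> u \<omega> < ennreal (y n)} \<in> \<G> s" for n
          using y[of n] real b(2) by (intro \<Phi>_less_generated[of b]) auto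
        show "natural_generator N (\<lambda>t \<omega>. (Y1 t \<omega>, Y2 t \<omega>)) s \<union> null_sets (completion N) \<subseteq> Pow (space N)"
          using sets.sets_into_space[of _ "completion N"] by (fastforce simp: natural_generator_def null_sets_def)
      qed simp
      finally show ?thesis .
    qed
  qed
  then show "Measurable.pred (\<F> t) (\<lambda>\<omega>. \<Phi> u \<omega> \<le> t)"
    by (simp add: pred_def space_usual_augmentation)
qed

text \<open>At \<open>s = \<Phi> u\<close> the path \<open>c * sqrt (Y2 s) / s\<close> is at most \<open>u\<close>; since \<open>Y2\<close> cannot jump downwards, its left
  limit is also at most \<open>u\<close>, so every level above \<open>u\<close> is undercut strictly before \<open>s\<close>.\<close>

lemma \<Phi>_strict_antimono:
  assumes \<omega>: "\<omega> \<in> space N" and jumps: "\<And>t. 0 < t \<Longrightarrow> left_lim 0 (\<lambda>t. Y2 t \<omega>) t \<le> Y2 t \<omega>"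
    and u: "u < v" "0 < \<Phi> u \<omega>" "\<Phi> u \<omega> < \<infinity>"
  shows "\<Phi> v \<omega> < \<Phi> u \<omega>"
proof -
  obtain s where s: "\<Phi> u \<omega> = ennreal s" "0 \<le> s" using u(3) by (cases "\<Phi> u \<omega>") auto
  then have "0 < s" using u(2) by simp
  let ?g = "\<lambda>t. c * (sqrt (Y2 t \<omega>) / t)"
  have cad: "cadlag_on {0..} (\<lambda>t. Y2 t \<omega>)" using Y2_cadlag \<omega> by (auto simp: cadlag_process_def)
  \<comment> \<open>Were the path above u at s, it would be so on an interval to the right of s by
    right-continuity; no earlier time undercuts u by the definition of the infimum, so
    \<open>\<Phi> u\<close> would be larger than s.\<close>
  have "?g s \<le> u"
  proof (rule ccontr)
    assume "\<not> ?thesis"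
    then have "u < ?g s" by simp
    moreover have "(?g \<longlongrightarrow> ?g s) (at_right s)"
      using \<open>0 < s\<close> by (intro tendsto_mult_left tendsto_divide tendsto_ident_at cadlag_on_at_right[OF cadlag_sqrt_Y2[OF \<omega>]]) auto
    ultimately have "\<forall>\<^sub>F t in at_right s. u < ?g t" by (intro order_tendstoD(1))
    then obtain b where b: "s < b" "\<And>t. s < t \<Longrightarrow> t < b \<Longrightarrow> u < ?g t"
      using eventually_at_right[of s "s + 1"] by auto
    have "\<Phi> u \<omega> < ennreal b" using s b(1) by (simp add: ennreal_less_iff)
    then obtain r where r: "0 < r" "r < b" "?g r < u" by (auto simp: limit_passage_less_iff)
    have "\<not> r < s" using r s(1) limit_passage_less_iff[of Y2 c u \<omega> s] by auto
    then show False using r b(2)[of r] \<open>u < ?g s\<close> by (cases "r = s") auto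
  qed
  moreover have "(?g \<longlongrightarrow> c * (sqrt (left_lim 0 (\<lambda>t. Y2 t \<omega>) s) / s)) (at_left s)"
    using \<open>0 < s\<close> by (intro tendsto_mult_left tendsto_divide tendsto_ident_at tendsto_real_sqrt cadlag_on_left_lim[OF cad]) auto
  moreover have "c * (sqrt (left_lim 0 (\<lambda>t. Y2 t \<omega>) s) / s) \<le> ?g s"
    using jumps[OF \<open>0 < s\<close>] c \<open>0 < s\<close> by (intro mult_left_mono divide_right_mono real_sqrt_le_mono) auto
  ultimately have "\<forall>\<^sub>F t in at_left s. ?g t < v"
    using u(1) by (intro order_tendstoD(2)[where y="c * (sqrt (left_lim 0 (\<lambda>t. Y2 t \<omega>) s) / s)"]) linarith+
  moreover have "\<forall>\<^sub>F t in at_left s. 0 < t \<and> t < s"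
    using \<open>0 < s\<close> by (auto simp: eventually_at_left)
  ultimately have "\<forall>\<^sub>F t in at_left s. ?g t < v \<and> 0 < t \<and> t < s" by eventually_elim simp
  then obtain t where "?g t < v \<and> 0 < t \<and> t < s"
    using eventually_happens'[OF trivial_limit_at_left_real] by blast
  then show ?thesis unfolding s(1) limit_passage_less_iff by blast
qed

text \<open>Continuity at u makes the announcing times converge; that they stay strictly before the
  limit comes from \<open>\<Phi>_strict_antimono\<close>, which applies almost surely by
  \<open>\<Phi>_finite\<close> and the absence of negative jumps.\<close>

lemma \<Phi>_predictable:
  assumes "0 < u" and cont: "AE \<omega> in N. isCont (\<lambda>v. \<Phi> v \<omega>) u"
  shows "predictable_time N \<F> (\<Phi> u)"
  unfolding predictable_time_def
proof (intro conjI exI[of _ "\<lambda>n. \<Phi> (u + 1 / real (Suc n))"] allI \<Phi>_stopping_time)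
  show "AE \<omega> in N. incseq (\<lambda>n. \<Phi> (u + 1 / real (Suc n)) \<omega>) \<and> (\<lambda>n. \<Phi> (u + 1 / real (Suc n)) \<omega>) \<longlonglongrightarrow> \<Phi> u \<omega> \<and>
      (0 < \<Phi> u \<omega> \<longrightarrow> (\<forall>n. \<Phi> (u + 1 / real (Suc n)) \<omega> < \<Phi> u \<omega>))"
    using cont Y2_no_neg_jumps \<Phi>_finite[OF assms(1)] AE_space
  proof eventually_elim
    case (elim \<omega>)
    have "(\<lambda>n. u + inverse (real (Suc n))) \<longlonglongrightarrow> u + 0"
      by (intro tendsto_intros LIMSEQ_inverse_real_of_nat)
    then have "(\<lambda>n. u + 1 / real (Suc n)) \<longlonglongrightarrow> u" by (simp add: divide_inverse)
    then have "(\<lambda>n. \<Phi> (u + 1 / real (Suc n)) \<omega>) \<longlonglongrightarrow> \<Phi> u \<omega>"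
      by (rule isCont_tendsto_compose[OF elim(1)])
    moreover have "incseq (\<lambda>n. \<Phi> (u + 1 / real (Suc n)) \<omega>)"
      by (intro incseq_SucI limit_passage_antimono) (auto simp: field_simps)
    moreover have "\<Phi> (u + 1 / real (Suc n)) \<omega> < \<Phi> u \<omega>" if "0 < \<Phi> u \<omega>" for n
      using elim that by (intro \<Phi>_strict_antimono) auto
    ultimately show ?case by blast
  qed
qed

end

theorem theorem3p1:
  fixes M :: "'a measure" and Z1 Z2 :: "real \<Rightarrow> 'a \<Rightarrow> real"
    and N :: "'b measure" and Y1 Y2 :: "real \<Rightarrow> 'b \<Rightarrow> real"
    and \<mu> h \<nu> c :: real and L Ainv a :: "real \<Rightarrow> real"
    and T :: "real \<Rightarrow> 'a \<Rightarrow> ennreal" and \<Phi> :: "real \<Rightarrow> 'b \<Rightarrow> ennreal"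
  defines "a \<equiv> \<lambda>\<epsilon>. Ainv (1 / \<epsilon>)"
    and "T \<equiv> stopping_rule Z2 \<nu> c"
    and "\<Phi> \<equiv> limit_passage Y2 c"
  assumes "functional_limit M Z1 Z2 \<mu> h L N Y1 Y2"
    and "asymptotic_inverse (\<lambda>x. x powr (1 - h) * L x) Ainv"
    and "0 < \<nu>" and "\<nu> < 1 / (1 - h)"
    and "no_early_stopping M Z2 a \<nu>"
    and "0 < c"
  shows
    "converges_weakly (at_right 0) M1_local_topology
       M (\<lambda>\<epsilon> \<omega>. \<lambda>u\<in>{0<..}. enn2real (T (\<epsilon> / u) \<omega>) / a \<epsilon>)
       N (\<lambda>\<omega>. \<lambda>u\<in>{0<..}. enn2real (\<Phi> (1 / u) \<omega>))
     \<and> (\<forall>t>0. (\<forall>b>0. distr N borel (\<Phi> (b * t)) =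
                       distr N borel (\<lambda>\<omega>. ennreal (b powr (1 / (h - 1))) * \<Phi> t \<omega>))
             \<and> (AE \<omega> in N. \<Phi> t \<omega> < \<infinity>))
     \<and> (\<forall>\<gamma>. \<gamma> > 1 / (1 - h) \<longrightarrow> (\<forall>\<delta>>0.
          ((\<lambda>\<epsilon>. measure M {\<omega> \<in> space M. ennreal (\<epsilon> powr \<gamma>) * T \<epsilon> \<omega> > ennreal \<delta>})
             \<longlongrightarrow> 0) (at_right 0)))
     \<and> (\<forall>u>0. (AE \<omega> in N. isCont (\<lambda>v. \<Phi> v \<omega>) u) \<longrightarrow>
          predictable_time N (usual_augmentation N (\<lambda>t \<omega>. (Y1 t \<omega>, Y2 t \<omega>))) (\<Phi> u))"
proof -
  interpret lim: stopping_limit M Z1 Z2 \<mu> h L N Y1 Y2 Ainv \<nu> c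
    using assms by (simp add: stopping_limit_def stopping_limit_axioms_def a_def)
  have a_eq: "a = lim.a" unfolding a_def lim.a_def[abs_def] ..
  show ?thesis
    unfolding T_def \<Phi>_def a_eq
    using lim.T_converges_weakly lim.\<Phi>_scaling lim.\<Phi>_finite lim.T_negligible lim.\<Phi>_predictable by blast
qed

end
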